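(* For any helper rates $R_e\ge R_d\ge0$, $\mathcal R_g^O(R_e,R_d,D)=\mathcal R(R_d,D)$.
   Context: Let $\mathcal X,\mathcal Y,\mathcal Z,\hat{\mathcal X}$ be finite alphabets, $d:\mathcal X\times\hat{\mathcal X}\to[0,\infty)$, and $(X_i,Y_i,Z_i)$ i.i.d. $\sim p(x,y)p(z|x)$ (Markov chain $Y-X-Z$). An $(n,M,M_e,M_d,D)$ code with different helper messages consists of helper encoders $f_e:\mathcal Y^n\to\{1,\dots,M_e\}$ (message to the source encoder) and $f_d:\mathcal Y^n\to\{1,\dots,M_d\}$ (message to the decoder), a source encoder $f:\mathcal X^n\times\{1,\dots,M_e\}\to\{1,\dots,M\}$, and a decoder that, using $f(X^n,f_e(Y^n))$, $f_d(Y^n)$ and the side information $Z^n$, outputs $\hat X^n$, with $\mathbb E[\frac1n\sum_i d(X_i,\hat X_i)]\le D$. $(R,R_e,R_d)$ is achievable if for every $\delta>0$ and large $n$ there exists an $(n,2^{n(R+\delta)},2^{n(R_e+\delta)},2^{n(R_d+\delta)},D+\delta)$ code; $\mathcal R_g^O(D)$ is the closure of the set of achievable triples, and $\mathcal R_g^O(R_e,R_d,D)=\{R:(R,R_e,R_d)\in\mathcal R_g^O(D)\}$. Further, $\mathcal R_{Y-X-Z}(D)$ is the set of pairs $(R,R_1)$ with $R_1\ge I(U;Y|Z)$ and $R\ge I(X;W|U,Z)$ for some finite-alphabet $U,W$ with joint distribution $p(x,y)p(z|x)p(u|y)p(w|x,u)$ and a function $\hat X(U,W,Z)$ with $\mathbb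 E\, d(X,\hat X(U,W,Z))\le D$, and $\mathcal R(R_1,D)=\{R:(R,R_1)\in\mathcal R_{Y-X-Z}(D)\}$. *)

theory Defs
  imports "HOL-Probability.Probability"
begin

definition ent :: "'a pmf \<Rightarrow> real" where
  "ent q = - (\<Sum>a\<in>set_pmf q. pmf q a * log 2 (pmf q a))"

definition cmi :: "'o pmf \<Rightarrow> ('o \<Rightarrow> 'a) \<Rightarrow> ('o \<Rightarrow> 'b) \<Rightarrow> ('o \<Rightarrow> 'c) \<Rightarrow> real" where
  "cmi J fA fB fC =
     ent (map_pmf (\<lambda>\<omega>. (fA \<omega>, fC \<omega>)) J) + ent (map_pmf (\<lambda>\<omega>. (fB \<omega>, fC \<omega>)) J)
     - ent (map_pmf (\<lambda>\<omega>. (fA \<omega>, fB \<omega>, fC \<omega>)) J) - ent (map_pmf fC J)"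

definition src :: "('x \<times> 'y) pmf \<Rightarrow> ('x \<Rightarrow> 'z pmf) \<Rightarrow> ('x \<times> 'y \<times> 'z) pmf" where
  "src pXY pZ = do { (x, y) \<leftarrow> pXY; z \<leftarrow> pZ x; return_pmf (x, y, z) }"

fun iid :: "nat \<Rightarrow> 'a pmf \<Rightarrow> 'a list pmf" where
  "iid 0 P = return_pmf []"
| "iid (Suc n) P = do { a \<leftarrow> P; as \<leftarrow> iid n P; return_pmf (a # as) }"

definition is_code ::
  "('x \<times> 'y) pmf \<Rightarrow> ('x \<Rightarrow> 'z pmf) \<Rightarrow> ('x \<Rightarrow> 'xh \<Rightarrow> real) \<Rightarrow>
   nat \<Rightarrow> nat \<Rightarrow> nat \<Rightarrow> nat \<Rightarrow> real \<Rightarrow> bool" where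
  "is_code pXY pZ d n M Me Md D \<longleftrightarrow>
    (\<exists>(fe :: 'y list \<Rightarrow> nat) (fd :: 'y list \<Rightarrow> nat) (f :: 'x list \<Rightarrow> nat \<Rightarrow> nat)
       (g :: nat \<Rightarrow> nat \<Rightarrow> 'z list \<Rightarrow> 'xh list).
      (\<forall>ys. length ys = n \<longrightarrow> fe ys \<in> {1..Me}) \<and>
      (\<forall>ys. length ys = n \<longrightarrow> fd ys \<in> {1..Md}) \<and>
      (\<forall>xs m. length xs = n \<longrightarrow> m \<in> {1..Me} \<longrightarrow> f xs m \<in> {1..M}) \<and>
      (\<forall>a b zs. length zs = n \<longrightarrow> length (g a b zs) = n) \<and>
      measure_pmf.expectation (iid n (src pXY pZ))
        (\<lambda>t. let xs = map fst t; ys = map (fst \<circ> snd) t; zs = map (snd \<circ> snd) t;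
                 xh = g (f xs (fe ys)) (fd ys) zs
             in (1 / real n) * (\<Sum>i<n. d (xs ! i) (xh ! i))) \<le> D)"

definition achievable ::
  "('x \<times> 'y) pmf \<Rightarrow> ('x \<Rightarrow> 'z pmf) \<Rightarrow> ('x \<Rightarrow> 'xh \<Rightarrow> real) \<Rightarrow>
   real \<Rightarrow> real \<Rightarrow> real \<Rightarrow> real \<Rightarrow> bool" where
  "achievable pXY pZ d D R R_e R_d \<longleftrightarrow>
    (\<forall>\<delta>>0. \<exists>N. \<forall>n\<ge>N. n > 0 \<and>
       (\<exists>M Me Md. real M \<le> 2 powr (real n * (R + \<delta>)) \<and>
                  real Me \<le> 2 powr (real n * (R_e + \<delta>)) \<and>
                  real Md \<le> 2 powr (real n * (R_d + \<delta>)) \<and>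
                  is_code pXY pZ d n M Me Md (D + \<delta>)))"

definition RgO_D ::
  "('x \<times> 'y) pmf \<Rightarrow> ('x \<Rightarrow> 'z pmf) \<Rightarrow> ('x \<Rightarrow> 'xh \<Rightarrow> real) \<Rightarrow> real \<Rightarrow> (real \<times> real \<times> real) set" where
  "RgO_D pXY pZ d D = closure {(R, R_e, R_d). achievable pXY pZ d D R R_e R_d}"

definition RgO ::
  "('x \<times> 'y) pmf \<Rightarrow> ('x \<Rightarrow> 'z pmf) \<Rightarrow> ('x \<Rightarrow> 'xh \<Rightarrow> real) \<Rightarrow> real \<Rightarrow> real \<Rightarrow> real \<Rightarrow> real set" where
  "RgO pXY pZ d R_e R_d D = {R. (R, R_e, R_d) \<in> RgO_D pXY pZ d D}"

text \<open>Auxiliary variables U, W take values in finite subsets of nat (any finite alphabet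
  embeds into nat). Joint law p(x,y) p(z|x) p(u|y) p(w|x,u).\<close>
definition joint5 ::
  "('x \<times> 'y) pmf \<Rightarrow> ('x \<Rightarrow> 'z pmf) \<Rightarrow> ('y \<Rightarrow> nat pmf) \<Rightarrow> ('x \<Rightarrow> nat \<Rightarrow> nat pmf)
   \<Rightarrow> ('x \<times> 'y \<times> 'z \<times> nat \<times> nat) pmf" where
  "joint5 pXY pZ qU qW = do { (x, y) \<leftarrow> pXY; z \<leftarrow> pZ x; u \<leftarrow> qU y; w \<leftarrow> qW x u;
                              return_pmf (x, y, z, u, w) }"

definition RYXZ ::
  "('x \<times> 'y) pmf \<Rightarrow> ('x \<Rightarrow> 'z pmf) \<Rightarrow> ('x \<Rightarrow> 'xh \<Rightarrow> real) \<Rightarrow> real \<Rightarrow> (real \<times> real) set" where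
  "RYXZ pXY pZ d D = {(R, R1). \<exists>(qU :: 'y \<Rightarrow> nat pmf) (qW :: 'x \<Rightarrow> nat \<Rightarrow> nat pmf)
       (xhat :: nat \<Rightarrow> nat \<Rightarrow> 'z \<Rightarrow> 'xh).
      finite (\<Union>y. set_pmf (qU y)) \<and> finite (\<Union>x u. set_pmf (qW x u)) \<and>
      (let J = joint5 pXY pZ qU qW;
           X = (\<lambda>(x,y,z,u,w). x); Y = (\<lambda>(x,y,z,u,w). y); Z = (\<lambda>(x,y,z,u,w). z);
           U = (\<lambda>(x,y,z,u,w). u); W = (\<lambda>(x,y,z,u,w). w)
       in R1 \<ge> cmi J U Y Z \<and>
          R \<ge> cmi J X W (\<lambda>\<omega>. (U \<omega>, Z \<omega>)) \<and>
          measure_pmf.expectation J (\<lambda>(x,y,z,u,w). d x (xhat u w z)) \<le> D)}"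

definition Rreg ::
  "('x \<times> 'y) pmf \<Rightarrow> ('x \<Rightarrow> 'z pmf) \<Rightarrow> ('x \<Rightarrow> 'xh \<Rightarrow> real) \<Rightarrow> real \<Rightarrow> real \<Rightarrow> real set" where
  "Rreg pXY pZ d R1 D = {R. (R, R1) \<in> RYXZ pXY pZ d D}"

end

theory Submission
  imports Defs "HOL-Real_Asymp.Real_Asymp"
begin

text \<open>
  \<^emph>\<open>Achievability.\<close> The helper sends the same message to the encoder and to the decoder, and all
  parties share independent standard exponential clocks, one per pair of a candidate codeword and
  a message. Selecting the pair that minimises clock divided by weight draws the pair with
  probability proportional to the weight, and parties with weights \<open>p\<close> and \<open>q\<close> both select
  \<open>v\<close> with probability at least \<open>1 / (1 / p v + 1 / q v)\<close>. With \<open>Md\<close> helper messages and \<open>M\<close>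
  encoder messages, the helper uses the weights \<open>p(u|y) / Md\<close>, the encoder and the decoder \<open>p(u|x)\<close>
  and \<open>p(u|z)\<close> restricted to the received message; given \<open>u\<close>, the same is done for \<open>w\<close> with
  \<open>p(w|x,u) / M\<close> and \<open>p(w|u,z)\<close>. The failure probability is bounded by likelihood ratios, and the
  weak law of large numbers turns these into \<open>I(U;Y|Z)\<close>, \<open>I(U;Y|X) \<le> I(U;Y|Z)\<close> and \<open>I(X;W|U,Z)\<close>.

  \<^emph>\<open>Converse.\<close> Let \<open>U i\<close> consist of the message to the decoder, of the pairs \<open>(X j, Y j)\<close> with
  \<open>j < i\<close> and of all \<open>Z j\<close> with \<open>j \<noteq> i\<close>, and let \<open>W i\<close> be the map that sends a value of \<open>Z i\<close> to
  the reconstruction of the \<open>i\<close>-th letter. The chain rule gives the two rate bounds. Since the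
  alphabet of \<open>W i\<close> is fixed and finite, the laws of \<open>(X, Y, W)\<close> for a fixed value of \<open>U\<close> form a
  compact set on which entropies and distortion are continuous, and their averages over \<open>U\<close> fill
  its convex hull. The hull is compact, which permits \<open>\<delta> \<rightarrow> 0\<close>, and its points are finite convex
  combinations, which gives back a finite \<open>U\<close>.
\<close>

section \<open>Joint and conditional laws\<close>

lemma expectation_eq_sum:
  fixes f :: "'a \<Rightarrow> real"
  assumes "finite (set_pmf p)"
  shows "measure_pmf.expectation p f = (\<Sum>a\<in>set_pmf p. pmf p a * f a)"
  using assms by (subst integral_measure_pmf[of "set_pmf p"]) auto

lemma expectation_mono_finite:
  fixes f g :: "'a \<Rightarrow> real"
  assumes "finite (set_pmf p)" "\<And>a. a \<in> set_pmf p \<Longrightarrow> f a \<le> g a"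
  shows "measure_pmf.expectation p f \<le> measure_pmf.expectation p g"
  using assms by (simp add: expectation_eq_sum sum_mono mult_left_mono)

lemma expectation_cong_pmf:
  fixes f g :: "'a \<Rightarrow> real"
  assumes "\<And>a. a \<in> set_pmf p \<Longrightarrow> f a = g a"
  shows "measure_pmf.expectation p f = measure_pmf.expectation p g"
  using assms by (intro integral_cong_AE) (auto simp: AE_measure_pmf_iff)

lemma pmf_map_pos: "\<omega> \<in> set_pmf J \<Longrightarrow> pmf (map_pmf f J) (f \<omega>) > 0"
  by (rule pmf_positive) simp

lemma pmf_map_mono:
  assumes "\<omega> \<in> set_pmf J"
    and "\<And>\<omega>'. \<omega>' \<in> set_pmf J \<Longrightarrow> f \<omega>' = f \<omega> \<Longrightarrow> g \<omega>' = g \<omega>"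
  shows "pmf (map_pmf f J) (f \<omega>) \<le> pmf (map_pmf g J) (g \<omega>)"
proof -
  have "measure_pmf.prob J (f -` {f \<omega>}) = measure_pmf.prob J (f -` {f \<omega>} \<inter> set_pmf J)"
    by (simp add: measure_Int_set_pmf)
  also have "\<dots> \<le> measure_pmf.prob J (g -` {g \<omega>})"
    by (intro measure_pmf.finite_measure_mono subsetI) (use assms in blast, simp)
  finally show ?thesis by (simp only: pmf_map)
qed

definition joint_pmf :: "'a pmf \<Rightarrow> ('a \<Rightarrow> 'b pmf) \<Rightarrow> ('a \<times> 'b) pmf" where
  "joint_pmf p K = bind_pmf p (\<lambda>a. map_pmf (Pair a) (K a))"

lemma set_joint_pmf: "set_pmf (joint_pmf p K) = (SIGMA a : set_pmf p. set_pmf (K a))"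
  by (auto simp: joint_pmf_def)

lemma pmf_joint_pmf: "pmf (joint_pmf p K) (a, b) = pmf p a * pmf (K a) b"
proof -
  have "pmf (map_pmf (Pair a') (K a')) (a, b) = indicator {a} a' * pmf (K a) b" for a'
  proof (cases "a' = a")
    case True
    then show ?thesis using pmf_map_inj'[of "Pair a" "K a" b] by (simp add: inj_def)
  next
    case False
    then show ?thesis by (simp add: pmf_eq_0_set_pmf image_iff)
  qed
  then show ?thesis by (simp add: joint_pmf_def pmf_bind measure_pmf_single)
qed

lemma map_fst_joint_pmf: "map_pmf fst (joint_pmf p K) = p"
  by (simp add: joint_pmf_def map_bind_pmf map_pmf_comp bind_return_pmf')

lemma map_snd_joint_pmf: "map_pmf snd (joint_pmf p K) = bind_pmf p K"
  by (simp add: joint_pmf_def map_bind_pmf map_pmf_comp)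

lemma map_joint_pmf:
  "map_pmf (\<lambda>(a, b). (a, h a b)) (joint_pmf p K) = joint_pmf p (\<lambda>a. map_pmf (h a) (K a))"
  by (simp add: joint_pmf_def map_bind_pmf map_pmf_comp)

lemma joint_pmf_map:
  "joint_pmf (map_pmf f p) K = map_pmf (\<lambda>(a, b). (f a, b)) (joint_pmf p (\<lambda>a. K (f a)))"
  by (simp add: joint_pmf_def map_bind_pmf bind_map_pmf map_pmf_comp)

lemma joint_pmf_assoc:
  "map_pmf (\<lambda>((a, b), c). (a, b, c)) (joint_pmf (joint_pmf p K) L) =
    joint_pmf p (\<lambda>a. joint_pmf (K a) (\<lambda>b. L (a, b)))"
  by (simp add: joint_pmf_def map_bind_pmf bind_map_pmf map_pmf_comp bind_assoc_pmf)

lemma joint_pmf_cong: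
  assumes "p = q" "\<And>a. a \<in> set_pmf q \<Longrightarrow> K a = L a"
  shows "joint_pmf p K = joint_pmf q L"
  unfolding joint_pmf_def using assms by (intro bind_pmf_cong) auto

lemma expectation_joint_pmf:
  fixes h :: "'a \<times> 'b \<Rightarrow> real"
  assumes "finite (set_pmf p)" "\<And>a. a \<in> set_pmf p \<Longrightarrow> finite (set_pmf (K a))"
  shows "measure_pmf.expectation (joint_pmf p K) h =
    measure_pmf.expectation p (\<lambda>a. measure_pmf.expectation (K a) (\<lambda>b. h (a, b)))"
proof -
  have "finite (set_pmf (joint_pmf p K))"
    using assms by (simp add: set_joint_pmf)
  then have "measure_pmf.expectation (joint_pmf p K) h =
      (\<Sum>(a, b)\<in>(SIGMA a : set_pmf p. set_pmf (K a)). pmf p a * (pmf (K a) b * h (a, b)))"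
    by (simp add: expectation_eq_sum set_joint_pmf pmf_joint_pmf case_prod_unfold
        flip: pmf_joint_pmf mult.assoc)
  then show ?thesis
    using assms by (simp add: expectation_eq_sum sum.Sigma sum_distrib_left)
qed

text \<open>Off the range of \<open>f\<close> the conditional law is the unconditional one, so that it is always
  supported in the range of \<open>g\<close>.\<close>
definition cond_law :: "'o pmf \<Rightarrow> ('o \<Rightarrow> 'b) \<Rightarrow> ('o \<Rightarrow> 'a) \<Rightarrow> 'a \<Rightarrow> 'b pmf" where
  "cond_law J g f a = map_pmf g (if a \<in> f ` set_pmf J then cond_pmf J (f -` {a}) else J)"

lemma vimage_singleton_meets_set_pmf: "\<omega> \<in> set_pmf J \<Longrightarrow> set_pmf J \<inter> f -` {f \<omega>} \<noteq> {}"
  by auto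

lemma set_cond_law_subset: "set_pmf (cond_law J g f a) \<subseteq> g ` set_pmf J"
proof (cases "a \<in> f ` set_pmf J")
  case True
  then have "set_pmf J \<inter> f -` {a} \<noteq> {}" by auto
  then show ?thesis
    using True by (auto simp: cond_law_def set_cond_pmf)
qed (simp add: cond_law_def)

lemma finite_set_cond_law: "finite (set_pmf J) \<Longrightarrow> finite (set_pmf (cond_law J g f a))"
  by (meson finite_imageI finite_subset set_cond_law_subset)

lemma pmf_cond_law:
  assumes "\<omega> \<in> set_pmf J"
  shows "pmf (cond_law J g f (f \<omega>)) b =
    pmf (map_pmf (\<lambda>\<omega>. (f \<omega>, g \<omega>)) J) (f \<omega>, b) / pmf (map_pmf f J) (f \<omega>)"
proof -
  note meets = vimage_singleton_meets_set_pmf[OF assms, of f]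
  have "pmf (cond_law J g f (f \<omega>)) b = measure (cond_pmf J (f -` {f \<omega>})) (g -` {b})"
    using assms by (simp add: cond_law_def pmf_map)
  also have "\<dots> = measure_pmf.prob J (f -` {f \<omega>} \<inter> g -` {b}) / measure_pmf.prob J (f -` {f \<omega>})"
    unfolding cond_pmf.rep_eq[OF meets] using pmf_map_pos[OF assms, of f]
    by (subst measure_uniform_measure) (auto simp: measure_pmf.emeasure_eq_measure pmf_map)
  also have "f -` {f \<omega>} \<inter> g -` {b} = (\<lambda>\<omega>. (f \<omega>, g \<omega>)) -` {(f \<omega>, b)}"
    by auto
  finally show ?thesis by (simp only: pmf_map)
qed

lemma joint_pmf_cond_law:
  "joint_pmf (map_pmf f J) (cond_law J g f) = map_pmf (\<lambda>\<omega>. (f \<omega>, g \<omega>)) J"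
proof (rule pmf_eqI, clarify)
  fix a b
  show "pmf (joint_pmf (map_pmf f J) (cond_law J g f)) (a, b) =
    pmf (map_pmf (\<lambda>\<omega>. (f \<omega>, g \<omega>)) J) (a, b)"
  proof (cases "a \<in> f ` set_pmf J")
    case True
    then obtain \<omega> where preimage: "\<omega> \<in> set_pmf J" "a = f \<omega>" by blast
    then show ?thesis
      using pmf_map_pos[OF preimage(1), of f] by (simp add: pmf_joint_pmf pmf_cond_law)
  next
    case False
    then show ?thesis
      by (subst (1 2) pmf_eq_0_set_pmf[THEN iffD2]) (auto simp: set_joint_pmf)
  qed
qed

lemma mem_set_cond_law: "\<omega> \<in> set_pmf J \<Longrightarrow> g \<omega> \<in> set_pmf (cond_law J g f (f \<omega>))"
  by (simp add: cond_law_def set_cond_pmf[OF vimage_singleton_meets_set_pmf])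

lemma cond_law_joint_pmf:
  assumes "map_pmf (\<lambda>\<omega>. (f \<omega>, g \<omega>)) J = joint_pmf p K" "a \<in> set_pmf p"
  shows "cond_law J g f a = K a"
proof -
  have p_eq: "p = map_pmf f J"
    using arg_cong[OF assms(1), of "map_pmf fst"] by (simp add: map_pmf_comp map_fst_joint_pmf)
  show ?thesis
  proof (rule pmf_eqI)
    fix b
    have "pmf p a * pmf (cond_law J g f a) b = pmf p a * pmf (K a) b"
      using joint_pmf_cond_law[of f J g] assms(1) unfolding p_eq by (metis pmf_joint_pmf)
    then show "pmf (cond_law J g f a) b = pmf (K a) b"
      using assms(2) by (simp add: set_pmf_iff)
  qed
qed

section \<open>Entropy of finitely supported laws\<close>

lemma ent_map_eq_expectation:
  assumes "finite (set_pmf J)"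
  shows "ent (map_pmf f J) = - measure_pmf.expectation J (\<lambda>\<omega>. log 2 (pmf (map_pmf f J) (f \<omega>)))"
proof -
  have "ent (map_pmf f J) =
      - measure_pmf.expectation (map_pmf f J) (\<lambda>a. log 2 (pmf (map_pmf f J) a))"
    using assms by (simp add: ent_def expectation_eq_sum del: integral_map_pmf)
  then show ?thesis by simp
qed

lemma ent_eq_expectation:
  "finite (set_pmf p) \<Longrightarrow> ent p = - measure_pmf.expectation p (\<lambda>a. log 2 (pmf p a))"
  using ent_map_eq_expectation[of p id] by simp

lemma ent_map_mono:
  assumes fin: "finite (set_pmf J)"
    and det: "\<And>\<omega> \<omega>'. \<omega> \<in> set_pmf J \<Longrightarrow> \<omega>' \<in> set_pmf J \<Longrightarrow> f \<omega> = f \<omega>' \<Longrightarrow> g \<omega> = g \<omega>'"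
  shows "ent (map_pmf g J) \<le> ent (map_pmf f J)"
  unfolding ent_map_eq_expectation[OF fin] neg_le_iff_le
proof (rule expectation_mono_finite[OF fin])
  fix \<omega> assume mem: "\<omega> \<in> set_pmf J"
  have "pmf (map_pmf f J) (f \<omega>) \<le> pmf (map_pmf g J) (g \<omega>)"
    using det mem by (intro pmf_map_mono) blast+
  then show "log 2 (pmf (map_pmf f J) (f \<omega>)) \<le> log 2 (pmf (map_pmf g J) (g \<omega>))"
    using pmf_map_pos[OF mem, of f] by simp
qed

lemma ent_map_cong:
  assumes "finite (set_pmf J)"
    and "\<And>\<omega> \<omega>'. \<omega> \<in> set_pmf J \<Longrightarrow> \<omega>' \<in> set_pmf J \<Longrightarrow> f \<omega> = f \<omega>' \<longleftrightarrow> g \<omega> = g \<omega>'"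
  shows "ent (map_pmf f J) = ent (map_pmf g J)"
  by (intro antisym ent_map_mono) (use assms in blast)+

lemma ent_le_cross_entropy:
  assumes fin: "finite (set_pmf p)" and sub: "set_pmf p \<subseteq> set_pmf q"
  shows "ent p \<le> - measure_pmf.expectation p (\<lambda>a. log 2 (pmf q a))"
proof -
  have pos: "pmf p a > 0" "pmf q a > 0" if "a \<in> set_pmf p" for a
    using that sub by (auto intro: pmf_positive)
  have "(\<Sum>a\<in>set_pmf p. pmf p a * (log 2 (pmf q a) - log 2 (pmf p a))) \<le>
      (\<Sum>a\<in>set_pmf p. (pmf q a - pmf p a) / ln 2)"
  proof (rule sum_mono)
    fix a assume a_mem: "a \<in> set_pmf p"
    have "ln (pmf q a / pmf p a) \<le> pmf q a / pmf p a - 1"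
      using pos[OF a_mem] by (intro ln_le_minus_one) simp
    then have "pmf p a * ln (pmf q a / pmf p a) \<le> pmf p a * (pmf q a / pmf p a - 1)"
      by (rule mult_left_mono) simp
    also have "\<dots> = pmf q a - pmf p a"
      using pos[OF a_mem] by (simp add: right_diff_distrib)
    finally have "pmf p a * ln (pmf q a / pmf p a) \<le> pmf q a - pmf p a" .
    then show "pmf p a * (log 2 (pmf q a) - log 2 (pmf p a)) \<le> (pmf q a - pmf p a) / ln 2"
      using pos[OF a_mem] by (simp add: log_def ln_div divide_right_mono flip: diff_divide_distrib)
  qed
  also have "\<dots> = (measure_pmf.prob q (set_pmf p) - 1) / ln 2"
    using fin by (simp add: sum_subtractf sum_pmf_eq_1 measure_measure_pmf_finite
        flip: sum_divide_distrib)
  also have "\<dots> \<le> 0"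
    by (simp add: divide_le_0_iff)
  finally show ?thesis
    using fin by (simp add: ent_def expectation_eq_sum right_diff_distrib sum_subtractf)
qed

lemma ent_le_log_card:
  assumes fin: "finite S" and sub: "set_pmf p \<subseteq> S"
  shows "ent p \<le> log 2 (card S)"
proof -
  have nonempty: "S \<noteq> {}" using sub set_pmf_not_empty[of p] by blast
  have "ent p \<le> - measure_pmf.expectation p (\<lambda>a. log 2 (pmf (pmf_of_set S) a))"
    using fin sub nonempty by (intro ent_le_cross_entropy) (auto intro: finite_subset)
  also have "measure_pmf.expectation p (\<lambda>a. log 2 (pmf (pmf_of_set S) a)) =
      measure_pmf.expectation p (\<lambda>_. - log 2 (card S))"
    using fin nonempty sub by (intro expectation_cong_pmf) (auto simp: log_divide card_gt_0_iff)
  finally show ?thesis by simp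
qed

lemma ent_joint_pmf:
  assumes "finite (set_pmf p)" "\<And>a. a \<in> set_pmf p \<Longrightarrow> finite (set_pmf (K a))"
  shows "ent (joint_pmf p K) = ent p + measure_pmf.expectation p (\<lambda>a. ent (K a))"
proof -
  have "finite (set_pmf (joint_pmf p K))"
    using assms by (simp add: set_joint_pmf)
  then have "ent (joint_pmf p K) = - measure_pmf.expectation p (\<lambda>a.
      measure_pmf.expectation (K a) (\<lambda>b. log 2 (pmf (joint_pmf p K) (a, b))))"
    using assms by (simp add: ent_eq_expectation expectation_joint_pmf)
  also have "\<dots> = - measure_pmf.expectation p (\<lambda>a. log 2 (pmf p a) - ent (K a))"
  proof (intro arg_cong[of _ _ uminus] expectation_cong_pmf)
    fix a assume a_mem: "a \<in> set_pmf p"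
    have "measure_pmf.expectation (K a) (\<lambda>b. log 2 (pmf (joint_pmf p K) (a, b))) =
      measure_pmf.expectation (K a) (\<lambda>b. log 2 (pmf p a) + log 2 (pmf (K a) b))"
      using a_mem by (intro expectation_cong_pmf) (auto simp: pmf_joint_pmf log_mult set_pmf_iff)
    then show "measure_pmf.expectation (K a) (\<lambda>b. log 2 (pmf (joint_pmf p K) (a, b))) =
      log 2 (pmf p a) - ent (K a)"
      using assms(2)[OF a_mem] by (simp add: ent_eq_expectation integrable_measure_pmf_finite)
  qed
  finally show ?thesis
    using assms(1) by (simp add: ent_eq_expectation integrable_measure_pmf_finite)
qed

definition cent :: "'o pmf \<Rightarrow> ('o \<Rightarrow> 'a) \<Rightarrow> ('o \<Rightarrow> 'b) \<Rightarrow> real" where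
  "cent J f g = ent (map_pmf (\<lambda>\<omega>. (f \<omega>, g \<omega>)) J) - ent (map_pmf g J)"

lemma cmi_eq_cent: "cmi J f g h = cent J f h - cent J f (\<lambda>\<omega>. (g \<omega>, h \<omega>))"
  by (simp add: cmi_def cent_def)

lemma cent_map_pmf: "cent (map_pmf h J) f g = cent J (\<lambda>\<omega>. f (h \<omega>)) (\<lambda>\<omega>. g (h \<omega>))"
  by (simp add: cent_def map_pmf_comp)

lemma cmi_map_pmf:
  "cmi (map_pmf h J) f g k = cmi J (\<lambda>\<omega>. f (h \<omega>)) (\<lambda>\<omega>. g (h \<omega>)) (\<lambda>\<omega>. k (h \<omega>))"
  by (simp add: cmi_eq_cent cent_map_pmf)

lemma cent_cong:
  assumes "finite (set_pmf J)"
    and "\<And>\<omega> \<omega>'. \<omega> \<in> set_pmf J \<Longrightarrow> \<omega>' \<in> set_pmf J \<Longrightarrow> g \<omega> = g \<omega>' \<longleftrightarrow> h \<omega> = h \<omega>'"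
  shows "cent J f g = cent J f h"
  unfolding cent_def using assms by (intro arg_cong2[of _ _ _ _ minus] ent_map_cong) auto

lemma cmi_commute:
  assumes "finite (set_pmf J)"
  shows "cmi J f g h = cmi J g f h"
proof -
  have "ent (map_pmf (\<lambda>\<omega>. (f \<omega>, g \<omega>, h \<omega>)) J) = ent (map_pmf (\<lambda>\<omega>. (g \<omega>, f \<omega>, h \<omega>)) J)"
    using assms by (intro ent_map_cong) auto
  then show ?thesis by (simp add: cmi_def)
qed

lemma cent_eq_expectation_ent:
  assumes fin: "finite (set_pmf J)"
    and law: "map_pmf (\<lambda>\<omega>. (g \<omega>, f \<omega>)) J = joint_pmf (map_pmf g J) K"
  shows "cent J f g = measure_pmf.expectation J (\<lambda>\<omega>. ent (K (g \<omega>)))"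
proof -
  have finite_K: "finite (set_pmf (K a))" if "a \<in> set_pmf (map_pmf g J)" for a
  proof (rule finite_subset)
    have "(a, b) \<in> set_pmf (map_pmf (\<lambda>\<omega>. (g \<omega>, f \<omega>)) J)" if "b \<in> set_pmf (K a)" for b
      using that \<open>a \<in> _\<close> unfolding law set_joint_pmf by blast
    then show "set_pmf (K a) \<subseteq> f ` set_pmf J" by auto
  qed (use fin in simp)
  have "ent (map_pmf (\<lambda>\<omega>. (f \<omega>, g \<omega>)) J) = ent (joint_pmf (map_pmf g J) K)"
    unfolding law[symmetric] using fin by (intro ent_map_cong) auto
  also have "\<dots> = ent (map_pmf g J) + measure_pmf.expectation (map_pmf g J) (\<lambda>a. ent (K a))"
    using fin finite_K by (intro ent_joint_pmf) auto
  finally show ?thesis by (simp add: cent_def)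
qed

lemma cent_eq_expectation_log:
  assumes fin: "finite (set_pmf J)"
    and law: "map_pmf (\<lambda>\<omega>. (g \<omega>, f \<omega>)) J = joint_pmf (map_pmf g J) K"
  shows "cent J f g = - measure_pmf.expectation J (\<lambda>\<omega>. log 2 (pmf (K (g \<omega>)) (f \<omega>)))"
proof -
  have "ent (map_pmf (\<lambda>\<omega>. (f \<omega>, g \<omega>)) J) = ent (map_pmf (\<lambda>\<omega>. (g \<omega>, f \<omega>)) J)"
    using fin by (intro ent_map_cong) auto
  also have "\<dots> = - measure_pmf.expectation J
      (\<lambda>\<omega>. log 2 (pmf (map_pmf g J) (g \<omega>)) + log 2 (pmf (K (g \<omega>)) (f \<omega>)))"
    unfolding ent_map_eq_expectation[OF fin]
  proof (intro arg_cong[of _ _ uminus] expectation_cong_pmf)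
    fix \<omega> assume "\<omega> \<in> set_pmf J"
    then have "pmf (map_pmf g J) (g \<omega>) * pmf (K (g \<omega>)) (f \<omega>) > 0"
      using pmf_map_pos[of \<omega> J "\<lambda>\<omega>. (g \<omega>, f \<omega>)"] by (simp add: law pmf_joint_pmf)
    then show "log 2 (pmf (map_pmf (\<lambda>\<omega>. (g \<omega>, f \<omega>)) J) (g \<omega>, f \<omega>)) =
        log 2 (pmf (map_pmf g J) (g \<omega>)) + log 2 (pmf (K (g \<omega>)) (f \<omega>))"
      by (simp add: law pmf_joint_pmf log_mult zero_less_mult_iff)
  qed
  finally show ?thesis
    using fin by (simp add: cent_def ent_map_eq_expectation integrable_measure_pmf_finite)
qed

text \<open>The law of \<open>(h, f, g)\<close> is compared with the one that makes \<open>f\<close> and \<open>g\<close> independent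
  given \<open>h\<close>.\<close>
lemma cmi_nonneg:
  assumes fin: "finite (set_pmf J)"
  shows "cmi J f g h \<ge> 0"
proof -
  define q where "q = joint_pmf (map_pmf h J) (\<lambda>c. pair_pmf (cond_law J f h c) (cond_law J g h c))"
  let ?law = "map_pmf (\<lambda>\<omega>. (h \<omega>, f \<omega>, g \<omega>)) J"
  have "set_pmf ?law \<subseteq> set_pmf q"
    by (auto simp: q_def set_joint_pmf mem_set_cond_law)
  then have "ent ?law \<le> - measure_pmf.expectation J (\<lambda>\<omega>. log 2 (pmf q (h \<omega>, f \<omega>, g \<omega>)))"
    using ent_le_cross_entropy[of ?law q] fin by simp
  also have "measure_pmf.expectation J (\<lambda>\<omega>. log 2 (pmf q (h \<omega>, f \<omega>, g \<omega>))) =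
    measure_pmf.expectation J (\<lambda>\<omega>. log 2 (pmf (map_pmf h J) (h \<omega>)) +
      log 2 (pmf (cond_law J f h (h \<omega>)) (f \<omega>)) + log 2 (pmf (cond_law J g h (h \<omega>)) (g \<omega>)))"
  proof (rule expectation_cong_pmf)
    fix \<omega> assume mem: "\<omega> \<in> set_pmf J"
    then show "log 2 (pmf q (h \<omega>, f \<omega>, g \<omega>)) = log 2 (pmf (map_pmf h J) (h \<omega>)) +
        log 2 (pmf (cond_law J f h (h \<omega>)) (f \<omega>)) + log 2 (pmf (cond_law J g h (h \<omega>)) (g \<omega>))"
      using pmf_map_pos[OF mem, of h] pmf_positive[OF mem_set_cond_law[OF mem, of f h]]
        pmf_positive[OF mem_set_cond_law[OF mem, of g h]]
      by (simp add: q_def pmf_joint_pmf pmf_pair log_mult)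
  qed
  also have "- \<dots> = ent (map_pmf h J) + cent J f h + cent J g h"
    using fin by (simp add: ent_map_eq_expectation integrable_measure_pmf_finite
        cent_eq_expectation_log[OF fin joint_pmf_cond_law[symmetric]])
  also have "ent ?law = ent (map_pmf (\<lambda>\<omega>. (f \<omega>, g \<omega>, h \<omega>)) J)"
    using fin by (intro ent_map_cong) auto
  finally show ?thesis by (simp add: cmi_def cent_def)
qed

lemma cent_antimono:
  assumes fin: "finite (set_pmf J)"
    and det: "\<And>\<omega> \<omega>'. \<omega> \<in> set_pmf J \<Longrightarrow> \<omega>' \<in> set_pmf J \<Longrightarrow> h \<omega> = h \<omega>' \<Longrightarrow> g \<omega> = g \<omega>'"
  shows "cent J f h \<le> cent J f g"
proof -
  have "cent J f h = cent J f (\<lambda>\<omega>. (h \<omega>, g \<omega>))"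
    using fin det by (intro cent_cong) blast+
  then show ?thesis using cmi_nonneg[OF fin, of f h g] by (simp add: cmi_eq_cent)
qed

lemma cent_nonneg:
  assumes "finite (set_pmf J)"
  shows "cent J f g \<ge> 0"
  using ent_map_mono[OF assms, of "\<lambda>\<omega>. (f \<omega>, g \<omega>)" g] by (simp add: cent_def)

lemma cent_le_ent:
  assumes fin: "finite (set_pmf J)"
  shows "cent J f g \<le> ent (map_pmf f J)"
proof -
  have "cent J f g \<le> cent J f (\<lambda>_. ())"
    using fin by (rule cent_antimono) simp
  also have "\<dots> = ent (map_pmf f J)"
    using ent_map_cong[OF fin, of "\<lambda>\<omega>. (f \<omega>, ())" f] by (simp add: cent_def ent_def)
  finally show ?thesis .
qed

lemma cmi_data_processing:
  assumes fin: "finite (set_pmf J)"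
    and det: "\<And>\<omega> \<omega>'. \<omega> \<in> set_pmf J \<Longrightarrow> \<omega>' \<in> set_pmf J \<Longrightarrow> t \<omega> = t \<omega>' \<Longrightarrow> h \<omega> = h \<omega>' \<Longrightarrow> g \<omega> = g \<omega>'"
  shows "cmi J f g h \<le> cmi J f t h"
proof -
  have "cent J f (\<lambda>\<omega>. (t \<omega>, h \<omega>)) \<le> cent J f (\<lambda>\<omega>. (g \<omega>, h \<omega>))"
    by (rule cent_antimono[OF fin]) (use det in blast)
  then show ?thesis by (simp add: cmi_eq_cent)
qed

lemma cent_joint_pmf:
  assumes finite_p: "finite (set_pmf p)" and finite_K: "\<And>a. a \<in> set_pmf p \<Longrightarrow> finite (set_pmf (K a))"
  shows "cent (joint_pmf p K) (\<lambda>(a, b). f b) (\<lambda>(a, b). (a, g b)) =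
    measure_pmf.expectation p (\<lambda>a. cent (K a) f g)"
proof -
  let ?J = "joint_pmf p K"
  have fin: "finite (set_pmf ?J)" using finite_p finite_K by (simp add: set_joint_pmf)
  have "ent (map_pmf (\<lambda>(a, b). (a, h b)) ?J) =
      ent p + measure_pmf.expectation p (\<lambda>a. ent (map_pmf h (K a)))" for h :: "'b \<Rightarrow> 'e"
    using finite_p finite_K unfolding map_joint_pmf by (intro ent_joint_pmf) auto
  note ent_tagged = this[of g] this[of "\<lambda>b. (f b, g b)"]
  have "ent (map_pmf (\<lambda>\<omega>. (case \<omega> of (a, b) \<Rightarrow> f b, case \<omega> of (a, b) \<Rightarrow> (a, g b))) ?J) =
      ent (map_pmf (\<lambda>(a, b). (a, (f b, g b))) ?J)"
    using fin by (intro ent_map_cong) auto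
  then show ?thesis
    using finite_p by (simp add: cent_def ent_tagged integrable_measure_pmf_finite)
qed

lemma cmi_joint_pmf:
  assumes finite_p: "finite (set_pmf p)" and finite_K: "\<And>a. a \<in> set_pmf p \<Longrightarrow> finite (set_pmf (K a))"
  shows "cmi (joint_pmf p K) (\<lambda>(a, b). f b) (\<lambda>(a, b). g b) (\<lambda>(a, b). (a, h b)) =
    measure_pmf.expectation p (\<lambda>a. cmi (K a) f g h)"
proof -
  have "cent (joint_pmf p K) (\<lambda>(a, b). f b)
        (\<lambda>\<omega>. (case \<omega> of (a, b) \<Rightarrow> g b, case \<omega> of (a, b) \<Rightarrow> (a, h b))) =
      cent (joint_pmf p K) (\<lambda>(a, b). f b) (\<lambda>(a, b). (a, (g b, h b)))"
    using finite_p finite_K by (intro cent_cong) (auto simp: set_joint_pmf)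
  then show ?thesis
    using finite_p by (simp add: cmi_eq_cent cent_joint_pmf[OF assms] integrable_measure_pmf_finite)
qed

lemma sum_cmi_le_ent:
  assumes fin: "finite (set_pmf J)"
    and refine: "\<And>i \<omega> \<omega>'. i < n \<Longrightarrow> \<omega> \<in> set_pmf J \<Longrightarrow> \<omega>' \<in> set_pmf J \<Longrightarrow> C (Suc i) \<omega> = C (Suc i) \<omega>' \<Longrightarrow>
        V i \<omega> = V i \<omega>' \<and> C i \<omega> = C i \<omega>'"
  shows "(\<Sum>i<n. cmi J T (V i) (C i)) \<le> ent (map_pmf T J)"
proof -
  have "(\<Sum>i<n. cmi J T (V i) (C i)) \<le> (\<Sum>i<n. cent J T (C i) - cent J T (C (Suc i)))"
  proof (rule sum_mono)
    fix i assume "i \<in> {..<n}"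
    then have "cent J T (C (Suc i)) \<le> cent J T (\<lambda>\<omega>. (V i \<omega>, C i \<omega>))"
      by (intro cent_antimono[OF fin]) (use refine in blast)
    then show "cmi J T (V i) (C i) \<le> cent J T (C i) - cent J T (C (Suc i))"
      by (simp add: cmi_eq_cent)
  qed
  also have "\<dots> = cent J T (C 0) - cent J T (C n)"
    by (rule sum_lessThan_telescope')
  also have "\<dots> \<le> ent (map_pmf T J)"
    using cent_le_ent[OF fin, of T "C 0"] cent_nonneg[OF fin, of T "C n"] by simp
  finally show ?thesis .
qed

section \<open>Exponential races\<close>

abbreviation exp_measure :: "real measure" where
  "exp_measure \<equiv> density lborel (exponential_density 1)"

abbreviation clock_space :: "'v set \<Rightarrow> ('v \<Rightarrow> real) measure" where
  "clock_space V \<equiv> PiM V (\<lambda>_. exp_measure)"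

lemma prob_space_exp_measure: "prob_space exp_measure"
  by (rule prob_space_exponential_density) simp

lemma prob_space_clock_space: "prob_space (clock_space V)"
  by (intro prob_space_PiM prob_space_exp_measure)

lemma product_sigma_finite_exp_measure: "product_sigma_finite (\<lambda>_. exp_measure)"
proof -
  interpret prob_space exp_measure by (rule prob_space_exp_measure)
  show ?thesis ..
qed

lemma AE_exp_measure_nonneg: "AE x in exp_measure. 0 \<le> x"
  by (auto simp: AE_density exponential_density_def intro!: AE_I2)

lemma emeasure_exp_measure_greaterThan:
  assumes "0 \<le> a"
  shows "emeasure exp_measure {a<..} = ennreal (exp (- a))"
proof -
  interpret prob_space exp_measure by (rule prob_space_exp_measure)
  have "distributed exp_measure lborel (\<lambda>x. x) (exponential_density 1)"
    by (auto simp: distributed_def distr_id2 sets_density)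
  from exponential_distributedD_gt[OF this assms]
  have "prob {a<..} = exp (- a)"
    by (simp add: greaterThan_def)
  then show ?thesis by (simp add: emeasure_eq_measure)
qed

lemma nn_integral_exp_measure_exp:
  assumes l_nonneg: "0 \<le> l"
  shows "(\<integral>\<^sup>+ x. ennreal (exp (- l * x)) \<partial>exp_measure) = ennreal (1 / (1 + l))"
proof -
  have density: "exponential_density 1 x * exp (- l * x) =
      1 / (1 + l) * exponential_density (1 + l) x" for x
    using l_nonneg by (simp add: exponential_density_def field_simps exp_add[symmetric])
  have "(\<integral>\<^sup>+ x. ennreal (exp (- l * x)) \<partial>exp_measure) =
      (\<integral>\<^sup>+ x. ennreal (exponential_density 1 x * exp (- l * x)) \<partial>lborel)"
    by (subst nn_integral_density) (auto simp: ennreal_mult exponential_density_nonneg)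
  also have "\<dots> = ennreal (1 / (1 + l)) * (\<integral>\<^sup>+ x. ennreal (exponential_density (1 + l) x) \<partial>lborel)"
    unfolding density using l_nonneg
    by (subst nn_integral_cmult[symmetric])
      (auto simp: exponential_density_nonneg simp flip: ennreal_mult)
  also have "(\<integral>\<^sup>+ x. ennreal (exponential_density (1 + l) x) \<partial>lborel) = 1"
    using prob_space.emeasure_space_1[OF prob_space_exponential_density[of "1 + l"]] l_nonneg
    by (simp add: emeasure_density)
  finally show ?thesis by simp
qed

lemma sets_clock_race:
  assumes "finite V" "v \<in> V"
  shows "{e \<in> space (clock_space V). \<forall>w\<in>V - {v}. l w * e v < e w} \<in> sets (clock_space V)"
proof -
  have clock: "(\<lambda>e. e w) \<in> borel_measurable (clock_space V)" if "w \<in> V" for w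
    using measurable_component_singleton[OF that, of "\<lambda>_. exp_measure"]
    by (simp add: measurable_def)
  have "{e \<in> space (clock_space V). l w * e v < e w} \<in> sets (clock_space V)" if "w \<in> V" for w
    using clock[OF that] clock[OF assms(2)] by measurable
  then show ?thesis
    using assms by (intro sets.sets_Collect_finite_All) auto
qed

lemma emeasure_clock_space_above:
  assumes "finite V" "\<And>w. w \<in> V \<Longrightarrow> l w \<ge> 0" "y \<ge> 0"
  shows "emeasure (clock_space V) (PiE V (\<lambda>w. {l w * y<..})) = ennreal (exp (- (\<Sum>w\<in>V. l w) * y))"
proof -
  interpret product_sigma_finite "\<lambda>_::'a. exp_measure"
    by (rule product_sigma_finite_exp_measure)
  have "emeasure (clock_space V) (PiE V (\<lambda>w. {l w * y<..})) = (\<Prod>w\<in>V. ennreal (exp (- (l w * y))))"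
    using assms by (simp add: emeasure_PiM emeasure_exp_measure_greaterThan)
  also have "\<dots> = ennreal (exp (- (\<Sum>w\<in>V. l w) * y))"
    using assms by (simp add: prod_ennreal sum_distrib_right sum_negf flip: exp_sum)
  finally show ?thesis .
qed

text \<open>Conditionally on the clock \<open>e v = y\<close> the other clocks exceed \<open>l w * y\<close> independently.\<close>
lemma prob_clock_race:
  fixes l :: "'v \<Rightarrow> real"
  assumes fin: "finite V" and v_mem: "v \<in> V" and l_nonneg: "\<And>w. w \<in> V - {v} \<Longrightarrow> l w \<ge> 0"
  shows "measure (clock_space V) {e \<in> space (clock_space V). \<forall>w\<in>V - {v}. l w * e v < e w} =
    1 / (1 + (\<Sum>w\<in>V - {v}. l w))"
proof -
  interpret product_sigma_finite "\<lambda>_::'v. exp_measure"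
    by (rule product_sigma_finite_exp_measure)
  define V' where "V' = V - {v}"
  have V_eq: "V = insert v V'" "v \<notin> V'" "finite V'" using v_mem fin by (auto simp: V'_def)
  let ?A = "{e \<in> space (clock_space V). \<forall>w\<in>V'. l w * e v < e w}"
  have sets_A: "?A \<in> sets (clock_space V)"
    using sets_clock_race[OF fin v_mem] by (simp add: V'_def)
  have sum_l_nonneg: "(\<Sum>w\<in>V'. l w) \<ge> 0" using l_nonneg unfolding V'_def by (rule sum_nonneg)
  have slice: "(\<integral>\<^sup>+ e. indicator ?A (e(v := y)) \<partial>clock_space V') =
      ennreal (exp (- (\<Sum>w\<in>V'. l w) * y))"
    if y_nonneg: "0 \<le> y" for y
  proof -
    have "(\<integral>\<^sup>+ e. indicator ?A (e(v := y)) \<partial>clock_space V') =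
      (\<integral>\<^sup>+ e. indicator (PiE V' (\<lambda>w. {l w * y<..})) e \<partial>clock_space V')"
    proof (intro nn_integral_cong)
      fix e assume "e \<in> space (clock_space V')"
      then have "e(v := y) \<in> ?A \<longleftrightarrow> e \<in> PiE V' (\<lambda>w. {l w * y<..})"
        using V_eq by (auto simp: space_PiM PiE_def extensional_def)
      then show "indicator ?A (e(v := y)) = (indicator (PiE V' (\<lambda>w. {l w * y<..})) e :: ennreal)"
        by (simp add: indicator_def)
    qed
    also have "\<dots> = emeasure (clock_space V') (PiE V' (\<lambda>w. {l w * y<..}))"
      using V_eq by (intro nn_integral_indicator sets_PiM_I_finite) auto
    also have "\<dots> = ennreal (exp (- (\<Sum>w\<in>V'. l w) * y))"
      using V_eq l_nonneg y_nonneg by (intro emeasure_clock_space_above) (auto simp: V'_def)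
    finally show ?thesis .
  qed
  have "emeasure (clock_space V) ?A = (\<integral>\<^sup>+ e. indicator ?A e \<partial>clock_space V)"
    using sets_A by simp
  also have "\<dots> = (\<integral>\<^sup>+ y. (\<integral>\<^sup>+ e. indicator ?A (e(v := y)) \<partial>clock_space V') \<partial>exp_measure)"
    using sets_A V_eq unfolding V_eq(1) by (intro product_nn_integral_insert_rev) auto
  also have "\<dots> = (\<integral>\<^sup>+ y. ennreal (exp (- (\<Sum>w\<in>V'. l w) * y)) \<partial>exp_measure)"
    using AE_exp_measure_nonneg by (intro nn_integral_cong_AE) (auto simp: slice)
  also have "\<dots> = ennreal (1 / (1 + (\<Sum>w\<in>V'. l w)))"
    using sum_l_nonneg by (rule nn_integral_exp_measure_exp)
  finally show ?thesis
    using sum_l_nonneg by (simp add: measure_def V'_def)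
qed

lemma min_one_sum_le:
  fixes r :: "'j \<Rightarrow> real"
  assumes "\<And>j. r j \<ge> 0"
  shows "min 1 (\<Sum>j\<in>J. r j) \<le> (\<Sum>j\<in>J. min 1 (r j))"
proof (induction J rule: infinite_finite_induct)
  case (insert j J)
  have "0 \<le> (\<Sum>j\<in>J. r j)" using assms by (rule sum_nonneg)
  then have "min 1 (r j + (\<Sum>j\<in>J. r j)) \<le> min 1 (r j) + min 1 (\<Sum>j\<in>J. r j)"
    using assms[of j] by linarith
  then show ?case using insert by simp
qed simp_all

definition wins_race :: "'v set \<Rightarrow> ('v \<Rightarrow> real) \<Rightarrow> ('v \<Rightarrow> real) \<Rightarrow> 'v \<Rightarrow> bool" where
  "wins_race V p e v \<longleftrightarrow> v \<in> V \<and> p v > 0 \<and> (\<forall>w\<in>V - {v}. p w * e v < p v * e w)"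

lemma wins_race_unique: "wins_race V p e v \<Longrightarrow> wins_race V p e w \<Longrightarrow> v = w"
  unfolding wins_race_def by (metis DiffI less_asym singletonD)

lemma some_wins_race_eq: "wins_race V p e v \<Longrightarrow> (SOME v. wins_race V p e v) = v"
  by (metis someI wins_race_unique)

lemma wins_race_iff:
  "v \<in> V \<Longrightarrow> p v > 0 \<Longrightarrow> wins_race V p e v \<longleftrightarrow> (\<forall>w\<in>V - {v}. p w / p v * e v < e w)"
  unfolding wins_race_def by (auto simp: field_simps)

lemma sets_common_winner:
  assumes "finite V" "finite I" "v \<in> V" "\<And>i. i \<in> I \<Longrightarrow> p i v > 0"
  shows "{e \<in> space (clock_space V). \<forall>i\<in>I. wins_race V (p i) e v} \<in> sets (clock_space V)"
proof (intro sets.sets_Collect_finite_All assms(2))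
  fix i assume "i \<in> I"
  then show "{e \<in> space (clock_space V). wins_race V (p i) e v} \<in> sets (clock_space V)"
    using sets_clock_race[of V v "\<lambda>w. p i w / p i v"] assms by (simp add: wins_race_iff)
qed

lemma sum_relative_weights_le:
  fixes p :: "'i \<Rightarrow> 'v \<Rightarrow> real"
  assumes fin: "finite V" "finite I" and I_nonempty: "I \<noteq> {}" and v_mem: "v \<in> V"
    and pos: "\<And>i. i \<in> I \<Longrightarrow> p i v > 0" and sum_1: "\<And>i. i \<in> I \<Longrightarrow> (\<Sum>w\<in>V. p i w) = 1"
  shows "1 + (\<Sum>w\<in>V - {v}. \<Sum>i\<in>I. p i w / p i v) \<le> (\<Sum>i\<in>I. 1 / p i v)"
proof -
  have "(\<Sum>w\<in>V - {v}. p i w / p i v) = 1 / p i v - 1" if "i \<in> I" for i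
    using sum_1[OF that] pos[OF that] fin v_mem
    by (simp add: sum_diff1 diff_divide_distrib flip: sum_divide_distrib)
  then have "(\<Sum>w\<in>V - {v}. \<Sum>i\<in>I. p i w / p i v) = (\<Sum>i\<in>I. 1 / p i v - 1)"
    by (subst sum.swap) simp
  also have "\<dots> = (\<Sum>i\<in>I. 1 / p i v) - card I" by (simp add: sum_subtractf)
  finally show ?thesis using fin I_nonempty by (simp add: Suc_le_eq card_gt_0_iff)
qed

text \<open>If \<open>v\<close> wins the race with the summed relative weights, it wins each of the races.\<close>
lemma prob_common_winner_ge:
  fixes p :: "'i \<Rightarrow> 'v \<Rightarrow> real"
  assumes fin: "finite V" "finite I" and I_nonempty: "I \<noteq> {}" and v_mem: "v \<in> V"
    and nonneg: "\<And>i w. i \<in> I \<Longrightarrow> p i w \<ge> 0" and pos: "\<And>i. i \<in> I \<Longrightarrow> p i v > 0"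
    and sum_1: "\<And>i. i \<in> I \<Longrightarrow> (\<Sum>w\<in>V. p i w) = 1"
  shows "measure (clock_space V) {e \<in> space (clock_space V). \<forall>i\<in>I. wins_race V (p i) e v} \<ge>
    1 / (\<Sum>i\<in>I. 1 / p i v)"
proof -
  define l where "l w = (\<Sum>i\<in>I. p i w / p i v)" for w
  have l_nonneg: "l w \<ge> 0" for w
    unfolding l_def by (intro sum_nonneg divide_nonneg_nonneg) (simp_all add: nonneg)
  let ?M = "clock_space V"
  let ?A = "{e \<in> space ?M. \<forall>i\<in>I. wins_race V (p i) e v}"
  let ?B = "{e \<in> space ?M. \<forall>w\<in>V - {v}. l w * e v < e w}"
  interpret prob_space ?M by (rule prob_space_clock_space)
  have "prob ?B \<le> prob ?A"
  proof (rule finite_measure_mono_AE)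
    have "AE e in ?M. 0 \<le> e v"
      using v_mem prob_space_exp_measure AE_exp_measure_nonneg by (intro AE_PiM_component) auto
    then show "AE e in ?M. e \<in> ?B \<longrightarrow> e \<in> ?A"
    proof eventually_elim
      case (elim e)
      have "p i w / p i v * e v < e w" if "e \<in> ?B" "i \<in> I" "w \<in> V - {v}" for i w
      proof -
        have "p i w / p i v \<le> l w"
          unfolding l_def using fin that nonneg by (intro member_le_sum) auto
        then have "p i w / p i v * e v \<le> l w * e v"
          using elim by (rule mult_right_mono)
        also have "\<dots> < e w" using that by blast
        finally show ?thesis .
      qed
      then show ?case using v_mem pos by (auto simp: wins_race_iff)
    qed
  qed (rule sets_common_winner[where p = p, OF fin v_mem pos])
  moreover have "prob ?B = 1 / (1 + (\<Sum>w\<in>V - {v}. l w))"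
    using fin v_mem l_nonneg by (intro prob_clock_race)
  moreover have "1 + (\<Sum>w\<in>V - {v}. l w) \<le> (\<Sum>i\<in>I. 1 / p i v)"
    unfolding l_def using fin I_nonempty v_mem pos sum_1 by (rule sum_relative_weights_le)
  moreover have "0 \<le> (\<Sum>w\<in>V - {v}. l w)"
    by (rule sum_nonneg) (rule l_nonneg)
  ultimately show ?thesis
    using frac_le[of 1 1 "1 + (\<Sum>w\<in>V - {v}. l w)" "\<Sum>i\<in>I. 1 / p i v"] by linarith
qed

lemma (in prob_space) exists_le_expectation:
  fixes X :: "'a \<Rightarrow> real"
  assumes "integrable M X"
  shows "\<exists>\<omega>\<in>space M. X \<omega> \<le> expectation X"
proof (rule ccontr)
  assume "\<not> ?thesis"
  then have "AE \<omega> in M. expectation X < X \<omega>" by (intro AE_I2) (auto simp: not_le)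
  from expectation_greater[OF assms this] show False by simp
qed

lemma (in prob_space) exists_realization_le:
  fixes X :: "'s \<Rightarrow> 'a \<Rightarrow> real"
  assumes fin: "finite (set_pmf S)"
    and integrable: "\<And>s. s \<in> set_pmf S \<Longrightarrow> integrable M (X s)"
    and expectation_le: "\<And>s. s \<in> set_pmf S \<Longrightarrow> expectation (X s) \<le> r s"
  shows "\<exists>\<omega>\<in>space M. measure_pmf.expectation S (\<lambda>s. X s \<omega>) \<le> measure_pmf.expectation S r"
proof -
  let ?X = "\<lambda>\<omega>. \<Sum>s\<in>set_pmf S. pmf S s * X s \<omega>"
  have "integrable M ?X" using integrable by (intro Bochner_Integration.integrable_sum) simp
  from exists_le_expectation[OF this] obtain \<omega> where "\<omega> \<in> space M" "?X \<omega> \<le> expectation ?X"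
    by blast
  moreover have "expectation ?X \<le> (\<Sum>s\<in>set_pmf S. pmf S s * r s)"
    using integrable expectation_le by (auto intro!: sum_mono mult_left_mono)
  ultimately show ?thesis using fin by (force simp: expectation_eq_sum)
qed

section \<open>One-shot matching\<close>

text \<open>The candidates are pairs of a symbol and one of \<open>N\<close> messages. The sender spreads its law \<open>a\<close>
  evenly over the messages; a receiver puts its law \<open>b\<close> on the message \<open>m\<close> it was sent.\<close>
definition sender_weight :: "nat \<Rightarrow> 'u pmf \<Rightarrow> 'u \<times> nat \<Rightarrow> real" where
  "sender_weight N a = (\<lambda>(u, m). pmf a u / N)"

definition receiver_weight :: "'u pmf \<Rightarrow> nat \<Rightarrow> 'u \<times> nat \<Rightarrow> real" where
  "receiver_weight b m = (\<lambda>(u, m'). if m' = m then pmf b u else 0)"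

definition sent_message :: "'u set \<Rightarrow> nat \<Rightarrow> 'u pmf \<Rightarrow> ('u \<times> nat \<Rightarrow> real) \<Rightarrow> nat" where
  "sent_message V N a e =
    (if \<exists>v. wins_race (V \<times> {1..N}) (sender_weight N a) e v
     then snd (SOME v. wins_race (V \<times> {1..N}) (sender_weight N a) e v) else 1)"

definition decoded_symbol :: "'u set \<Rightarrow> nat \<Rightarrow> 'u pmf \<Rightarrow> nat \<Rightarrow> ('u \<times> nat \<Rightarrow> real) \<Rightarrow> 'u" where
  "decoded_symbol V N b m e = fst (SOME v. wins_race (V \<times> {1..N}) (receiver_weight b m) e v)"

definition matched_via ::
  "'u set \<Rightarrow> nat \<Rightarrow> 'u pmf \<Rightarrow> 'i set \<Rightarrow> ('i \<Rightarrow> 'u pmf) \<Rightarrow> 'u \<Rightarrow> nat \<Rightarrow> ('u \<times> nat \<Rightarrow> real) \<Rightarrow> bool" where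
  "matched_via V N a I b u m e \<longleftrightarrow> wins_race (V \<times> {1..N}) (sender_weight N a) e (u, m) \<and>
    (\<forall>i\<in>I. wins_race (V \<times> {1..N}) (receiver_weight (b i) m) e (u, m))"

definition matched ::
  "'u set \<Rightarrow> nat \<Rightarrow> 'u pmf \<Rightarrow> 'i set \<Rightarrow> ('i \<Rightarrow> 'u pmf) \<Rightarrow> 'u \<Rightarrow> ('u \<times> nat \<Rightarrow> real) \<Rightarrow> bool" where
  "matched V N a I b u e \<longleftrightarrow> (\<exists>m\<in>{1..N}. matched_via V N a I b u m e)"

lemma sent_message_eq:
  "wins_race (V \<times> {1..N}) (sender_weight N a) e (u, m) \<Longrightarrow> sent_message V N a e = m"
  by (auto simp: sent_message_def some_wins_race_eq)

lemma decoded_symbol_eq: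
  "wins_race (V \<times> {1..N}) (receiver_weight b m) e (u, m') \<Longrightarrow> decoded_symbol V N b m e = u"
  by (simp add: decoded_symbol_def some_wins_race_eq)

lemma sent_message_range:
  assumes "N > 0"
  shows "sent_message V N a e \<in> {1..N}"
proof (cases "\<exists>v. wins_race (V \<times> {1..N}) (sender_weight N a) e v")
  case True
  then obtain u m where winner: "wins_race (V \<times> {1..N}) (sender_weight N a) e (u, m)" by auto
  then have "m \<in> {1..N}" by (simp add: wins_race_def)
  then show ?thesis by (simp add: sent_message_eq[OF winner])
qed (use assms in \<open>simp add: sent_message_def\<close>)

lemma matched_via_unique:
  "matched_via V N a I b u m e \<Longrightarrow> matched_via V N a I b u' m' e \<Longrightarrow> u = u' \<and> m = m'"
  using wins_race_unique[of "V \<times> {1..N}" "sender_weight N a" e "(u, m)" "(u', m')"]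
  by (simp add: matched_via_def)

lemma matched_unique: "matched V N a I b u e \<Longrightarrow> matched V N a I b u' e \<Longrightarrow> u = u'"
  unfolding matched_def by (blast dest: matched_via_unique)

lemma matched_imp_mem_set_pmf: "matched V N a I b u e \<Longrightarrow> u \<in> set_pmf a"
  by (auto simp: matched_def matched_via_def wins_race_def sender_weight_def set_pmf_iff)

lemma decoded_symbol_matched:
  assumes "matched V N a I b u e" "i \<in> I"
  shows "decoded_symbol V N (b i) (sent_message V N a e) e = u"
  using assms by (auto simp: matched_def matched_via_def sent_message_eq decoded_symbol_eq)

context
  fixes V :: "'u set" and N :: nat and a :: "'u pmf" and I :: "'i set" and b :: "'i \<Rightarrow> 'u pmf"
  assumes finite_V: "finite V" and finite_I: "finite I" and N_pos: "N > 0"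
    and set_a: "set_pmf a \<subseteq> V" and set_b: "\<And>i. i \<in> I \<Longrightarrow> set_pmf (b i) \<subseteq> V"
    and set_a_b: "\<And>i. i \<in> I \<Longrightarrow> set_pmf a \<subseteq> set_pmf (b i)"
begin

abbreviation clocks :: "('u \<times> nat \<Rightarrow> real) measure" where
  "clocks \<equiv> clock_space (V \<times> {1..N})"

lemma
  assumes u_mem: "u \<in> set_pmf a" and m_mem: "m \<in> {1..N}"
  shows sets_matched_via: "{e \<in> space clocks. matched_via V N a I b u m e} \<in> sets clocks"
      (is "?sets")
    and prob_matched_via_ge: "measure clocks {e \<in> space clocks. matched_via V N a I b u m e} \<ge>
      1 / (N / pmf a u + (\<Sum>i\<in>I. 1 / pmf (b i) u))" (is "?ge")
proof -
  define p where "p j = (case j of None \<Rightarrow> sender_weight N a | Some i \<Rightarrow> receiver_weight (b i) m)"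
    for j
  let ?I = "insert None (Some ` I)"
  have event: "{e \<in> space clocks. matched_via V N a I b u m e} =
      {e \<in> space clocks. \<forall>j\<in>?I. wins_race (V \<times> {1..N}) (p j) e (u, m)}"
    by (auto simp: matched_via_def p_def)
  have um_mem: "(u, m) \<in> V \<times> {1..N}" using u_mem m_mem set_a by auto
  have pos: "p j (u, m) > 0" if "j \<in> ?I" for j
    using that u_mem N_pos subsetD[OF set_a_b]
    by (auto simp: p_def sender_weight_def receiver_weight_def intro!: divide_pos_pos pmf_positive)
  have nonneg: "p j v \<ge> 0" for j v
    by (auto simp: p_def sender_weight_def receiver_weight_def split: option.split prod.split)
  have sum_1: "(\<Sum>v\<in>V \<times> {1..N}. p j v) = 1" if "j \<in> ?I" for j
    using that N_pos m_mem set_a set_b finite_V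
    by (auto simp: p_def sender_weight_def receiver_weight_def sum_pmf_eq_1
        simp flip: sum.cartesian_product)
  show ?sets
    unfolding event by (rule sets_common_winner) (use finite_V finite_I um_mem pos in auto)
  have "(\<Sum>j\<in>?I. 1 / p j (u, m)) = N / pmf a u + (\<Sum>i\<in>I. 1 / pmf (b i) u)"
    using finite_I by (simp add: sum.reindex p_def sender_weight_def receiver_weight_def)
  then show ?ge
    unfolding event
    using prob_common_winner_ge[of "V \<times> {1..N}" ?I "(u, m)" p] finite_V finite_I um_mem
      nonneg pos sum_1
    by simp
qed

lemma sets_matched:
  assumes "u \<in> set_pmf a"
  shows "{e \<in> space clocks. matched V N a I b u e} \<in> sets clocks"
  unfolding matched_def using sets_matched_via[OF assms] by (intro sets.sets_Collect_finite_Ex) auto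

lemma prob_matched_ge:
  assumes u_mem: "u \<in> set_pmf a"
  shows "measure clocks {e \<in> space clocks. matched V N a I b u e} \<ge>
    pmf a u * (1 - (\<Sum>i\<in>I. min 1 (pmf a u / (N * pmf (b i) u))))"
proof -
  interpret prob_space clocks by (rule prob_space_clock_space)
  have a_pos: "pmf a u > 0" using u_mem by (rule pmf_positive)
  define r where "r i = pmf a u / (N * pmf (b i) u)" for i
  have r_nonneg: "r i \<ge> 0" for i by (simp add: r_def)
  have "1 - (\<Sum>i\<in>I. min 1 (r i)) \<le> 1 / (1 + (\<Sum>i\<in>I. r i))"
  proof -
    have "1 - min 1 (\<Sum>i\<in>I. r i) \<le> 1 / (1 + (\<Sum>i\<in>I. r i))"
      using sum_nonneg[of I r] r_nonneg by (auto simp: min_def field_simps)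
    moreover have "min 1 (\<Sum>i\<in>I. r i) \<le> (\<Sum>i\<in>I. min 1 (r i))"
      using r_nonneg by (intro min_one_sum_le)
    ultimately show ?thesis by linarith
  qed
  then have "pmf a u * (1 - (\<Sum>i\<in>I. min 1 (r i))) \<le> pmf a u * (1 / (1 + (\<Sum>i\<in>I. r i)))"
    by (rule mult_left_mono) simp
  also have "\<dots> = N * (1 / (N / pmf a u + (\<Sum>i\<in>I. 1 / pmf (b i) u)))"
  proof -
    have expand: "N / pmf a u + (\<Sum>i\<in>I. 1 / pmf (b i) u) = N / pmf a u * (1 + (\<Sum>i\<in>I. r i))"
      using a_pos N_pos by (simp add: r_def distrib_left sum_distrib_left)
    show ?thesis
      unfolding expand using N_pos a_pos by simp
  qed
  also have "\<dots> \<le> (\<Sum>m\<in>{1..N}. prob {e \<in> space clocks. matched_via V N a I b u m e})"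
    using sum_mono[OF prob_matched_via_ge[OF u_mem], of "{1..N}"] by simp
  also have "\<dots> = prob (\<Union>m\<in>{1..N}. {e \<in> space clocks. matched_via V N a I b u m e})"
    using sets_matched_via[OF u_mem]
    by (intro finite_measure_finite_Union[symmetric])
      (auto simp: disjoint_family_on_def dest: matched_via_unique)
  also have "(\<Union>m\<in>{1..N}. {e \<in> space clocks. matched_via V N a I b u m e}) =
      {e \<in> space clocks. matched V N a I b u e}"
    by (auto simp: matched_def)
  finally show ?thesis by (simp only: r_def)
qed

definition matching_cost :: "('u \<Rightarrow> real) \<Rightarrow> real \<Rightarrow> ('u \<times> nat \<Rightarrow> real) \<Rightarrow> real" where
  "matching_cost c cmax e = cmax - (\<Sum>u\<in>set_pmf a. of_bool (matched V N a I b u e) * (cmax - c u))"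

lemma finite_set_a: "finite (set_pmf a)"
  using finite_V set_a by (rule rev_finite_subset)

lemma matching_cost_matched:
  assumes "matched V N a I b u e"
  shows "matching_cost c cmax e = c u"
proof -
  have "of_bool (matched V N a I b u' e) * (cmax - c u') = (if u' = u then cmax - c u else 0)"
    for u'
    using assms matched_unique by fastforce
  then show ?thesis
    using matched_imp_mem_set_pmf[OF assms] by (simp add: matching_cost_def finite_set_a)
qed

lemma matching_cost_unmatched:
  "(\<And>u. \<not> matched V N a I b u e) \<Longrightarrow> matching_cost c cmax e = cmax"
  by (simp add: matching_cost_def)

lemma has_bochner_integral_matching_cost:
  "has_bochner_integral clocks (matching_cost c cmax)
    (cmax - (\<Sum>u\<in>set_pmf a. measure clocks {e \<in> space clocks. matched V N a I b u e} *
      (cmax - c u)))"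
proof -
  interpret prob_space clocks by (rule prob_space_clock_space)
  have "has_bochner_integral clocks (\<lambda>e. of_bool (matched V N a I b u e) :: real)
      (prob {e \<in> space clocks. matched V N a I b u e})" if "u \<in> set_pmf a" for u
    using has_bochner_integral_real_indicator[OF sets_matched[OF that]]
    unfolding emeasure_eq_measure
    by (rule has_bochner_integral_cong[THEN iffD1, rotated -1]) (auto simp: indicator_def)
  moreover have "has_bochner_integral clocks (\<lambda>_. cmax) cmax"
    by (simp only: has_bochner_integral_iff integrable_const lebesgue_integral_const prob_space
        scaleR_one simp_thms)
  ultimately show ?thesis
    unfolding matching_cost_def[abs_def]
    by (intro has_bochner_integral_diff has_bochner_integral_sum has_bochner_integral_mult_left)
qed

lemma integral_matching_cost_le:
  assumes c_bounds: "\<And>u. 0 \<le> c u" "\<And>u. c u \<le> cmax"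
  shows "integral\<^sup>L clocks (matching_cost c cmax) \<le> measure_pmf.expectation a
    (\<lambda>u. c u + cmax * (\<Sum>i\<in>I. min 1 (pmf a u / (N * pmf (b i) u))))"
proof -
  define err where "err u = (\<Sum>i\<in>I. min 1 (pmf a u / (N * pmf (b i) u)))" for u
  have err_nonneg: "err u \<ge> 0" for u by (simp add: err_def sum_nonneg)
  have "integral\<^sup>L clocks (matching_cost c cmax) =
      cmax - (\<Sum>u\<in>set_pmf a. measure clocks {e \<in> space clocks. matched V N a I b u e} *
        (cmax - c u))"
    using has_bochner_integral_matching_cost by (rule has_bochner_integral_integral_eq)
  also have "\<dots> \<le> cmax - (\<Sum>u\<in>set_pmf a. pmf a u * (1 - err u) * (cmax - c u))"
    using c_bounds prob_matched_ge
    by (intro diff_left_mono sum_mono mult_right_mono) (auto simp: err_def)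
  also have "\<dots> \<le> cmax - (\<Sum>u\<in>set_pmf a. pmf a u * (cmax - c u - cmax * err u))"
  proof (intro diff_left_mono sum_mono)
    fix u
    have "cmax - c u - cmax * err u \<le> (1 - err u) * (cmax - c u)"
      using c_bounds(1)[of u] err_nonneg[of u] by (simp add: algebra_simps)
    then show "pmf a u * (cmax - c u - cmax * err u) \<le> pmf a u * (1 - err u) * (cmax - c u)"
      by (simp add: mult.assoc mult_left_mono)
  qed
  also have "\<dots> = cmax - measure_pmf.expectation a (\<lambda>u. cmax - (c u + cmax * err u))"
    by (simp add: expectation_eq_sum finite_set_a diff_diff_eq)
  also have "\<dots> = measure_pmf.expectation a (\<lambda>u. c u + cmax * err u)"
    by (simp add: integrable_measure_pmf_finite finite_set_a)
  finally show ?thesis by (simp only: err_def)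
qed

lemma matching_cost_le: "(\<And>u. c u \<le> cmax) \<Longrightarrow> matching_cost c cmax e \<le> cmax"
  by (simp add: matching_cost_def sum_nonneg)

lemma decoded_cost_le_matching_cost:
  assumes "i \<in> I" "\<And>u. c u \<le> cmax"
  shows "c (decoded_symbol V N (b i) (sent_message V N a e) e) \<le> matching_cost c cmax e"
proof (cases "\<exists>u. matched V N a I b u e")
  case True
  then show ?thesis using assms(1) by (auto simp: decoded_symbol_matched matching_cost_matched)
qed (simp add: matching_cost_unmatched assms(2))

end

text \<open>\<open>T\<close> is the set of situations in which an earlier stage has succeeded. The laws need not be
  compatible outside of it, where the cost is bounded by \<open>cmax\<close>.\<close>
lemma exists_clocks_matching_cost_le:
  fixes S :: "'s pmf" and a :: "'s \<Rightarrow> 'u pmf" and b :: "'s \<Rightarrow> 'i \<Rightarrow> 'u pmf"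
  assumes fin: "finite (set_pmf S)" "finite V" "finite I" and N_pos: "N > 0"
    and set_a: "\<And>s. s \<in> set_pmf S \<inter> T \<Longrightarrow> set_pmf (a s) \<subseteq> V"
    and set_b: "\<And>s i. s \<in> set_pmf S \<inter> T \<Longrightarrow> i \<in> I \<Longrightarrow> set_pmf (b s i) \<subseteq> V"
    and set_a_b: "\<And>s i. s \<in> set_pmf S \<inter> T \<Longrightarrow> i \<in> I \<Longrightarrow> set_pmf (a s) \<subseteq> set_pmf (b s i)"
    and c_bounds: "\<And>s u. 0 \<le> c s u" "\<And>s u. c s u \<le> cmax"
  shows "\<exists>e. measure_pmf.expectation S
      (\<lambda>s. if s \<in> T then matching_cost V N (a s) I (b s) (c s) cmax e else cmax) \<le>
    measure_pmf.expectation S (\<lambda>s. if s \<in> T then min cmax (measure_pmf.expectation (a s)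
      (\<lambda>u. c s u + cmax * (\<Sum>i\<in>I. min 1 (pmf (a s) u / (N * pmf (b s i) u))))) else cmax)"
    (is "\<exists>e. _ \<le> measure_pmf.expectation S ?bound")
proof -
  let ?M = "clock_space (V \<times> {1..N})"
  interpret prob_space ?M by (rule prob_space_clock_space)
  define cost where "cost s e =
      (if s \<in> T then matching_cost V N (a s) I (b s) (c s) cmax e else cmax)"
    for s e
  have "integrable ?M (cost s) \<and> expectation (cost s) \<le> ?bound s" if s_mem: "s \<in> set_pmf S" for s
  proof (cases "s \<in> T")
    case True
    then have "s \<in> set_pmf S \<inter> T" using s_mem by simp
    note laws = fin(2,3) N_pos set_a[OF this] set_b[OF this] set_a_b[OF this]
    have cost_eq: "cost s = matching_cost V N (a s) I (b s) (c s) cmax"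
      using True by (simp add: cost_def fun_eq_iff)
    have "integrable ?M (cost s)"
      unfolding cost_eq by (intro integrable.intros[OF has_bochner_integral_matching_cost] laws)
    moreover from this have "expectation (cost s) \<le> cmax"
      using c_bounds(2) by (intro integral_le_const AE_I2)
        (auto simp only: cost_eq matching_cost_le[OF laws])
    moreover have "expectation (cost s) \<le> measure_pmf.expectation (a s)
        (\<lambda>u. c s u + cmax * (\<Sum>i\<in>I. min 1 (pmf (a s) u / (N * pmf (b s i) u))))"
      unfolding cost_eq by (intro integral_matching_cost_le laws c_bounds)
    ultimately show ?thesis using True by simp
  next
    case False
    then have "cost s = (\<lambda>_. cmax)" by (simp add: cost_def fun_eq_iff)
    then show ?thesis using False prob_space integrable_const[of cmax] by simp
  qed
  then have "\<exists>e\<in>space ?M. measure_pmf.expectation S (\<lambda>s. cost s e) \<le>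
      measure_pmf.expectation S ?bound"
    using fin(1) by (intro exists_realization_le) blast+
  then show ?thesis unfolding cost_def by blast
qed

section \<open>One-shot coding with a helper\<close>

text \<open>\<open>A\<close>, \<open>B\<close>, \<open>C\<close> are the laws of the first symbol \<open>u\<close> used by the helper, the encoder and the
  decoder; \<open>E\<close>, \<open>F\<close> are the laws of the second symbol \<open>w\<close> used by the encoder and the decoder.\<close>
locale one_shot_problem =
  fixes S :: "'s pmf" and X :: "'s \<Rightarrow> 'x" and Y :: "'s \<Rightarrow> 'y" and Z :: "'s \<Rightarrow> 'z"
    and A :: "'y \<Rightarrow> 'u pmf" and B :: "'x \<Rightarrow> 'u pmf" and C :: "'z \<Rightarrow> 'u pmf"
    and E :: "'x \<Rightarrow> 'u \<Rightarrow> 'w pmf" and F :: "'u \<Rightarrow> 'z \<Rightarrow> 'w pmf"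
    and c :: "'s \<Rightarrow> 'u \<Rightarrow> 'w \<Rightarrow> real" and cmax :: real and M Md :: nat
  assumes finite_S: "finite (set_pmf S)"
    and finite_B: "\<And>s. s \<in> set_pmf S \<Longrightarrow> finite (set_pmf (B (X s)))"
    and finite_C: "\<And>s. s \<in> set_pmf S \<Longrightarrow> finite (set_pmf (C (Z s)))"
    and finite_F: "\<And>s u. s \<in> set_pmf S \<Longrightarrow> u \<in> set_pmf (A (Y s)) \<Longrightarrow> finite (set_pmf (F u (Z s)))"
    and set_A_B: "\<And>s. s \<in> set_pmf S \<Longrightarrow> set_pmf (A (Y s)) \<subseteq> set_pmf (B (X s))"
    and set_A_C: "\<And>s. s \<in> set_pmf S \<Longrightarrow> set_pmf (A (Y s)) \<subseteq> set_pmf (C (Z s))"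
    and set_E_F: "\<And>s u. s \<in> set_pmf S \<Longrightarrow> u \<in> set_pmf (A (Y s)) \<Longrightarrow>
      set_pmf (E (X s) u) \<subseteq> set_pmf (F u (Z s))"
    and c_nonneg: "\<And>s u w. 0 \<le> c s u w" and c_le: "\<And>s u w. c s u w \<le> cmax"
    and M_pos: "M > 0" and Md_pos: "Md > 0"
begin

definition u_symbols :: "'u set" where
  "u_symbols = (\<Union>s\<in>set_pmf S. set_pmf (B (X s)) \<union> set_pmf (C (Z s)))"

definition w_symbols :: "'w set" where
  "w_symbols = (\<Union>s\<in>set_pmf S. \<Union>u\<in>set_pmf (A (Y s)). set_pmf (F u (Z s)))"

definition receiver_law :: "'s \<Rightarrow> bool \<Rightarrow> 'u pmf" where
  "receiver_law s i = (if i then B (X s) else C (Z s))"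

definition helper_error :: "'s \<Rightarrow> 'u \<Rightarrow> real" where
  "helper_error s u = min 1 (pmf (A (Y s)) u / (Md * pmf (B (X s)) u)) +
  min 1 (pmf (A (Y s)) u / (Md * pmf (C (Z s)) u))"

definition encoder_error :: "'s \<Rightarrow> 'u \<Rightarrow> 'w \<Rightarrow> real" where
  "encoder_error s u w = min 1 (pmf (E (X s) u) w / (M * pmf (F u (Z s)) w))"

definition second_stage_cost :: "'s \<Rightarrow> 'u \<Rightarrow> real" where
  "second_stage_cost s u =
  measure_pmf.expectation (E (X s) u) (\<lambda>w. c s u w + cmax * encoder_error s u w)"

definition first_stage_cost :: "'s \<Rightarrow> ('u \<times> nat \<Rightarrow> real) \<Rightarrow> real" where
  "first_stage_cost s e = matching_cost u_symbols Md (A (Y s)) UNIV (receiver_law s)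
  (\<lambda>u. min cmax (second_stage_cost s u)) cmax e"

lemma cmax_nonneg: "0 \<le> cmax"
  using c_nonneg c_le by (rule order.trans)

lemma finite_set_A: "s \<in> set_pmf S \<Longrightarrow> finite (set_pmf (A (Y s)))"
  using finite_B set_A_B by (rule rev_finite_subset)

lemma finite_u_symbols: "finite u_symbols"
  using finite_S finite_B finite_C by (simp add: u_symbols_def)

lemma finite_w_symbols: "finite w_symbols"
  using finite_S finite_set_A finite_F by (simp add: w_symbols_def)

lemma set_receiver_law:
  assumes "s \<in> set_pmf S"
  shows "set_pmf (receiver_law s i) \<subseteq> u_symbols"
    and "set_pmf (A (Y s)) \<subseteq> set_pmf (receiver_law s i)"
    and "set_pmf (A (Y s)) \<subseteq> u_symbols"
  using assms set_A_B[OF assms] set_A_C[OF assms] by (auto simp: receiver_law_def u_symbols_def)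

lemma second_stage_cost_nonneg: "0 \<le> second_stage_cost s u"
  unfolding second_stage_cost_def encoder_error_def
  using c_nonneg cmax_nonneg by (intro integral_nonneg_AE AE_pmfI) simp

lemma exists_first_stage:
  "\<exists>e. measure_pmf.expectation S (\<lambda>s. first_stage_cost s e) \<le>
    measure_pmf.expectation S (\<lambda>s. measure_pmf.expectation (A (Y s))
      (\<lambda>u. second_stage_cost s u + cmax * helper_error s u))"
proof -
  let ?capped = "\<lambda>s u. min cmax (second_stage_cost s u)"
  have "\<exists>e. measure_pmf.expectation S (\<lambda>s. if s \<in> UNIV then first_stage_cost s e else cmax) \<le>
    measure_pmf.expectation S (\<lambda>s. if s \<in> UNIV then min cmax (measure_pmf.expectation (A (Y s))
      (\<lambda>u. ?capped s u + cmax *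
        (\<Sum>i\<in>UNIV. min 1 (pmf (A (Y s)) u / (Md * pmf (receiver_law s i) u)))))
      else cmax)"
    unfolding first_stage_cost_def
    by (rule exists_clocks_matching_cost_le)
      (use finite_S finite_u_symbols Md_pos set_receiver_law cmax_nonneg second_stage_cost_nonneg
        in auto)
  then obtain e where "measure_pmf.expectation S (\<lambda>s. first_stage_cost s e) \<le>
    measure_pmf.expectation S (\<lambda>s. min cmax (measure_pmf.expectation (A (Y s))
      (\<lambda>u. ?capped s u + cmax * helper_error s u)))"
    by (auto simp: UNIV_bool receiver_law_def helper_error_def add.commute)
  also have "\<dots> \<le> measure_pmf.expectation S (\<lambda>s. measure_pmf.expectation (A (Y s))
      (\<lambda>u. second_stage_cost s u + cmax * helper_error s u))"
    by (intro expectation_mono_finite finite_S min.coboundedI2 finite_set_A) simp_all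
  finally show ?thesis by blast
qed

definition helper_message :: "('u \<times> nat \<Rightarrow> real) \<Rightarrow> 's \<Rightarrow> nat" where
  "helper_message e s = sent_message u_symbols Md (A (Y s)) e"

definition encoder_symbol :: "('u \<times> nat \<Rightarrow> real) \<Rightarrow> 's \<Rightarrow> 'u" where
  "encoder_symbol e s = decoded_symbol u_symbols Md (B (X s)) (helper_message e s) e"

definition decoder_symbol :: "('u \<times> nat \<Rightarrow> real) \<Rightarrow> 's \<Rightarrow> 'u" where
  "decoder_symbol e s = decoded_symbol u_symbols Md (C (Z s)) (helper_message e s) e"

definition first_stage_matched :: "('u \<times> nat \<Rightarrow> real) \<Rightarrow> 's set" where
  "first_stage_matched e =
  {s. \<exists>u. matched u_symbols Md (A (Y s)) UNIV (receiver_law s) u e}"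

lemma symbols_first_stage_matched:
  assumes "matched u_symbols Md (A (Y s)) UNIV (receiver_law s) u e"
  shows "encoder_symbol e s = u" "decoder_symbol e s = u" "u \<in> set_pmf (A (Y s))"
  using decoded_symbol_matched[OF assms, of True] decoded_symbol_matched[OF assms, of False]
    matched_imp_mem_set_pmf[OF assms]
  by (simp_all add: encoder_symbol_def decoder_symbol_def helper_message_def receiver_law_def)

lemma first_stage_cost_eq:
  assumes "s \<in> set_pmf S"
  shows "first_stage_cost s e = (if s \<in> first_stage_matched e
    then min cmax (second_stage_cost s (decoder_symbol e s)) else cmax)"
proof -
  note laws = finite_u_symbols finite_class.finite_UNIV Md_pos set_receiver_law(3,1,2)[OF assms]
  show ?thesis
  proof (cases "s \<in> first_stage_matched e")
    case True
    then obtain u where matched_u: "matched u_symbols Md (A (Y s)) UNIV (receiver_law s) u e"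
      by (auto simp: first_stage_matched_def)
    then show ?thesis
      unfolding first_stage_cost_def matching_cost_matched[OF laws matched_u]
      using True by (simp add: symbols_first_stage_matched(2))
  next
    case False
    then show ?thesis
      unfolding first_stage_cost_def
      by (subst matching_cost_unmatched[OF laws]) (auto simp: first_stage_matched_def)
  qed
qed

lemma second_stage_laws:
  assumes "s \<in> set_pmf S \<inter> first_stage_matched e"
  shows "encoder_symbol e s = decoder_symbol e s"
    and "set_pmf (E (X s) (encoder_symbol e s)) \<subseteq> w_symbols"
    and "set_pmf (F (decoder_symbol e s) (Z s)) \<subseteq> w_symbols"
    and "set_pmf (E (X s) (encoder_symbol e s)) \<subseteq> set_pmf (F (decoder_symbol e s) (Z s))"
proof -
  obtain u where "matched u_symbols Md (A (Y s)) UNIV (receiver_law s) u e"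
    using assms by (auto simp: first_stage_matched_def)
  note symbols_eq = symbols_first_stage_matched[OF this]
  then show "encoder_symbol e s = decoder_symbol e s"
    and E_subset_F: "set_pmf (E (X s) (encoder_symbol e s)) \<subseteq>
        set_pmf (F (decoder_symbol e s) (Z s))"
    and F_subset: "set_pmf (F (decoder_symbol e s) (Z s)) \<subseteq> w_symbols"
    using assms set_E_F[of s u] by (auto simp: w_symbols_def)
  show "set_pmf (E (X s) (encoder_symbol e s)) \<subseteq> w_symbols"
    using E_subset_F F_subset by (rule order.trans)
qed

lemma exists_second_stage:
  "\<exists>e'. measure_pmf.expectation S (\<lambda>s. c s (decoder_symbol e s)
      (decoded_symbol w_symbols M (F (decoder_symbol e s) (Z s))
        (sent_message w_symbols M (E (X s) (encoder_symbol e s)) e') e')) \<le>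
    measure_pmf.expectation S (\<lambda>s. first_stage_cost s e)"
proof -
  let ?T = "first_stage_matched e"
  let ?a = "\<lambda>s. E (X s) (encoder_symbol e s)" and ?b = "\<lambda>s _::unit. F (decoder_symbol e s) (Z s)"
    and ?c = "\<lambda>s. c s (decoder_symbol e s)"
  define cost where "cost e' s =
    (if s \<in> ?T then matching_cost w_symbols M (?a s) UNIV (?b s) (?c s) cmax e' else cmax)" for e' s
  have "\<exists>e'. measure_pmf.expectation S (cost e') \<le>
    measure_pmf.expectation S (\<lambda>s. if s \<in> ?T then min cmax (measure_pmf.expectation (?a s)
      (\<lambda>w. ?c s w + cmax * (\<Sum>i\<in>UNIV. min 1 (pmf (?a s) w / (M * pmf (?b s i) w))))) else cmax)"
    unfolding cost_def
    by (rule exists_clocks_matching_cost_le)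
      (use finite_S finite_w_symbols M_pos second_stage_laws c_nonneg c_le in auto)
  also have "measure_pmf.expectation S (\<lambda>s. if s \<in> ?T then min cmax (measure_pmf.expectation (?a s)
      (\<lambda>w. ?c s w + cmax * (\<Sum>i\<in>UNIV. min 1 (pmf (?a s) w / (M * pmf (?b s i) w))))) else cmax) =
    measure_pmf.expectation S (\<lambda>s. first_stage_cost s e)"
    by (intro expectation_cong_pmf)
      (auto simp: first_stage_cost_eq second_stage_cost_def encoder_error_def second_stage_laws(1)
        UNIV_unit)
  finally obtain e' where cost_le: "measure_pmf.expectation S (cost e') \<le>
      measure_pmf.expectation S (\<lambda>s. first_stage_cost s e)"
    by blast
  have "?c s (decoded_symbol w_symbols M (?b s ()) (sent_message w_symbols M (?a s) e') e') \<le>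
      cost e' s"
    if s_mem: "s \<in> set_pmf S" for s
  proof (cases "s \<in> ?T")
    case True
    with s_mem have "s \<in> set_pmf S \<inter> ?T" by simp
    note laws = finite_w_symbols finite_class.finite_UNIV M_pos second_stage_laws(2-4)[OF this]
    show ?thesis
      using True c_le
        decoded_cost_le_matching_cost[where a = "?a s" and b = "?b s", OF laws, of "()"]
      by (simp add: cost_def)
  qed (simp add: cost_def c_le)
  then show ?thesis
    by (intro exI[of _ e'] order.trans[OF expectation_mono_finite[OF finite_S] cost_le])
qed

lemma finite_set_E: "s \<in> set_pmf S \<Longrightarrow> u \<in> set_pmf (A (Y s)) \<Longrightarrow> finite (set_pmf (E (X s) u))"
  by (rule finite_subset[OF set_E_F finite_F])

lemma ideal_cost_eq:
  "measure_pmf.expectation S (\<lambda>s. measure_pmf.expectation (A (Y s))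
      (\<lambda>u. second_stage_cost s u + cmax * helper_error s u)) =
    measure_pmf.expectation (joint_pmf (joint_pmf S (\<lambda>s. A (Y s))) (\<lambda>(s, u). E (X s) u))
      (\<lambda>((s, u), w). c s u w + cmax * (encoder_error s u w + helper_error s u))"
proof -
  have "measure_pmf.expectation S (\<lambda>s. measure_pmf.expectation (A (Y s))
      (\<lambda>u. second_stage_cost s u + cmax * helper_error s u)) =
    measure_pmf.expectation (joint_pmf S (\<lambda>s. A (Y s)))
      (\<lambda>(s, u). second_stage_cost s u + cmax * helper_error s u)"
    by (simp add: expectation_joint_pmf finite_S finite_set_A)
  also have "\<dots> = measure_pmf.expectation (joint_pmf S (\<lambda>s. A (Y s)))
    (\<lambda>(s, u). measure_pmf.expectation (E (X s) u)
      (\<lambda>w. c s u w + cmax * (encoder_error s u w + helper_error s u)))"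
    by (intro expectation_cong_pmf)
      (auto simp: set_joint_pmf second_stage_cost_def integrable_measure_pmf_finite finite_set_E
        distrib_left)
  also have "\<dots> = measure_pmf.expectation
      (joint_pmf (joint_pmf S (\<lambda>s. A (Y s))) (\<lambda>(s, u). E (X s) u))
      (\<lambda>((s, u), w). c s u w + cmax * (encoder_error s u w + helper_error s u))"
    by (subst expectation_joint_pmf)
      (auto simp: set_joint_pmf finite_S finite_set_A finite_set_E case_prod_unfold)
  finally show ?thesis .
qed

lemma one_shot_coding:
  obtains fd f g where "\<And>y. fd y \<in> {1..Md}" "\<And>x m. f x m \<in> {1..M}"
    "measure_pmf.expectation S
        (\<lambda>s. case g (f (X s) (fd (Y s))) (fd (Y s)) (Z s) of (u, w) \<Rightarrow> c s u w) \<le>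
      measure_pmf.expectation (joint_pmf (joint_pmf S (\<lambda>s. A (Y s))) (\<lambda>(s, u). E (X s) u))
        (\<lambda>((s, u), w). c s u w + cmax * (encoder_error s u w + helper_error s u))"
proof -
  obtain e where first_stage_le: "measure_pmf.expectation S (\<lambda>s. first_stage_cost s e) \<le>
    measure_pmf.expectation S (\<lambda>s. measure_pmf.expectation (A (Y s))
      (\<lambda>u. second_stage_cost s u + cmax * helper_error s u))"
    using exists_first_stage by blast
  obtain e' where second_stage_le: "measure_pmf.expectation S (\<lambda>s. c s (decoder_symbol e s)
      (decoded_symbol w_symbols M (F (decoder_symbol e s) (Z s))
        (sent_message w_symbols M (E (X s) (encoder_symbol e s)) e') e')) \<le>
    measure_pmf.expectation S (\<lambda>s. first_stage_cost s e)"
    using exists_second_stage[of e] by blast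
  define fd where "fd y = sent_message u_symbols Md (A y) e" for y
  define f where "f x m = sent_message w_symbols M (E x (decoded_symbol u_symbols Md (B x) m e)) e'"
    for x m
  define g where "g k m z = (let u = decoded_symbol u_symbols Md (C z) m e
      in (u, decoded_symbol w_symbols M (F u z) k e'))" for k m z
  show thesis
  proof (rule that)
    show "fd y \<in> {1..Md}" "f x m \<in> {1..M}" for x y m
      unfolding fd_def f_def using M_pos Md_pos by (simp_all only: sent_message_range)
    show "measure_pmf.expectation S
        (\<lambda>s. case g (f (X s) (fd (Y s))) (fd (Y s)) (Z s) of (u, w) \<Rightarrow> c s u w) \<le>
      measure_pmf.expectation (joint_pmf (joint_pmf S (\<lambda>s. A (Y s))) (\<lambda>(s, u). E (X s) u))
        (\<lambda>((s, u), w). c s u w + cmax * (encoder_error s u w + helper_error s u))"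
      using order.trans[OF second_stage_le first_stage_le] unfolding ideal_cost_eq
      by (simp add: fd_def f_def g_def Let_def encoder_symbol_def decoder_symbol_def
          helper_message_def)
  qed
qed

end

section \<open>Memoryless extensions\<close>

lemma pair_pmf_eq_joint_pmf: "pair_pmf p q = joint_pmf p (\<lambda>_. q)"
  by (simp add: pair_pmf_def joint_pmf_def map_pmf_def)

lemma iid_Suc_pair: "iid (Suc n) P = map_pmf (\<lambda>(a, as). a # as) (pair_pmf P (iid n P))"
  by (simp add: pair_pmf_def map_bind_pmf map_pmf_def bind_assoc_pmf bind_return_pmf)

lemma set_pmf_iid: "set_pmf (iid n P) = {t. length t = n \<and> set t \<subseteq> set_pmf P}"
proof (induction n)
  case (Suc n)
  show ?case
    unfolding iid_Suc_pair set_map_pmf set_pair_pmf Suc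
    by (auto simp: length_Suc_conv image_iff)
qed auto

lemma finite_set_pmf_iid:
  assumes "finite (set_pmf P)"
  shows "finite (set_pmf (iid n P))"
  using finite_lists_length_eq[OF assms, of n] by (simp add: set_pmf_iid conj_commute)

lemma iid_map_pmf: "iid n (map_pmf f P) = map_pmf (map f) (iid n P)"
proof (induction n)
  case (Suc n)
  have "iid (Suc n) (map_pmf f P) = map_pmf (\<lambda>(a, as). f a # map f as) (pair_pmf P (iid n P))"
    unfolding iid_Suc_pair Suc pair_map_pmf1 pair_map_pmf2 map_pmf_comp
    by (simp add: case_prod_unfold)
  then show ?case
    unfolding iid_Suc_pair map_pmf_comp by (simp add: case_prod_unfold)
qed simp

primrec product_kernel :: "('a \<Rightarrow> 'b pmf) \<Rightarrow> 'a list \<Rightarrow> 'b list pmf" where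
  "product_kernel K [] = return_pmf []"
| "product_kernel K (a # as) = map_pmf (\<lambda>(b, bs). b # bs) (pair_pmf (K a) (product_kernel K as))"

lemma product_kernel_map: "product_kernel K (map f as) = product_kernel (\<lambda>a. K (f a)) as"
  by (induction as) simp_all

lemma set_pmf_product_kernel:
  "set_pmf (product_kernel K as) = {bs. list_all2 (\<lambda>b a. b \<in> set_pmf (K a)) bs as}"
  by (induction as) (auto simp: list_all2_Cons2 image_iff)

lemma finite_set_pmf_product_kernel:
  "(\<And>a. a \<in> set as \<Longrightarrow> finite (set_pmf (K a))) \<Longrightarrow> finite (set_pmf (product_kernel K as))"
  by (induction as) auto

lemma set_pmf_product_kernel_mono:
  assumes "\<And>a. a \<in> set as \<Longrightarrow> set_pmf (K a) \<subseteq> set_pmf (L a)"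
  shows "set_pmf (product_kernel K as) \<subseteq> set_pmf (product_kernel L as)"
  unfolding set_pmf_product_kernel using assms by (auto elim!: list.rel_mono_strong)

lemma pmf_product_kernel_map:
  "pmf (product_kernel K (map f t)) (map g t) = prod_list (map (\<lambda>\<omega>. pmf (K (f \<omega>)) (g \<omega>)) t)"
proof (induction t)
  case (Cons \<omega> t)
  have "inj (\<lambda>(b, bs). b # bs)" by (auto simp: inj_def)
  from pmf_map_inj'[OF this, of _ "(g \<omega>, map g t)"] show ?case
    using Cons by (simp add: pmf_pair)
qed simp

lemma iid_joint_pmf:
  "map_pmf (\<lambda>t. (map fst t, map snd t)) (iid n (joint_pmf p K)) =
    joint_pmf (iid n p) (product_kernel K)"
proof (induction n)
  case 0
  show ?case by (simp add: joint_pmf_def bind_return_pmf)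
next
  case (Suc n)
  have "map_pmf (\<lambda>t. (map fst t, map snd t)) (iid (Suc n) (joint_pmf p K)) =
    bind_pmf p (\<lambda>a. bind_pmf (K a) (\<lambda>b. map_pmf (\<lambda>(as, bs). (a # as, b # bs))
      (map_pmf (\<lambda>t. (map fst t, map snd t)) (iid n (joint_pmf p K)))))"
    by (simp add: joint_pmf_def map_bind_pmf bind_map_pmf bind_assoc_pmf map_pmf_comp map_pmf_def
        bind_return_pmf case_prod_unfold)
  also have "\<dots> = bind_pmf p (\<lambda>a. bind_pmf (iid n p) (\<lambda>as. bind_pmf (K a) (\<lambda>b.
      map_pmf (\<lambda>bs. (a # as, b # bs)) (product_kernel K as))))"
    unfolding Suc by (subst bind_commute_pmf) (simp add: joint_pmf_def map_bind_pmf map_pmf_comp)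
  also have "\<dots> = joint_pmf (iid (Suc n) p) (product_kernel K)"
    by (simp add: joint_pmf_def pair_pmf_def map_bind_pmf bind_assoc_pmf map_pmf_def
        bind_return_pmf case_prod_unfold)
  finally show ?case .
qed

lemma prod_list_divide:
  fixes f g :: "'a \<Rightarrow> 'b::field"
  shows "prod_list (map f t) / prod_list (map g t) = prod_list (map (\<lambda>a. f a / g a) t)"
  by (induction t) (auto simp flip: times_divide_times_eq)

lemma prod_list_eq_powr_sum_list_log:
  fixes \<rho> :: "'a \<Rightarrow> real"
  assumes "\<And>a. a \<in> set t \<Longrightarrow> \<rho> a > 0"
  shows "prod_list (map \<rho> t) = 2 powr (\<Sum>a\<leftarrow>t. log 2 (\<rho> a))"
  using assms by (induction t) (simp_all add: powr_add)

context
  fixes P :: "'a pmf"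
  assumes fin: "finite (set_pmf P)"
begin

lemma expectation_iid_Suc:
  fixes h :: "'a list \<Rightarrow> real"
  shows "measure_pmf.expectation (iid (Suc n) P) h =
    measure_pmf.expectation P (\<lambda>a. measure_pmf.expectation (iid n P) (\<lambda>as. h (a # as)))"
  unfolding iid_Suc_pair
  using fin by (simp add: pair_pmf_eq_joint_pmf expectation_joint_pmf finite_set_pmf_iid)

lemma expectation_iid_sum_list:
  fixes h :: "'a \<Rightarrow> real"
  shows "measure_pmf.expectation (iid n P) (\<lambda>t. \<Sum>a\<leftarrow>t. h a) = n * measure_pmf.expectation P h"
proof (induction n)
  case (Suc n)
  then show ?case
    unfolding expectation_iid_Suc
    using fin by (simp add: algebra_simps integrable_measure_pmf_finite finite_set_pmf_iid)
qed simp

lemma expectation_iid_sum_list_square: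
  fixes h :: "'a \<Rightarrow> real"
  assumes mean_0: "measure_pmf.expectation P h = 0"
  shows "measure_pmf.expectation (iid n P) (\<lambda>t. (\<Sum>a\<leftarrow>t. h a)\<^sup>2) =
    n * measure_pmf.expectation P (\<lambda>a. (h a)\<^sup>2)"
proof (induction n)
  case (Suc n)
  have "measure_pmf.expectation (iid (Suc n) P) (\<lambda>t. (\<Sum>a\<leftarrow>t. h a)\<^sup>2) =
    measure_pmf.expectation P (\<lambda>a. measure_pmf.expectation (iid n P)
      (\<lambda>t. (h a)\<^sup>2 + (\<Sum>a\<leftarrow>t. h a)\<^sup>2 + 2 * h a * (\<Sum>a\<leftarrow>t. h a)))"
    unfolding expectation_iid_Suc by (simp add: power2_sum)
  also have "\<dots> = measure_pmf.expectation P
      (\<lambda>a. (h a)\<^sup>2 + n * measure_pmf.expectation P (\<lambda>a. (h a)\<^sup>2))"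
    using fin Suc mean_0
    by (simp add: integrable_measure_pmf_finite finite_set_pmf_iid expectation_iid_sum_list)
  also have "\<dots> = Suc n * measure_pmf.expectation P (\<lambda>a. (h a)\<^sup>2)"
    using fin by (simp add: algebra_simps integrable_measure_pmf_finite)
  finally show ?case .
qed simp

context
  fixes \<rho> :: "'a \<Rightarrow> real" and \<mu> :: real
  assumes pos: "\<And>a. a \<in> set_pmf P \<Longrightarrow> \<rho> a > 0"
  defines "\<mu> \<equiv> measure_pmf.expectation P (\<lambda>a. log 2 (\<rho> a))"
begin

lemma expectation_iid_min_one_prod_list_le:
  assumes c_nonneg: "c \<ge> 0" and \<epsilon>_pos: "\<epsilon> > 0" and n_pos: "n > 0"
  shows "measure_pmf.expectation (iid n P) (\<lambda>t. min 1 (c * prod_list (map \<rho> t))) \<le>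
    measure_pmf.expectation P (\<lambda>a. (log 2 (\<rho> a) - \<mu>)\<^sup>2) / (n * \<epsilon>\<^sup>2) + c * 2 powr (n * (\<mu> + \<epsilon>))"
proof -
  let ?dev = "\<lambda>t. \<Sum>a\<leftarrow>t. log 2 (\<rho> a) - \<mu>"
  have "min 1 (c * prod_list (map \<rho> t)) \<le> (?dev t)\<^sup>2 / (n * \<epsilon>)\<^sup>2 + c * 2 powr (n * (\<mu> + \<epsilon>))"
    if t_mem: "t \<in> set_pmf (iid n P)" for t
  proof (cases "?dev t \<ge> n * \<epsilon>")
    case True
    then have "(n * \<epsilon>)\<^sup>2 \<le> (?dev t)\<^sup>2" using \<epsilon>_pos n_pos by (intro power_mono) auto
    then have "1 \<le> (?dev t)\<^sup>2 / (n * \<epsilon>)\<^sup>2" using \<epsilon>_pos n_pos by (simp add: le_divide_eq)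
    then show ?thesis using c_nonneg by (simp add: add_increasing2 min.coboundedI1)
  next
    case False
    have "?dev t = (\<Sum>a\<leftarrow>t. log 2 (\<rho> a)) - n * \<mu>"
      using t_mem by (simp add: sum_list_subtractf sum_list_triv set_pmf_iid)
    then have "prod_list (map \<rho> t) \<le> 2 powr (n * (\<mu> + \<epsilon>))"
      using False t_mem pos
      by (subst prod_list_eq_powr_sum_list_log) (auto simp: set_pmf_iid algebra_simps)
    then show ?thesis
      using c_nonneg by (intro min.coboundedI2 add_increasing mult_left_mono) auto
  qed
  then have "measure_pmf.expectation (iid n P) (\<lambda>t. min 1 (c * prod_list (map \<rho> t))) \<le>
    measure_pmf.expectation (iid n P) (\<lambda>t. (?dev t)\<^sup>2 / (n * \<epsilon>)\<^sup>2 + c * 2 powr (n * (\<mu> + \<epsilon>)))"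
    by (intro expectation_mono_finite finite_set_pmf_iid fin)
  also have "\<dots> = measure_pmf.expectation (iid n P) (\<lambda>t. (?dev t)\<^sup>2) / (n * \<epsilon>)\<^sup>2 +
      c * 2 powr (n * (\<mu> + \<epsilon>))"
    using fin by (simp add: integrable_measure_pmf_finite finite_set_pmf_iid)
  also have "measure_pmf.expectation (iid n P) (\<lambda>t. (?dev t)\<^sup>2) =
      n * measure_pmf.expectation P (\<lambda>a. (log 2 (\<rho> a) - \<mu>)\<^sup>2)"
    using fin by (intro expectation_iid_sum_list_square)
      (simp add: \<mu>_def integrable_measure_pmf_finite)
  finally show ?thesis using n_pos by (simp add: power_mult_distrib power2_eq_square[of "real n"])
qed

lemma expectation_iid_min_one_prod_list_tendsto_0:
  assumes mean_less: "\<mu> < r" and c_bounds: "\<And>n. 0 \<le> c n" "\<And>n. c n \<le> K * 2 powr (- real n * r)"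
  shows "(\<lambda>n. measure_pmf.expectation (iid n P) (\<lambda>t. min 1 (c n * prod_list (map \<rho> t)))) \<longlonglongrightarrow> 0"
proof -
  define \<epsilon> where "\<epsilon> = (r - \<mu>) / 2"
  have \<epsilon>_pos: "\<epsilon> > 0" and r_eq: "r = \<mu> + \<epsilon> + \<epsilon>" using mean_less by (simp_all add: \<epsilon>_def field_simps)
  define v where "v = measure_pmf.expectation P (\<lambda>a. (log 2 (\<rho> a) - \<mu>)\<^sup>2)"
  have upper: "measure_pmf.expectation (iid n P) (\<lambda>t. min 1 (c n * prod_list (map \<rho> t))) \<le>
    v / (n * \<epsilon>\<^sup>2) + K * 2 powr (- real n * \<epsilon>)" if "n > 0" for n
  proof -
    have "c n * 2 powr (n * (\<mu> + \<epsilon>)) \<le> K * 2 powr (- real n * r) * 2 powr (n * (\<mu> + \<epsilon>))"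
      using c_bounds(2) by (intro mult_right_mono) auto
    also have "\<dots> = K * 2 powr (- real n * \<epsilon>)"
      by (simp add: r_eq algebra_simps flip: powr_add)
    finally show ?thesis
      using expectation_iid_min_one_prod_list_le[OF c_bounds(1) \<epsilon>_pos that, of n]
      by (simp add: v_def)
  qed
  have "(\<lambda>n. v / (real n * \<epsilon>\<^sup>2) + K * 2 powr (- real n * \<epsilon>)) \<longlonglongrightarrow> 0"
    using \<epsilon>_pos by real_asymp
  moreover have "0 \<le> measure_pmf.expectation (iid n P) (\<lambda>t. min 1 (c n * prod_list (map \<rho> t)))"
    for n
  proof -
    have "0 \<le> prod_list (map \<rho> t)" if "t \<in> set_pmf (iid n P)" for t
      using that pos by (intro prod_list_nonneg) (auto simp: set_pmf_iid less_imp_le)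
    then show ?thesis using c_bounds(1) by (intro integral_nonneg_AE AE_pmfI) simp
  qed
  ultimately show ?thesis
    by (intro tendsto_sandwich[OF always_eventually eventually_mono[OF eventually_gt_at_top upper]
        tendsto_const]) auto
qed

end

end

section \<open>Achievability\<close>

abbreviation X_of :: "'x \<times> 'y \<times> 'z \<times> 'u \<times> 'w \<Rightarrow> 'x" where "X_of \<equiv> (\<lambda>(x, y, z, u, w). x)"
abbreviation Y_of :: "'x \<times> 'y \<times> 'z \<times> 'u \<times> 'w \<Rightarrow> 'y" where "Y_of \<equiv> (\<lambda>(x, y, z, u, w). y)"
abbreviation Z_of :: "'x \<times> 'y \<times> 'z \<times> 'u \<times> 'w \<Rightarrow> 'z" where "Z_of \<equiv> (\<lambda>(x, y, z, u, w). z)"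
abbreviation U_of :: "'x \<times> 'y \<times> 'z \<times> 'u \<times> 'w \<Rightarrow> 'u" where "U_of \<equiv> (\<lambda>(x, y, z, u, w). u)"
abbreviation W_of :: "'x \<times> 'y \<times> 'z \<times> 'u \<times> 'w \<Rightarrow> 'w" where "W_of \<equiv> (\<lambda>(x, y, z, u, w). w)"
abbreviation UZ_of :: "'x \<times> 'y \<times> 'z \<times> 'u \<times> 'w \<Rightarrow> 'u \<times> 'z" where "UZ_of \<equiv> (\<lambda>\<omega>. (U_of \<omega>, Z_of \<omega>))"

lemmas pmf_monad = joint_pmf_def map_bind_pmf bind_assoc_pmf bind_map_pmf map_pmf_def
  bind_return_pmf case_prod_unfold

lemma joint5_eq_joint_pmf:
  "joint5 pXY pZ qU qW = map_pmf (\<lambda>(((x, y, z), u), w). (x, y, z, u, w))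
    (joint_pmf (joint_pmf (src pXY pZ) (\<lambda>s. qU (fst (snd s)))) (\<lambda>(s, u). qW (fst s) u))"
  by (simp add: joint5_def src_def pmf_monad)

lemma set_joint5: "(x, y, z, u, w) \<in> set_pmf (joint5 pXY pZ qU qW) \<longleftrightarrow>
   (x, y, z) \<in> set_pmf (src pXY pZ) \<and> u \<in> set_pmf (qU y) \<and> w \<in> set_pmf (qW x u)"
  by (simp add: joint5_eq_joint_pmf set_joint_pmf image_iff Bex_def)

lemma joint5_U_given_YZ: "map_pmf (\<lambda>\<omega>. ((Y_of \<omega>, Z_of \<omega>), U_of \<omega>)) (joint5 pXY pZ qU qW) =
  joint_pmf (map_pmf (\<lambda>\<omega>. (Y_of \<omega>, Z_of \<omega>)) (joint5 pXY pZ qU qW)) (\<lambda>(y, z). qU y)"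
  by (simp add: joint5_def pmf_monad)

lemma joint5_W_given_XUZ: "map_pmf (\<lambda>\<omega>. ((X_of \<omega>, UZ_of \<omega>), W_of \<omega>)) (joint5 pXY pZ qU qW) =
  joint_pmf (map_pmf (\<lambda>\<omega>. (X_of \<omega>, UZ_of \<omega>)) (joint5 pXY pZ qU qW)) (\<lambda>(x, u, z). qW x u)"
  by (simp add: joint5_def pmf_monad)

lemma joint5_Z_given_UX: "map_pmf (\<lambda>\<omega>. ((U_of \<omega>, X_of \<omega>), Z_of \<omega>)) (joint5 pXY pZ qU qW) =
  joint_pmf (map_pmf (\<lambda>\<omega>. (U_of \<omega>, X_of \<omega>)) (joint5 pXY pZ qU qW)) (\<lambda>(u, x). pZ x)"
  by (simp add: joint5_def pmf_monad) (intro bind_pmf_cong refl, rule bind_commute_pmf)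

lemma joint5_Z_given_X: "map_pmf (\<lambda>\<omega>. (X_of \<omega>, Z_of \<omega>)) (joint5 pXY pZ qU qW) =
  joint_pmf (map_pmf X_of (joint5 pXY pZ qU qW)) pZ"
  by (simp add: joint5_def pmf_monad)

lemma iid_joint5:
  fixes pXY :: "('x \<times> 'y) pmf" and pZ :: "'x \<Rightarrow> 'z pmf"
  shows "joint_pmf (joint_pmf (iid n (src pXY pZ)) (\<lambda>t. product_kernel qU (map (fst \<circ> snd) t)))
      (\<lambda>(t, us). product_kernel (\<lambda>(x, u). qW x u) (zip (map fst t) us)) =
    map_pmf (\<lambda>t. ((map (\<lambda>\<omega>. (X_of \<omega>, Y_of \<omega>, Z_of \<omega>)) t, map U_of t), map W_of t))
      (iid n (joint5 pXY pZ qU qW))"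
proof -
  let ?S = "src pXY pZ" and ?unzip = "\<lambda>t. (map fst t, map snd t)"
  let ?kW = "\<lambda>(s, u). qW (fst s) u"
  define SU where "SU = joint_pmf ?S (\<lambda>s. qU (fst (snd s)))"
  have "joint_pmf (iid n ?S) (\<lambda>t. product_kernel qU (map (fst \<circ> snd) t)) =
      map_pmf ?unzip (iid n SU)"
    unfolding SU_def iid_joint_pmf by (simp add: product_kernel_map)
  moreover have "product_kernel (\<lambda>(x, u). qW x u) (zip (map fst t) us) =
      product_kernel ?kW (zip t us)"
    for t :: "('x \<times> 'y \<times> 'z) list" and us
    unfolding zip_map1 product_kernel_map by (simp add: case_prod_unfold)
  ultimately have "joint_pmf (joint_pmf (iid n ?S) (\<lambda>t. product_kernel qU (map (fst \<circ> snd) t)))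
      (\<lambda>(t, us). product_kernel (\<lambda>(x, u). qW x u) (zip (map fst t) us)) =
    joint_pmf (map_pmf ?unzip (iid n SU)) (\<lambda>(t, us). product_kernel ?kW (zip t us))"
    by (simp only:)
  also have "\<dots> = map_pmf (\<lambda>(t, ws). (?unzip t, ws)) (joint_pmf (iid n SU) (product_kernel ?kW))"
    by (simp add: joint_pmf_map zip_map_fst_snd)
  also have "\<dots> = map_pmf (\<lambda>t. (?unzip (map fst t), map snd t)) (iid n (joint_pmf SU ?kW))"
    by (simp add: map_pmf_comp flip: iid_joint_pmf)
  also have "\<dots> = map_pmf (\<lambda>t. ((map (\<lambda>\<omega>. (X_of \<omega>, Y_of \<omega>, Z_of \<omega>)) t, map U_of t), map W_of t))
      (iid n (joint5 pXY pZ qU qW))"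
    unfolding joint5_eq_joint_pmf iid_map_pmf map_pmf_comp SU_def[symmetric]
    by (simp add: case_prod_unfold comp_def)
  finally show ?thesis .
qed

lemma expectation_log_divide:
  fixes f g :: "'o \<Rightarrow> real"
  assumes "finite (set_pmf J)" "\<And>\<omega>. \<omega> \<in> set_pmf J \<Longrightarrow> f \<omega> > 0" "\<And>\<omega>. \<omega> \<in> set_pmf J \<Longrightarrow> g \<omega> > 0"
  shows "measure_pmf.expectation J (\<lambda>\<omega>. log 2 (f \<omega> / g \<omega>)) =
    measure_pmf.expectation J (\<lambda>\<omega>. log 2 (f \<omega>)) - measure_pmf.expectation J (\<lambda>\<omega>. log 2 (g \<omega>))"
proof -
  have "measure_pmf.expectation J (\<lambda>\<omega>. log 2 (f \<omega> / g \<omega>)) =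
    measure_pmf.expectation J (\<lambda>\<omega>. log 2 (f \<omega>) - log 2 (g \<omega>))"
  proof (rule expectation_cong_pmf)
    fix \<omega> assume "\<omega> \<in> set_pmf J"
    from assms(2,3)[OF this] show "log 2 (f \<omega> / g \<omega>) = log 2 (f \<omega>) - log 2 (g \<omega>)"
      by (simp add: log_divide)
  qed
  then show ?thesis using assms(1) by (simp add: integrable_measure_pmf_finite)
qed

lemma product_kernel_likelihood_ratio:
  "pmf (product_kernel K (map f t)) (map g t) / (N * pmf (product_kernel L (map h t)) (map g t)) =
    1 / N * prod_list (map (\<lambda>\<omega>. pmf (K (f \<omega>)) (g \<omega>) / pmf (L (h \<omega>)) (g \<omega>)) t)"
  by (simp add: pmf_product_kernel_map flip: prod_list_divide)

lemma is_code_mono: "is_code pXY pZ d n M Me Md D \<Longrightarrow> D \<le> D' \<Longrightarrow> is_code pXY pZ d n M Me Md D'"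
  unfolding is_code_def by (elim exE conjE, intro exI conjI) (assumption+, rule order.trans)

lemma inverse_nat_floor_le:
  fixes x :: real
  assumes "x \<ge> 1"
  shows "nat \<lfloor>x\<rfloor> > 0" "1 / real (nat \<lfloor>x\<rfloor>) \<le> 2 / x"
proof -
  have floor_bounds: "1 \<le> \<lfloor>x\<rfloor>" "x < of_int \<lfloor>x\<rfloor> + 1" using assms by auto
  then show "nat \<lfloor>x\<rfloor> > 0" by simp
  have "x \<le> 2 * of_int \<lfloor>x\<rfloor>" using floor_bounds by linarith
  then show "1 / real (nat \<lfloor>x\<rfloor>) \<le> 2 / x" using assms floor_bounds(1) by (simp add: field_simps)
qed

locale test_channel =
  fixes pXY :: "('x::finite \<times> 'y::finite) pmf" and pZ :: "'x \<Rightarrow> 'z::finite pmf"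
    and qU :: "'y \<Rightarrow> nat pmf" and qW :: "'x \<Rightarrow> nat \<Rightarrow> nat pmf"
    and d :: "'x \<Rightarrow> 'xh::finite \<Rightarrow> real" and xhat :: "nat \<Rightarrow> nat \<Rightarrow> 'z \<Rightarrow> 'xh"
  assumes finite_qU: "finite (\<Union>y. set_pmf (qU y))" and finite_qW: "finite (\<Union>x u. set_pmf (qW x u))"
    and d_nonneg: "d a b \<ge> 0"
begin

abbreviation J :: "('x \<times> 'y \<times> 'z \<times> nat \<times> nat) pmf" where
  "J \<equiv> joint5 pXY pZ qU qW"

abbreviation letter_cost :: "'x \<times> 'y \<times> 'z \<times> nat \<times> nat \<Rightarrow> real" where
  "letter_cost \<equiv> \<lambda>\<omega>. d (X_of \<omega>) (xhat (U_of \<omega>) (W_of \<omega>) (Z_of \<omega>))"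

abbreviation U_given_X :: "'x \<Rightarrow> nat pmf" where
  "U_given_X \<equiv> cond_law J U_of X_of"

abbreviation U_given_Z :: "'z \<Rightarrow> nat pmf" where
  "U_given_Z \<equiv> cond_law J U_of Z_of"

abbreviation W_given_UZ :: "nat \<times> 'z \<Rightarrow> nat pmf" where
  "W_given_UZ \<equiv> cond_law J W_of UZ_of"

definition ratio_UX :: "'x \<times> 'y \<times> 'z \<times> nat \<times> nat \<Rightarrow> real" where
  "ratio_UX \<omega> = pmf (qU (Y_of \<omega>)) (U_of \<omega>) / pmf (U_given_X (X_of \<omega>)) (U_of \<omega>)"

definition ratio_UZ :: "'x \<times> 'y \<times> 'z \<times> nat \<times> nat \<Rightarrow> real" where
  "ratio_UZ \<omega> = pmf (qU (Y_of \<omega>)) (U_of \<omega>) / pmf (U_given_Z (Z_of \<omega>)) (U_of \<omega>)"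

definition ratio_W :: "'x \<times> 'y \<times> 'z \<times> nat \<times> nat \<Rightarrow> real" where
  "ratio_W \<omega> = pmf (qW (X_of \<omega>) (U_of \<omega>)) (W_of \<omega>) / pmf (W_given_UZ (UZ_of \<omega>)) (W_of \<omega>)"

lemma finite_J: "finite (set_pmf J)"
proof (rule finite_subset)
  show "set_pmf J \<subseteq> UNIV \<times> UNIV \<times> UNIV \<times> (\<Union>y. set_pmf (qU y)) \<times> (\<Union>x u. set_pmf (qW x u))"
    by (clarsimp simp: set_joint5) blast
qed (use finite_qU finite_qW in auto)

lemma cond_laws_pos:
  assumes "\<omega> \<in> set_pmf J"
  shows "pmf (qU (Y_of \<omega>)) (U_of \<omega>) > 0" "pmf (U_given_X (X_of \<omega>)) (U_of \<omega>) > 0"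
    "pmf (U_given_Z (Z_of \<omega>)) (U_of \<omega>) > 0" "pmf (qW (X_of \<omega>) (U_of \<omega>)) (W_of \<omega>) > 0"
    "pmf (W_given_UZ (UZ_of \<omega>)) (W_of \<omega>) > 0"
  using assms mem_set_cond_law[OF assms, of U_of X_of] mem_set_cond_law[OF assms, of U_of Z_of]
    mem_set_cond_law[OF assms, of W_of UZ_of]
  by (auto intro!: pmf_positive simp: set_joint5 split: prod.splits)

lemma expectation_log_qU: "measure_pmf.expectation J (\<lambda>\<omega>. log 2 (pmf (qU (Y_of \<omega>)) (U_of \<omega>))) =
    - cent J U_of (\<lambda>\<omega>. (Y_of \<omega>, Z_of \<omega>))"
  by (simp add: cent_eq_expectation_log[OF finite_J joint5_U_given_YZ])

lemma expectation_log_qW: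
  "measure_pmf.expectation J (\<lambda>\<omega>. log 2 (pmf (qW (X_of \<omega>) (U_of \<omega>)) (W_of \<omega>))) =
    - cent J W_of (\<lambda>\<omega>. (X_of \<omega>, UZ_of \<omega>))"
  by (simp add: cent_eq_expectation_log[OF finite_J joint5_W_given_XUZ])

lemma expectation_log_cond_law:
  "measure_pmf.expectation J (\<lambda>\<omega>. log 2 (pmf (cond_law J g f (f \<omega>)) (g \<omega>))) = - cent J g f"
  by (simp add: cent_eq_expectation_log[OF finite_J joint_pmf_cond_law[symmetric]])

lemma cent_U_X_le: "cent J U_of X_of \<le> cent J U_of Z_of"
proof -
  have "cmi J U_of Z_of X_of = cmi J Z_of U_of X_of" by (rule cmi_commute[OF finite_J])
  also have "\<dots> = 0"
    by (simp add: cmi_eq_cent cent_eq_expectation_ent[OF finite_J joint5_Z_given_X]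
        cent_eq_expectation_ent[OF finite_J joint5_Z_given_UX])
  finally have "cent J U_of X_of = cent J U_of (\<lambda>\<omega>. (Z_of \<omega>, X_of \<omega>))" by (simp add: cmi_eq_cent)
  also have "\<dots> \<le> cent J U_of Z_of" by (rule cent_antimono[OF finite_J]) simp
  finally show ?thesis .
qed

lemma expectation_log_ratio_UZ:
  "measure_pmf.expectation J (\<lambda>\<omega>. log 2 (ratio_UZ \<omega>)) = cmi J U_of Y_of Z_of"
  unfolding ratio_UZ_def
  by (subst expectation_log_divide)
    (simp_all add: finite_J cond_laws_pos expectation_log_qU expectation_log_cond_law[of U_of Z_of]
      cmi_eq_cent)

lemma expectation_log_ratio_UX:
  "measure_pmf.expectation J (\<lambda>\<omega>. log 2 (ratio_UX \<omega>)) \<le> cmi J U_of Y_of Z_of"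
  unfolding ratio_UX_def using cent_U_X_le
  by (subst expectation_log_divide)
    (simp_all add: finite_J cond_laws_pos expectation_log_qU expectation_log_cond_law[of U_of X_of]
      cmi_eq_cent)

lemma expectation_log_ratio_W:
  "measure_pmf.expectation J (\<lambda>\<omega>. log 2 (ratio_W \<omega>)) = cmi J X_of W_of UZ_of"
  unfolding ratio_W_def cmi_commute[OF finite_J, of X_of W_of]
  by (subst expectation_log_divide)
    (simp_all add: finite_J cond_laws_pos expectation_log_qW expectation_log_cond_law[of W_of UZ_of]
      cmi_eq_cent)

lemma ratio_pos:
  assumes "\<omega> \<in> set_pmf J"
  shows "ratio_UX \<omega> > 0" "ratio_UZ \<omega> > 0" "ratio_W \<omega> > 0"
  using cond_laws_pos[OF assms] by (simp_all add: ratio_UX_def ratio_UZ_def ratio_W_def)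

lemma set_qU_subset:
  assumes "s \<in> set_pmf (src pXY pZ)"
  shows "set_pmf (qU (fst (snd s))) \<subseteq> set_pmf (U_given_X (fst s))"
    and "set_pmf (qU (fst (snd s))) \<subseteq> set_pmf (U_given_Z (snd (snd s)))"
proof -
  obtain x y z where s_eq: "s = (x, y, z)" by (rule prod_cases3)
  have "u \<in> set_pmf (U_given_X x) \<and> u \<in> set_pmf (U_given_Z z)" if u_mem: "u \<in> set_pmf (qU y)" for u
  proof -
    obtain w where "w \<in> set_pmf (qW x u)" using set_pmf_not_empty by fast
    with u_mem assms have "(x, y, z, u, w) \<in> set_pmf J" by (simp add: s_eq set_joint5)
    from mem_set_cond_law[OF this, of U_of X_of] mem_set_cond_law[OF this, of U_of Z_of]
    show ?thesis by simp
  qed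
  then show "set_pmf (qU (fst (snd s))) \<subseteq> set_pmf (U_given_X (fst s))"
    "set_pmf (qU (fst (snd s))) \<subseteq> set_pmf (U_given_Z (snd (snd s)))"
    by (auto simp: s_eq)
qed

lemma set_qW_subset:
  assumes "s \<in> set_pmf (src pXY pZ)" "u \<in> set_pmf (qU (fst (snd s)))"
  shows "set_pmf (qW (fst s) u) \<subseteq> set_pmf (W_given_UZ (u, snd (snd s)))"
proof
  obtain x y z where s_eq: "s = (x, y, z)" by (rule prod_cases3)
  fix w assume "w \<in> set_pmf (qW (fst s) u)"
  with assms have "(x, y, z, u, w) \<in> set_pmf J" by (simp add: s_eq set_joint5)
  from mem_set_cond_law[OF this, of W_of UZ_of] show "w \<in> set_pmf (W_given_UZ (u, snd (snd s)))"
    by (simp add: s_eq)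
qed

definition dmax :: "real" where
  "dmax = (MAX (a, b)\<in>UNIV. d a b)"

lemma d_le_dmax: "d a b \<le> dmax"
  unfolding dmax_def by (rule Max_ge) (auto intro: image_eqI[of _ _ "(a, b)"])

definition block_cost :: "nat \<Rightarrow> ('x \<times> 'y \<times> 'z) list \<Rightarrow> nat list \<Rightarrow> nat list \<Rightarrow> real" where
  "block_cost n t us ws = (1 / n) *
    (\<Sum>i<n. d (map fst t ! i) (xhat (us ! i) (ws ! i) (map (snd \<circ> snd) t ! i)))"

lemma block_cost_nonneg: "0 \<le> block_cost n t us ws"
  by (simp add: block_cost_def sum_nonneg d_nonneg)

lemma block_cost_le: "n > 0 \<Longrightarrow> block_cost n t us ws \<le> dmax"
  using sum_bounded_above[of "{..<n}"
    "\<lambda>i. d (map fst t ! i) (xhat (us ! i) (ws ! i) (map (snd \<circ> snd) t ! i))" dmax]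
  by (simp add: block_cost_def d_le_dmax field_simps)

lemma one_shot_problem_block:
  assumes "n > 0" "M > 0" "Md > 0"
  shows "one_shot_problem (iid n (src pXY pZ)) (map fst) (map (fst \<circ> snd)) (map (snd \<circ> snd))
    (product_kernel qU) (product_kernel U_given_X) (product_kernel U_given_Z)
    (\<lambda>xs us. product_kernel (\<lambda>(x, u). qW x u) (zip xs us))
    (\<lambda>us zs. product_kernel (\<lambda>(z, u). W_given_UZ (u, z)) (zip zs us))
    (block_cost n) dmax M Md"
proof
  show "finite (set_pmf (iid n (src pXY pZ)))"
    by (intro finite_set_pmf_iid) simp
  show "finite (set_pmf (product_kernel U_given_X xs))"
    "finite (set_pmf (product_kernel U_given_Z zs))"
    "finite (set_pmf (product_kernel (\<lambda>(z, u). W_given_UZ (u, z)) (zip zs us)))" for xs zs us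
    by (intro finite_set_pmf_product_kernel;
        simp add: finite_set_cond_law finite_J case_prod_unfold)+
next
  fix t assume "t \<in> set_pmf (iid n (src pXY pZ))"
  then have letter_mem: "s \<in> set t \<Longrightarrow> s \<in> set_pmf (src pXY pZ)" for s
    by (auto simp: set_pmf_iid)
  show "set_pmf (product_kernel qU (map (fst \<circ> snd) t)) \<subseteq>
      set_pmf (product_kernel U_given_X (map fst t))"
    "set_pmf (product_kernel qU (map (fst \<circ> snd) t)) \<subseteq>
      set_pmf (product_kernel U_given_Z (map (snd \<circ> snd) t))"
    unfolding product_kernel_map comp_def
    by (intro set_pmf_product_kernel_mono set_qU_subset letter_mem; assumption)+
  fix us assume "us \<in> set_pmf (product_kernel qU (map (fst \<circ> snd) t))"
  then have "s \<in> set t \<and> u \<in> set_pmf (qU (fst (snd s)))" if "(s, u) \<in> set (zip t us)" for s u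
    using that by (auto simp: set_pmf_product_kernel list_all2_conv_all_nth in_set_zip)
  then show "set_pmf (product_kernel (\<lambda>(x, u). qW x u) (zip (map fst t) us)) \<subseteq>
      set_pmf (product_kernel (\<lambda>(z, u). W_given_UZ (u, z)) (zip (map (snd \<circ> snd) t) us))"
    unfolding zip_map1 product_kernel_map
    by (intro set_pmf_product_kernel_mono)
      (auto dest!: letter_mem intro!: subsetD[OF set_qW_subset])
qed (use assms block_cost_nonneg block_cost_le in auto)

definition block_bound :: "nat \<Rightarrow> nat \<Rightarrow> nat \<Rightarrow> real" where
  "block_bound n M Md = measure_pmf.expectation J letter_cost +
    dmax * (measure_pmf.expectation (iid n J) (\<lambda>t. min 1 (1 / M * prod_list (map ratio_W t))) +
      (measure_pmf.expectation (iid n J) (\<lambda>t. min 1 (1 / Md * prod_list (map ratio_UX t))) +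
       measure_pmf.expectation (iid n J) (\<lambda>t. min 1 (1 / Md * prod_list (map ratio_UZ t)))))"

context
  fixes n M Md :: nat
  assumes n_pos: "n > 0" and M_pos: "M > 0" and Md_pos: "Md > 0"
begin

interpretation block: one_shot_problem "iid n (src pXY pZ)" "map fst" "map (fst \<circ> snd)"
  "map (snd \<circ> snd)"
  "product_kernel qU" "product_kernel U_given_X" "product_kernel U_given_Z"
  "\<lambda>xs us. product_kernel (\<lambda>(x, u). qW x u) (zip xs us)"
  "\<lambda>us zs. product_kernel (\<lambda>(z, u). W_given_UZ (u, z)) (zip zs us)"
  "block_cost n" dmax M Md
  using n_pos M_pos Md_pos by (rule one_shot_problem_block)

lemma block_encoder_error:
  "block.encoder_error (map (\<lambda>\<omega>. (X_of \<omega>, Y_of \<omega>, Z_of \<omega>)) t) (map U_of t) (map W_of t) =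
    min 1 (1 / M * prod_list (map ratio_W t))"
  unfolding block.encoder_error_def map_map zip_map_map zip_same_conv_map
    product_kernel_likelihood_ratio
  by (simp add: ratio_W_def[abs_def] comp_def)

lemma block_helper_error:
  "block.helper_error (map (\<lambda>\<omega>. (X_of \<omega>, Y_of \<omega>, Z_of \<omega>)) t) (map U_of t) =
    min 1 (1 / Md * prod_list (map ratio_UX t)) + min 1 (1 / Md * prod_list (map ratio_UZ t))"
  unfolding block.helper_error_def map_map product_kernel_likelihood_ratio
  by (simp add: ratio_UX_def[abs_def] ratio_UZ_def[abs_def] comp_def)

lemma block_cost_map:
  assumes "length t = n"
  shows "block_cost n (map (\<lambda>\<omega>. (X_of \<omega>, Y_of \<omega>, Z_of \<omega>)) t) (map U_of t) (map W_of t) =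
    (1 / n) * (\<Sum>\<omega>\<leftarrow>t. letter_cost \<omega>)"
  using assms by (simp add: block_cost_def sum_list_sum_nth atLeast0LessThan)

lemma expected_block_cost:
  "measure_pmf.expectation
      (joint_pmf (joint_pmf (iid n (src pXY pZ)) (\<lambda>t. product_kernel qU (map (fst \<circ> snd) t)))
        (\<lambda>(t, us). product_kernel (\<lambda>(x, u). qW x u) (zip (map fst t) us)))
      (\<lambda>((t, us), ws). block_cost n t us ws +
        dmax * (block.encoder_error t us ws + block.helper_error t us)) = block_bound n M Md"
    (is "?lhs = _")
proof -
  have "?lhs = measure_pmf.expectation (iid n J) (\<lambda>t.
      (1 / n) * (\<Sum>\<omega>\<leftarrow>t. letter_cost \<omega>) +
      dmax * (min 1 (1 / M * prod_list (map ratio_W t)) +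
        (min 1 (1 / Md * prod_list (map ratio_UX t)) +
          min 1 (1 / Md * prod_list (map ratio_UZ t)))))"
    unfolding iid_joint5 integral_map_pmf prod.case block_encoder_error block_helper_error
    by (rule expectation_cong_pmf) (simp only: set_pmf_iid mem_Collect_eq block_cost_map)
  also have "\<dots> = block_bound n M Md"
    using n_pos by (simp add: block_bound_def integrable_measure_pmf_finite finite_set_pmf_iid
        finite_J expectation_iid_sum_list)
  finally show ?thesis .
qed

lemma is_code_block_bound: "is_code pXY pZ d n M Md Md (block_bound n M Md)"
proof -
  obtain fd f g where range: "\<And>y. fd y \<in> {1..Md}" "\<And>x m. f x m \<in> {1..M}"
    and cost_le: "measure_pmf.expectation (iid n (src pXY pZ)) (\<lambda>t. case g (f (map fst t)
        (fd (map (fst \<circ> snd) t))) (fd (map (fst \<circ> snd) t)) (map (snd \<circ> snd) t) of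
          (us, ws) \<Rightarrow> block_cost n t us ws) \<le> block_bound n M Md"
    by (rule block.one_shot_coding[unfolded expected_block_cost]) blast
  define g' where "g' a b zs =
      (case g a b zs of (us, ws) \<Rightarrow> map (\<lambda>i. xhat (us ! i) (ws ! i) (zs ! i)) [0..<n])"
    for a b zs
  have length_g': "length (g' a b zs) = n" for a b zs
    by (simp add: g'_def case_prod_unfold)
  have distortion_le: "measure_pmf.expectation (iid n (src pXY pZ))
        (\<lambda>t. let xs = map fst t; ys = map (fst \<circ> snd) t; zs = map (snd \<circ> snd) t;
                 xh = g' (f xs (fd ys)) (fd ys) zs
             in (1 / real n) * (\<Sum>i<n. d (xs ! i) (xh ! i))) \<le> block_bound n M Md"
    using cost_le by (simp add: Let_def g'_def block_cost_def case_prod_unfold)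
  show ?thesis
    unfolding is_code_def
    by (rule exI[of _ fd], rule exI[of _ fd], rule exI[of _ f], rule exI[of _ g'])
      (intro conjI allI impI range length_g' distortion_le)
qed

end

lemma inverse_nat_floor_powr_le:
  assumes "0 \<le> r"
  shows "nat \<lfloor>2 powr (real n * r)\<rfloor> > 0"
    and "1 / real (nat \<lfloor>2 powr (real n * r)\<rfloor>) \<le> 2 * 2 powr (- real n * r)"
proof -
  have "2 powr (real n * r) \<ge> 1" using assms by (intro ge_one_powr_ge_zero) auto
  from inverse_nat_floor_le[OF this] show "nat \<lfloor>2 powr (real n * r)\<rfloor> > 0"
    "1 / real (nat \<lfloor>2 powr (real n * r)\<rfloor>) \<le> 2 * 2 powr (- real n * r)"
    by (simp_all add: powr_minus divide_inverse)
qed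

lemma block_bound_tendsto:
  assumes cmi_W_less: "cmi J X_of W_of UZ_of < r" and cmi_U_less: "cmi J U_of Y_of Z_of < rd"
  shows "(\<lambda>n. block_bound n (nat \<lfloor>2 powr (real n * r)\<rfloor>) (nat \<lfloor>2 powr (real n * rd)\<rfloor>)) \<longlonglongrightarrow>
    measure_pmf.expectation J letter_cost"
proof -
  have "0 \<le> r" "0 \<le> rd"
    using cmi_nonneg[OF finite_J] cmi_W_less cmi_U_less by (meson less_imp_le order.trans)+
  then have tendsto_0: "(\<lambda>n. measure_pmf.expectation (iid n J)
      (\<lambda>t. min 1 (1 / nat \<lfloor>2 powr (real n * s)\<rfloor> * prod_list (map \<rho> t)))) \<longlonglongrightarrow> 0"
    if "s \<in> {r, rd}" "\<And>\<omega>. \<omega> \<in> set_pmf J \<Longrightarrow> \<rho> \<omega> > 0"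
      "measure_pmf.expectation J (\<lambda>\<omega>. log 2 (\<rho> \<omega>)) < s" for s \<rho>
    using that inverse_nat_floor_powr_le(2)
    by (intro expectation_iid_min_one_prod_list_tendsto_0[OF finite_J, where K = 2]) auto
  have "(\<lambda>n. block_bound n (nat \<lfloor>2 powr (real n * r)\<rfloor>) (nat \<lfloor>2 powr (real n * rd)\<rfloor>)) \<longlonglongrightarrow>
    measure_pmf.expectation J letter_cost + dmax * (0 + (0 + 0))"
    unfolding block_bound_def
    using cmi_W_less cmi_U_less expectation_log_ratio_UX ratio_pos
    by (intro tendsto_intros tendsto_0)
      (auto simp: expectation_log_ratio_UZ expectation_log_ratio_W)
  then show ?thesis by simp
qed

lemma achievable_test_channel:
  assumes helper_rates: "R_e \<ge> R_d" and R_d_ge: "R_d \<ge> cmi J U_of Y_of Z_of"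
    and R_ge: "R \<ge> cmi J X_of W_of UZ_of"
    and D_ge: "D \<ge> measure_pmf.expectation J letter_cost"
  shows "achievable pXY pZ d D R R_e R_d"
  unfolding achievable_def
proof (intro allI impI)
  fix \<delta> :: real assume \<delta>_pos: "\<delta> > 0"
  define count where "count r n = nat \<lfloor>2 powr (real n * (r + \<delta>))\<rfloor>" for r and n :: nat
  have count_le: "real (count r n) \<le> 2 powr (real n * (r + \<delta>))" for r n
    by (simp add: count_def)
  have rates_nonneg: "0 \<le> R" "0 \<le> R_d"
    using cmi_nonneg[OF finite_J] R_ge R_d_ge order.trans by blast+
  have "(\<lambda>n. block_bound n (count R n) (count R_d n)) \<longlonglongrightarrow>
      measure_pmf.expectation J letter_cost"
    unfolding count_def using R_ge R_d_ge \<delta>_pos by (intro block_bound_tendsto) auto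
  then have "\<forall>\<^sub>F n in sequentially. block_bound n (count R n) (count R_d n) < D + \<delta>"
    using D_ge \<delta>_pos by (intro order_tendstoD(2)) auto
  then obtain N where bound_less: "\<And>n. n \<ge> N \<Longrightarrow> block_bound n (count R n) (count R_d n) < D + \<delta>"
    by (auto simp: eventually_sequentially)
  show "\<exists>N. \<forall>n\<ge>N. n > 0 \<and> (\<exists>M Me Md. real M \<le> 2 powr (real n * (R + \<delta>)) \<and>
      real Me \<le> 2 powr (real n * (R_e + \<delta>)) \<and> real Md \<le> 2 powr (real n * (R_d + \<delta>)) \<and>
      is_code pXY pZ d n M Me Md (D + \<delta>))"
  proof (rule exI[of _ "max N 1"], intro allI impI conjI)
    fix n assume n_ge: "n \<ge> max N 1"
    then show "n > 0" by simp
    then have "is_code pXY pZ d n (count R n) (count R_d n) (count R_d n) (D + \<delta>)"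
      using rates_nonneg \<delta>_pos bound_less n_ge unfolding count_def
      by (intro is_code_mono[OF is_code_block_bound] inverse_nat_floor_powr_le(1))
        (auto simp: less_imp_le)
    moreover have "2 powr (real n * (R_d + \<delta>)) \<le> 2 powr (real n * (R_e + \<delta>))"
      using helper_rates by (intro powr_mono mult_left_mono) auto
    ultimately show "\<exists>M Me Md. real M \<le> 2 powr (real n * (R + \<delta>)) \<and>
      real Me \<le> 2 powr (real n * (R_e + \<delta>)) \<and> real Md \<le> 2 powr (real n * (R_d + \<delta>)) \<and>
      is_code pXY pZ d n M Me Md (D + \<delta>)"
      using count_le order.trans by blast
  qed
qed

end

lemma mem_RYXZ_iff: "(R, R1) \<in> RYXZ pXY pZ d D \<longleftrightarrow> (\<exists>qU qW xhat.
    finite (\<Union>y. set_pmf (qU y)) \<and> finite (\<Union>x u. set_pmf (qW x u)) \<and>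
    cmi (joint5 pXY pZ qU qW) U_of Y_of Z_of \<le> R1 \<and>
    cmi (joint5 pXY pZ qU qW) X_of W_of UZ_of \<le> R \<and>
    measure_pmf.expectation (joint5 pXY pZ qU qW)
      (\<lambda>\<omega>. d (X_of \<omega>) (xhat (U_of \<omega>) (W_of \<omega>) (Z_of \<omega>))) \<le> D)"
  by (simp add: RYXZ_def Let_def case_prod_unfold)

lemma RYXZ_imp_achievable:
  fixes pXY :: "('x::finite \<times> 'y::finite) pmf" and pZ :: "'x \<Rightarrow> 'z::finite pmf"
    and d :: "'x \<Rightarrow> 'xh::finite \<Rightarrow> real"
  assumes "\<And>a b. d a b \<ge> 0" and "(R, R_d) \<in> RYXZ pXY pZ d D" and "R_e \<ge> R_d"
  shows "achievable pXY pZ d D R R_e R_d"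
proof -
  obtain qU qW xhat where "test_channel qU qW d"
    and "cmi (joint5 pXY pZ qU qW) U_of Y_of Z_of \<le> R_d"
      "cmi (joint5 pXY pZ qU qW) X_of W_of UZ_of \<le> R"
      "measure_pmf.expectation (joint5 pXY pZ qU qW)
        (\<lambda>\<omega>. d (X_of \<omega>) (xhat (U_of \<omega>) (W_of \<omega>) (Z_of \<omega>))) \<le> D"
    using assms(1,2) unfolding mem_RYXZ_iff test_channel_def by blast
  then show ?thesis
    using assms(3) by (intro test_channel.achievable_test_channel)
qed

section \<open>Compactness of laws on a finite alphabet\<close>

lemma tendsto_mult_log_at_right_0: "((\<lambda>t. t * log 2 t) \<longlongrightarrow> (0::real)) (at_right 0)"
  by real_asymp

lemma continuous_on_entropy_term: "continuous_on {0..} (\<lambda>t::real. t * log 2 t)"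
proof -
  have "((\<lambda>t. t * log 2 t) \<longlongrightarrow> x * log 2 x) (at x within {0..})" if x_nonneg: "x \<ge> 0" for x :: real
  proof (cases "x = 0")
    case True
    then show ?thesis
      using tendsto_mult_log_at_right_0 by (simp add: at_within_Ici_at_right)
  next
    case False
    then have "isCont (\<lambda>t. t * log 2 t) x" using x_nonneg by (intro continuous_intros) auto
    then show ?thesis unfolding isCont_def by (rule tendsto_within_subset) simp
  qed
  then show ?thesis by (auto simp: continuous_on_def)
qed

definition prob_simplex :: "(real ^ 'a::finite) set" where
  "prob_simplex = {v. (\<forall>i. 0 \<le> v $ i) \<and> (\<Sum>i\<in>UNIV. v $ i) = 1}"

definition pmf_of_vec :: "real ^ 'a::finite \<Rightarrow> 'a pmf" where
  "pmf_of_vec v = embed_pmf (($) v)"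

lemma pmf_pmf_of_vec:
  assumes "v \<in> prob_simplex"
  shows "pmf (pmf_of_vec v) i = v $ i"
proof -
  have "(\<integral>\<^sup>+ i. ennreal (v $ i) \<partial>count_space UNIV) = ennreal (\<Sum>i\<in>UNIV. v $ i)"
    using assms by (simp add: nn_integral_count_space_finite prob_simplex_def)
  then show ?thesis
    using assms unfolding pmf_of_vec_def by (intro pmf_embed_pmf) (auto simp: prob_simplex_def)
qed

lemma vec_pmf_mem_prob_simplex: "(\<chi> i. pmf p i) \<in> prob_simplex"
  by (simp add: prob_simplex_def sum_pmf_eq_1)

lemma pmf_of_vec_pmf: "pmf_of_vec (\<chi> i. pmf p i) = p"
  by (rule pmf_eqI) (simp add: pmf_pmf_of_vec vec_pmf_mem_prob_simplex)

lemma compact_prob_simplex: "compact (prob_simplex :: (real ^ 'a::finite) set)"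
proof -
  have "norm v \<le> 1" if "v \<in> prob_simplex" for v :: "real ^ 'a"
    using norm_le_l1_cart[of v] that by (auto simp: prob_simplex_def)
  then have "bounded (prob_simplex :: (real ^ 'a) set)" by (auto simp: bounded_iff)
  moreover have "closed (prob_simplex :: (real ^ 'a) set)"
    unfolding prob_simplex_def
    by (intro closed_Collect_conj closed_Collect_all closed_Collect_le closed_Collect_eq
        continuous_intros)
  ultimately show ?thesis by (simp add: compact_eq_bounded_closed)
qed

lemma continuous_on_pmf_bind_pmf_of_vec:
  "continuous_on prob_simplex (\<lambda>v. pmf (bind_pmf (pmf_of_vec v) K) b)"
proof -
  have "continuous_on prob_simplex (\<lambda>v. \<Sum>a\<in>UNIV. v $ a * pmf (K a) b)"
    by (intro continuous_intros)
  then show ?thesis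
    by (rule continuous_on_eq) (simp add: pmf_bind integral_measure_pmf[of UNIV] pmf_pmf_of_vec)
qed

lemma continuous_on_pmf_map_pmf_of_vec:
  "continuous_on prob_simplex (\<lambda>v. pmf (map_pmf f (pmf_of_vec v)) b)"
  using continuous_on_pmf_bind_pmf_of_vec[of "\<lambda>a. return_pmf (f a)" b] by (simp add: map_pmf_def)

lemma map_pmf_joint_pmf: "map_pmf f (joint_pmf p L) = bind_pmf p (\<lambda>a. map_pmf (\<lambda>b. f (a, b)) (L a))"
  by (simp add: joint_pmf_def map_bind_pmf map_pmf_comp)

lemma continuous_on_ent_joint_pmf_of_vec:
  fixes f :: "'a::finite \<times> 'b \<Rightarrow> 'c::finite"
  shows "continuous_on prob_simplex (\<lambda>v. ent (map_pmf f (joint_pmf (pmf_of_vec v) L)))"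
proof -
  have ent_eq: "ent q = - (\<Sum>c\<in>UNIV. pmf q c * log 2 (pmf q c))" for q :: "'c pmf"
    unfolding ent_def by (intro arg_cong[of _ _ uminus] sum.mono_neutral_left)
      (auto simp: set_pmf_iff)
  show ?thesis
    unfolding ent_eq map_pmf_joint_pmf
    by (intro continuous_intros continuous_on_compose2[OF continuous_on_entropy_term]
        continuous_on_pmf_bind_pmf_of_vec) auto
qed

lemma continuous_on_expectation_joint_pmf_of_vec:
  fixes h :: "'a::finite \<times> 'b::finite \<Rightarrow> real"
  shows "continuous_on prob_simplex (\<lambda>v. measure_pmf.expectation (joint_pmf (pmf_of_vec v) L) h)"
proof -
  have "continuous_on prob_simplex (\<lambda>v.
      \<Sum>a\<in>UNIV. v $ a * measure_pmf.expectation (L a) (\<lambda>b. h (a, b)))"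
    by (intro continuous_intros)
  then show ?thesis
    by (rule continuous_on_eq)
      (subst expectation_joint_pmf, simp_all add: integral_measure_pmf[of UNIV] pmf_pmf_of_vec)
qed

lemma expectation_in_convex_hull:
  fixes f :: "'u \<Rightarrow> 'v::euclidean_space"
  assumes "finite (set_pmf P)" "\<And>u. u \<in> set_pmf P \<Longrightarrow> f u \<in> S"
  shows "measure_pmf.expectation P f \<in> convex hull S"
proof -
  have "(\<Sum>u\<in>set_pmf P. pmf P u *\<^sub>R f u) \<in> convex hull S"
    using assms by (intro convex_sum convex_convex_hull hull_inc) (auto simp: sum_pmf_eq_1)
  then show ?thesis using assms(1) by (subst integral_measure_pmf[of "set_pmf P"]) auto
qed

lemma convex_hull_image_imp_expectation:
  fixes g :: "'a \<Rightarrow> 'v::euclidean_space"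
  assumes "x \<in> convex hull (g ` A)"
  obtains P :: "nat pmf" and q where "finite (set_pmf P)" "\<And>i. i \<in> set_pmf P \<Longrightarrow> q i \<in> A"
    "measure_pmf.expectation P (\<lambda>i. g (q i)) = x"
proof -
  obtain n \<mu> f where \<mu>_weights: "\<And>i. i \<in> {1..n::nat} \<Longrightarrow> 0 \<le> \<mu> i" "sum \<mu> {1..n} = 1"
    and f_mem: "\<forall>i\<in>{1..n}. f i \<in> g ` A" and x_eq: "(\<Sum>i=1..n. \<mu> i *\<^sub>R f i) = x"
    using assms unfolding convex_hull_indexed by blast
  have "\<forall>i\<in>{1..n}. \<exists>a. a \<in> A \<and> f i = g a" using f_mem by blast
  from bchoice[OF this] obtain q where q_mem: "\<forall>i\<in>{1..n}. q i \<in> A \<and> f i = g (q i)" by blast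
  define w where "w i = (if i \<in> {1..n} then \<mu> i else 0)" for i
  have "(\<integral>\<^sup>+ i. ennreal (w i) \<partial>count_space UNIV) = (\<Sum>i\<in>{1..n}. ennreal (\<mu> i))"
    by (subst nn_integral_count_space'[of "{1..n}"]) (auto simp: w_def)
  also have "\<dots> = 1" using \<mu>_weights by (subst sum_ennreal) auto
  finally have pmf_w: "pmf (embed_pmf w) i = w i" for i
    using \<mu>_weights(1) by (intro pmf_embed_pmf) (auto simp: w_def)
  then have set_w: "set_pmf (embed_pmf w) \<subseteq> {1..n}"
    by (auto simp: set_pmf_iff w_def split: if_splits)
  show thesis
  proof (rule that)
    show "finite (set_pmf (embed_pmf w))"
      using set_w by (rule finite_subset) simp
    show "measure_pmf.expectation (embed_pmf w) (\<lambda>i. g (q i)) = x"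
      using set_w q_mem by (subst integral_measure_pmf[of "{1..n}"])
        (auto simp: pmf_w w_def x_eq[symmetric])
  qed (use set_w q_mem in blast)
qed

lemma expectation_Pair:
  fixes f :: "'u \<Rightarrow> 'v::euclidean_space" and g :: "'u \<Rightarrow> 'w::euclidean_space"
  assumes "finite (set_pmf P)"
  shows "measure_pmf.expectation P (\<lambda>u. (f u, g u)) =
    (measure_pmf.expectation P f, measure_pmf.expectation P g)"
  using assms by (simp add: integral_measure_pmf[of "set_pmf P"] prod_eq_iff fst_sum snd_sum)

lemma expectation_vec:
  fixes f :: "'u \<Rightarrow> 'i::finite \<Rightarrow> real"
  assumes "finite (set_pmf P)"
  shows "measure_pmf.expectation P (\<lambda>u. \<chi> i. f u i) = (\<chi> i. measure_pmf.expectation P (\<lambda>u. f u i))"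
  using assms by (simp add: integral_measure_pmf[of "set_pmf P"] vec_eq_iff)

section \<open>The single-letter region\<close>

abbreviation cent_Y_given_Z :: "('x \<times> 'y) pmf \<Rightarrow> ('x \<Rightarrow> 'z pmf) \<Rightarrow> real" where
  "cent_Y_given_Z pXY pZ \<equiv> cent (src pXY pZ) (\<lambda>(x, y, z). y) (\<lambda>(x, y, z). z)"

text \<open>A letter law is the joint law of \<open>X\<close>, \<open>Y\<close> and \<open>W\<close> for a fixed value of \<open>U\<close>, where \<open>W\<close> maps
  a value of \<open>Z\<close> to a reconstruction. The only constraint is that \<open>X\<close> given \<open>Y\<close> is distributed as in
  the source; \<open>W\<close> may depend on \<open>Y\<close>, which the functionals below do not see.\<close>
definition letter_laws :: "('x \<times> 'y) pmf \<Rightarrow> ('x \<times> 'y \<times> 'w) pmf set" where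
  "letter_laws pXY = {q. \<forall>x y.
    pmf (map_pmf (\<lambda>(x, y, w). (x, y)) q) (x, y) * pmf (map_pmf snd pXY) y =
    pmf pXY (x, y) * pmf (map_pmf (\<lambda>(x, y, w). y) q) y}"

definition with_side_info :: "('x \<Rightarrow> 'z pmf) \<Rightarrow> ('x \<times> 'y \<times> 'w) pmf \<Rightarrow> (('x \<times> 'y \<times> 'w) \<times> 'z) pmf" where
  "with_side_info pZ q = joint_pmf q (\<lambda>(x, y, w). pZ x)"

definition letter_point :: "('x::finite \<Rightarrow> 'z::finite pmf) \<Rightarrow> ('x \<Rightarrow> 'xh \<Rightarrow> real) \<Rightarrow>
    ('x \<times> 'y::finite \<times> ('z \<Rightarrow> 'xh::finite)) pmf \<Rightarrow> (real ^ ('x \<times> 'y)) \<times> real \<times> real \<times> real" where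
  "letter_point pZ d q = (\<chi> v. pmf (map_pmf (\<lambda>(x, y, w). (x, y)) q) v,
    cent (with_side_info pZ q) (\<lambda>((x, y, w), z). y) (\<lambda>((x, y, w), z). z),
    cmi (with_side_info pZ q) (\<lambda>((x, y, w), z). x) (\<lambda>((x, y, w), z). w) (\<lambda>((x, y, w), z). z),
    measure_pmf.expectation (with_side_info pZ q) (\<lambda>((x, y, w), z). d x (w z)))"

definition letter_hull :: "('x::finite \<times> 'y::finite) pmf \<Rightarrow> ('x \<Rightarrow> 'z::finite pmf) \<Rightarrow>
    ('x \<Rightarrow> 'xh::finite \<Rightarrow> real) \<Rightarrow> ((real ^ ('x \<times> 'y)) \<times> real \<times> real \<times> real) set" where
  "letter_hull pXY pZ d = convex hull (letter_point pZ d ` letter_laws pXY)"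

lemma compact_letter_laws:
  fixes pXY :: "('x::finite \<times> 'y::finite) pmf"
  shows "compact {v \<in> prob_simplex. (pmf_of_vec v :: ('x \<times> 'y \<times> 'w::finite) pmf) \<in> letter_laws pXY}"
    (is "compact ?K")
proof -
  define defect where "defect x y v =
      pmf (map_pmf (\<lambda>(x, y, w). (x, y)) (pmf_of_vec v)) (x, y) * pmf (map_pmf snd pXY) y -
      pmf pXY (x, y) * pmf (map_pmf (\<lambda>(x, y, w). y) (pmf_of_vec v)) y"
    for x y and v :: "real ^ ('x \<times> 'y \<times> 'w)"
  have "continuous_on prob_simplex (defect x y)" for x y
    unfolding defect_def by (intro continuous_intros continuous_on_pmf_map_pmf_of_vec)
  then have "closed (prob_simplex \<inter> defect x y -` {0})" for x y
    by (intro continuous_closed_preimage compact_imp_closed compact_prob_simplex) auto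
  moreover have "?K = prob_simplex \<inter> (\<Inter>x y. prob_simplex \<inter> defect x y -` {0})"
    by (auto simp: letter_laws_def defect_def)
  ultimately show ?thesis
    by (simp only: compact_Int_closed compact_prob_simplex closed_INT ball_UNIV simp_thms)
qed

lemma compact_letter_hull: "compact (letter_hull pXY pZ d)"
proof -
  let ?K = "{v \<in> prob_simplex. pmf_of_vec v \<in> letter_laws pXY}"
  have "letter_laws pXY \<subseteq> pmf_of_vec ` ?K"
    by (auto intro!: image_eqI[where x = "\<chi> i. pmf q i" for q]
        simp: pmf_of_vec_pmf vec_pmf_mem_prob_simplex)
  then have "letter_point pZ d ` letter_laws pXY = (\<lambda>v. letter_point pZ d (pmf_of_vec v)) ` ?K"
    by auto
  moreover have "continuous_on prob_simplex (\<lambda>v. letter_point pZ d (pmf_of_vec v))"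
    unfolding letter_point_def with_side_info_def cent_def cmi_def
    by (intro continuous_intros continuous_on_pmf_map_pmf_of_vec continuous_on_ent_joint_pmf_of_vec
        continuous_on_expectation_joint_pmf_of_vec)
  then have "continuous_on ?K (\<lambda>v. letter_point pZ d (pmf_of_vec v))"
    by (rule continuous_on_subset) simp
  ultimately show ?thesis
    unfolding letter_hull_def
    by (simp add: compact_convex_hull compact_continuous_image compact_letter_laws)
qed

lemma expectation_letter_point:
  fixes pZ :: "'x::finite \<Rightarrow> 'z::finite pmf" and P :: "'u pmf"
    and q :: "'u \<Rightarrow> ('x \<times> 'y::finite \<times> ('z \<Rightarrow> 'xh::finite)) pmf"
  assumes fin: "finite (set_pmf P)"
  defines "J \<equiv> joint_pmf P (\<lambda>u. with_side_info pZ (q u))"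
  shows "measure_pmf.expectation P (\<lambda>u. letter_point pZ d (q u)) =
    (\<chi> v. pmf (map_pmf (\<lambda>(x, y, w). (x, y)) (bind_pmf P q)) v,
     cent J (\<lambda>(u, (x, y, w), z). y) (\<lambda>(u, (x, y, w), z). (u, z)),
     cmi J (\<lambda>(u, (x, y, w), z). x) (\<lambda>(u, (x, y, w), z). w) (\<lambda>(u, (x, y, w), z). (u, z)),
     measure_pmf.expectation J (\<lambda>(u, (x, y, w), z). d x (w z)))"
proof -
  let ?Q = "\<lambda>u. with_side_info pZ (q u)"
  note mixture = cent_joint_pmf[OF fin, of ?Q "\<lambda>((x, y, w), z). y" "\<lambda>((x, y, w), z). z"]
    cmi_joint_pmf[OF fin, of ?Q "\<lambda>((x, y, w), z). x" "\<lambda>((x, y, w), z). w" "\<lambda>((x, y, w), z). z"]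
    expectation_joint_pmf[OF fin, of ?Q "\<lambda>(u, (x, y, w), z). d x (w z)"]
  show ?thesis
    unfolding letter_point_def expectation_Pair[OF fin] expectation_vec[OF fin] J_def
    using mixture by (simp add: map_bind_pmf pmf_bind case_prod_unfold)
qed

lemma pmf_map_swap:
  "pmf (map_pmf (\<lambda>\<omega>. (f \<omega>, g \<omega>)) J) (a, b) = pmf (map_pmf (\<lambda>\<omega>. (g \<omega>, f \<omega>)) J) (b, a)"
  by (simp add: pmf_map vimage_def conj_commute)

lemma pmf_map_swap_joint_pmf:
  assumes law: "map_pmf (\<lambda>\<omega>. (g \<omega>, h \<omega>)) J = joint_pmf p K"
  shows "pmf (map_pmf (\<lambda>\<omega>. (f (h \<omega>), g \<omega>)) J) (b, a) = pmf p a * pmf (map_pmf f (K a)) b"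
proof -
  have "map_pmf (\<lambda>\<omega>. (g \<omega>, f (h \<omega>))) J = map_pmf (\<lambda>(a, c). (a, f c)) (joint_pmf p K)"
    by (simp add: map_pmf_comp flip: law)
  then have "map_pmf (\<lambda>\<omega>. (g \<omega>, f (h \<omega>))) J = joint_pmf p (\<lambda>a. map_pmf f (K a))"
    by (simp only: map_joint_pmf)
  then show ?thesis
    by (simp only: pmf_map_swap[of _ g] pmf_joint_pmf)
qed

lemma map_pmf_eq_joint_pmf_cond_law:
  assumes indep: "\<And>a b c. pmf (map_pmf (\<lambda>\<omega>. ((f \<omega>, g \<omega>), h \<omega>)) J) ((a, b), c) *
      pmf (map_pmf g J) b =
    pmf (map_pmf (\<lambda>\<omega>. (f \<omega>, g \<omega>)) J) (a, b) * pmf (map_pmf (\<lambda>\<omega>. (g \<omega>, h \<omega>)) J) (b, c)"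
  shows "map_pmf (\<lambda>\<omega>. ((f \<omega>, g \<omega>), h \<omega>)) J =
    joint_pmf (map_pmf (\<lambda>\<omega>. (f \<omega>, g \<omega>)) J) (\<lambda>(a, b). cond_law J h g b)"
proof (rule pmf_eqI, clarify)
  fix a b c
  show "pmf (map_pmf (\<lambda>\<omega>. ((f \<omega>, g \<omega>), h \<omega>)) J) ((a, b), c) =
    pmf (joint_pmf (map_pmf (\<lambda>\<omega>. (f \<omega>, g \<omega>)) J) (\<lambda>(a, b). cond_law J h g b)) ((a, b), c)"
  proof (cases "pmf (map_pmf g J) b = 0")
    case True
    then have "g \<omega> \<noteq> b" if "\<omega> \<in> set_pmf J" for \<omega>
      using that by (auto simp: pmf_eq_0_set_pmf)
    then show ?thesis
      by (subst (1 2) pmf_eq_0_set_pmf[THEN iffD2]) (auto simp: set_joint_pmf)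
  next
    case False
    have "pmf (map_pmf (\<lambda>\<omega>. (g \<omega>, h \<omega>)) J) (b, c) = pmf (map_pmf g J) b * pmf (cond_law J h g b) c"
      by (simp add: pmf_joint_pmf flip: joint_pmf_cond_law)
    then show ?thesis
      using indep[of a b c] False by (simp add: pmf_joint_pmf)
  qed
qed

text \<open>\<open>U - Y - X\<close> and \<open>(U, Y, W) - X - Z\<close> are Markov chains and \<open>(X, Y, Z)\<close> is distributed as the
  source.\<close>
locale helper_markov =
  fixes pXY :: "('x::finite \<times> 'y::finite) pmf" and pZ :: "'x \<Rightarrow> 'z::finite pmf" and J :: "'o pmf"
    and U :: "'o \<Rightarrow> 'u" and X :: "'o \<Rightarrow> 'x" and Y :: "'o \<Rightarrow> 'y" and Z :: "'o \<Rightarrow> 'z"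
    and W :: "'o \<Rightarrow> 'z \<Rightarrow> 'xh::finite"
  assumes finite_J: "finite (set_pmf J)"
    and law_XYU: "map_pmf (\<lambda>\<omega>. ((X \<omega>, Y \<omega>), U \<omega>)) J = joint_pmf pXY (\<lambda>(x, y). cond_law J U Y y)"
    and law_UXYWZ: "map_pmf (\<lambda>\<omega>. ((U \<omega>, X \<omega>, Y \<omega>, W \<omega>), Z \<omega>)) J =
      joint_pmf (map_pmf (\<lambda>\<omega>. (U \<omega>, X \<omega>, Y \<omega>, W \<omega>)) J) (\<lambda>(u, x, y, w). pZ x)"
begin

lemma law_Z:
  assumes "\<And>u x y w. \<kappa> (\<phi> (u, x, y, w)) = pZ x"
  shows "map_pmf (\<lambda>\<omega>. (\<phi> (U \<omega>, X \<omega>, Y \<omega>, W \<omega>), Z \<omega>)) J =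
    joint_pmf (map_pmf (\<lambda>\<omega>. \<phi> (U \<omega>, X \<omega>, Y \<omega>, W \<omega>)) J) \<kappa>"
proof -
  have "map_pmf (\<lambda>\<omega>. (\<phi> (U \<omega>, X \<omega>, Y \<omega>, W \<omega>), Z \<omega>)) J =
      map_pmf (\<lambda>(a, z). (\<phi> a, z)) (map_pmf (\<lambda>\<omega>. ((U \<omega>, X \<omega>, Y \<omega>, W \<omega>), Z \<omega>)) J)"
    by (simp add: map_pmf_comp)
  also have "\<dots> = joint_pmf (map_pmf \<phi> (map_pmf (\<lambda>\<omega>. (U \<omega>, X \<omega>, Y \<omega>, W \<omega>)) J)) \<kappa>"
  proof -
    have "(\<lambda>(u, x, y, w). pZ x) = (\<lambda>a. \<kappa> (\<phi> a))" using assms by (simp add: fun_eq_iff)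
    then show ?thesis unfolding law_UXYWZ joint_pmf_map[of \<phi>] by simp
  qed
  finally show ?thesis by (simp add: map_pmf_comp)
qed

lemma law_XY: "map_pmf (\<lambda>\<omega>. (X \<omega>, Y \<omega>)) J = pXY"
  using arg_cong[OF law_XYU, of "map_pmf fst"] by (simp add: map_pmf_comp map_fst_joint_pmf)

lemma law_Y: "map_pmf Y J = map_pmf snd pXY"
  using arg_cong[OF law_XY, of "map_pmf snd"] by (simp add: map_pmf_comp)

definition letter_law :: "'u \<Rightarrow> ('x \<times> 'y \<times> ('z \<Rightarrow> 'xh)) pmf" where
  "letter_law = cond_law J (\<lambda>\<omega>. (X \<omega>, Y \<omega>, W \<omega>)) U"

lemma joint_pmf_letter_law:
  "joint_pmf (map_pmf U J) letter_law = map_pmf (\<lambda>\<omega>. (U \<omega>, X \<omega>, Y \<omega>, W \<omega>)) J"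
  unfolding letter_law_def by (rule joint_pmf_cond_law)

lemma joint_pmf_letter_law_side_info:
  "joint_pmf (map_pmf U J) (\<lambda>u. with_side_info pZ (letter_law u)) =
    map_pmf (\<lambda>\<omega>. (U \<omega>, (X \<omega>, Y \<omega>, W \<omega>), Z \<omega>)) J"
proof -
  have "map_pmf (\<lambda>\<omega>. (U \<omega>, (X \<omega>, Y \<omega>, W \<omega>), Z \<omega>)) J =
      map_pmf (\<lambda>((a, b), c). (a, b, c)) (map_pmf (\<lambda>\<omega>. ((U \<omega>, X \<omega>, Y \<omega>, W \<omega>), Z \<omega>)) J)"
    by (simp add: map_pmf_comp)
  also have "\<dots> = map_pmf (\<lambda>((a, b), c). (a, b, c))
      (joint_pmf (joint_pmf (map_pmf U J) letter_law) (\<lambda>(u, x, y, w). pZ x))"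
    by (simp only: law_UXYWZ joint_pmf_letter_law)
  also have "\<dots> = joint_pmf (map_pmf U J) (\<lambda>u. with_side_info pZ (letter_law u))"
    unfolding joint_pmf_assoc by (simp add: with_side_info_def)
  finally show ?thesis ..
qed

lemma letter_law_mem:
  assumes u_mem: "u \<in> set_pmf (map_pmf U J)"
  shows "letter_law u \<in> letter_laws pXY"
proof -
  let ?k = "cond_law J U Y"
  note weight = pmf_map_swap_joint_pmf[OF joint_pmf_letter_law[symmetric], symmetric]
  have weight_XY: "pmf (map_pmf U J) u * pmf (map_pmf (\<lambda>(x, y, w). (x, y)) (letter_law u)) (x, y) =
      pmf pXY (x, y) * pmf (?k y) u" for x y
    unfolding weight by (simp add: law_XYU pmf_joint_pmf)
  have weight_Y: "pmf (map_pmf U J) u * pmf (map_pmf (\<lambda>(x, y, w). y) (letter_law u)) y =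
      pmf (map_pmf snd pXY) y * pmf (?k y) u" for y
    unfolding weight by (simp add: pmf_joint_pmf joint_pmf_cond_law[of Y J U, symmetric] law_Y)
  have "pmf (map_pmf U J) u *
      (pmf (map_pmf (\<lambda>(x, y, w). (x, y)) (letter_law u)) (x, y) * pmf (map_pmf snd pXY) y) =
    pmf (map_pmf U J) u *
      (pmf pXY (x, y) * pmf (map_pmf (\<lambda>(x, y, w). y) (letter_law u)) y)" for x y
    unfolding mult.assoc[symmetric] weight_XY
    unfolding mult.commute[of _ "pmf pXY (x, y)"] mult.assoc weight_Y by (simp only: mult.commute)
  then show ?thesis
    using u_mem by (simp add: letter_laws_def set_pmf_iff del: set_map_pmf)
qed

lemma rates_in_letter_hull:
  "(\<chi> v. pmf pXY v, cent J Y (\<lambda>\<omega>. (U \<omega>, Z \<omega>)), cmi J X W (\<lambda>\<omega>. (U \<omega>, Z \<omega>)),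
    measure_pmf.expectation J (\<lambda>\<omega>. d (X \<omega>) (W \<omega> (Z \<omega>)))) \<in> letter_hull pXY pZ d"
proof -
  have fin: "finite (set_pmf (map_pmf U J))" using finite_J by simp
  have "bind_pmf (map_pmf U J) letter_law = map_pmf (\<lambda>\<omega>. (X \<omega>, Y \<omega>, W \<omega>)) J"
    using arg_cong[OF joint_pmf_letter_law, of "map_pmf snd"]
    by (simp add: map_snd_joint_pmf map_pmf_comp)
  moreover have "measure_pmf.expectation (map_pmf U J) (\<lambda>u. letter_point pZ d (letter_law u)) \<in>
      letter_hull pXY pZ d"
    unfolding letter_hull_def
    by (rule expectation_in_convex_hull[OF fin]) (intro imageI letter_law_mem)
  ultimately show ?thesis
    unfolding expectation_letter_point[OF fin] joint_pmf_letter_law_side_info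
    by (simp add: cent_map_pmf cmi_map_pmf map_pmf_comp law_XY)
qed

end

lemma helper_markov_letter_laws:
  fixes pXY :: "('x::finite \<times> 'y::finite) pmf" and pZ :: "'x \<Rightarrow> 'z::finite pmf"
    and q :: "'u \<Rightarrow> ('x \<times> 'y \<times> ('z \<Rightarrow> 'xh::finite)) pmf"
  assumes fin: "finite (set_pmf P)" and q_mem: "\<And>u. u \<in> set_pmf P \<Longrightarrow> q u \<in> letter_laws pXY"
    and law_pXY: "map_pmf (\<lambda>(x, y, w). (x, y)) (bind_pmf P q) = pXY"
  shows "helper_markov pXY pZ (joint_pmf P (\<lambda>u. with_side_info pZ (q u))) (\<lambda>(u, (x, y, w), z). u)
    (\<lambda>(u, (x, y, w), z). x) (\<lambda>(u, (x, y, w), z). y) (\<lambda>(u, (x, y, w), z). z) (\<lambda>(u, (x, y, w), z). w)"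
    (is "helper_markov _ _ ?J ?U ?X ?Y ?Z ?W")
proof
  show "finite (set_pmf ?J)" using fin by (simp add: set_joint_pmf)
  have law: "map_pmf (\<lambda>\<omega>. (?U \<omega>, ?X \<omega>, ?Y \<omega>, ?W \<omega>)) ?J = joint_pmf P q"
    by (simp add: with_side_info_def pmf_monad)
  then show "map_pmf (\<lambda>\<omega>. ((?U \<omega>, ?X \<omega>, ?Y \<omega>, ?W \<omega>), ?Z \<omega>)) ?J =
      joint_pmf (map_pmf (\<lambda>\<omega>. (?U \<omega>, ?X \<omega>, ?Y \<omega>, ?W \<omega>)) ?J) (\<lambda>(u, x, y, w). pZ x)"
    by (simp add: with_side_info_def pmf_monad)
  have "map_pmf (\<lambda>\<omega>. (?X \<omega>, ?Y \<omega>, ?W \<omega>)) ?J = bind_pmf P q"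
    using arg_cong[OF law, of "map_pmf snd"] by (simp add: map_pmf_comp map_snd_joint_pmf)
  from arg_cong[OF this, of "map_pmf (\<lambda>(x, y, w). (x, y))"]
  have law_XY: "map_pmf (\<lambda>\<omega>. (?X \<omega>, ?Y \<omega>)) ?J = pXY"
    by (simp add: map_pmf_comp law_pXY)
  have law_Y: "map_pmf ?Y ?J = map_pmf snd pXY"
    using arg_cong[OF law_XY, of "map_pmf snd"] by (simp add: map_pmf_comp case_prod_unfold)
  note weight_XY = pmf_map_swap_joint_pmf[OF law, of "\<lambda>(x, y, w). (x, y)", simplified prod.case]
    and weight_Y = pmf_map_swap_joint_pmf[OF law, of "\<lambda>(x, y, w). y", simplified prod.case]
  show "map_pmf (\<lambda>\<omega>. ((?X \<omega>, ?Y \<omega>), ?U \<omega>)) ?J = joint_pmf pXY (\<lambda>(x, y). cond_law ?J ?U ?Y y)"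
  proof (subst law_XY[symmetric], rule map_pmf_eq_joint_pmf_cond_law)
    fix x y u
    show "pmf (map_pmf (\<lambda>\<omega>. ((?X \<omega>, ?Y \<omega>), ?U \<omega>)) ?J) ((x, y), u) * pmf (map_pmf ?Y ?J) y =
      pmf (map_pmf (\<lambda>\<omega>. (?X \<omega>, ?Y \<omega>)) ?J) (x, y) * pmf (map_pmf (\<lambda>\<omega>. (?Y \<omega>, ?U \<omega>)) ?J) (y, u)"
    proof (cases "u \<in> set_pmf P")
      case True
      then have "pmf (map_pmf (\<lambda>(x, y, w). (x, y)) (q u)) (x, y) * pmf (map_pmf snd pXY) y =
          pmf pXY (x, y) * pmf (map_pmf (\<lambda>(x, y, w). y) (q u)) y"
        using q_mem by (simp add: letter_laws_def)
      then show ?thesis by (simp add: weight_XY weight_Y law_XY law_Y)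
    qed (simp add: weight_XY weight_Y set_pmf_iff)
  qed
qed

lemma letter_hull_imp_helper_markov:
  fixes pXY :: "('x::finite \<times> 'y::finite) pmf" and pZ :: "'x \<Rightarrow> 'z::finite pmf"
    and d :: "'x \<Rightarrow> 'xh::finite \<Rightarrow> real"
  assumes "(\<chi> v. pmf pXY v, c1, c2, c3) \<in> letter_hull pXY pZ d"
  obtains J :: "(nat \<times> ('x \<times> 'y \<times> ('z \<Rightarrow> 'xh)) \<times> 'z) pmf" and U :: "_ \<Rightarrow> nat" and X Y Z W where
    "helper_markov pXY pZ J U X Y Z W" "cent J Y (\<lambda>\<omega>. (U \<omega>, Z \<omega>)) = c1"
    "cmi J X W (\<lambda>\<omega>. (U \<omega>, Z \<omega>)) = c2" "measure_pmf.expectation J (\<lambda>\<omega>. d (X \<omega>) (W \<omega> (Z \<omega>))) = c3"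
proof -
  obtain P :: "nat pmf" and q where fin: "finite (set_pmf P)"
    and q_mem: "\<And>i. i \<in> set_pmf P \<Longrightarrow> q i \<in> letter_laws pXY"
    and point: "measure_pmf.expectation P (\<lambda>i. letter_point pZ d (q i)) =
        (\<chi> v. pmf pXY v, c1, c2, c3)"
    by (rule convex_hull_image_imp_expectation[OF assms[unfolded letter_hull_def]]) blast
  from point have law_pXY: "map_pmf (\<lambda>(x, y, w). (x, y)) (bind_pmf P q) = pXY"
    unfolding expectation_letter_point[OF fin] by (auto simp: vec_eq_iff pmf_eq_iff)
  show thesis
    by (rule that, rule helper_markov_letter_laws[OF fin _ law_pXY], erule q_mem)
      (use point in \<open>simp_all add: expectation_letter_point[OF fin] case_prod_unfold\<close>)
qed

lemma cmi_cong:
  assumes "finite (set_pmf J)"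
    and "\<And>\<omega> \<omega>'. \<omega> \<in> set_pmf J \<Longrightarrow> \<omega>' \<in> set_pmf J \<Longrightarrow> g \<omega> = g \<omega>' \<longleftrightarrow> g' \<omega> = g' \<omega>'"
  shows "cmi J f g h = cmi J f g' h"
proof -
  have "cent J f (\<lambda>\<omega>. (g \<omega>, h \<omega>)) = cent J f (\<lambda>\<omega>. (g' \<omega>, h \<omega>))"
    using assms by (intro cent_cong) auto
  then show ?thesis by (simp add: cmi_eq_cent)
qed

text \<open>\<open>W\<close> is redrawn independently of \<open>Y\<close>, which keeps the laws of \<open>(U, X, W, Z)\<close> and \<open>(U, Y, Z)\<close>.\<close>
locale helper_markov_nat = helper_markov pXY pZ J U X Y Z W
  for pXY :: "('x::finite \<times> 'y::finite) pmf" and pZ :: "'x \<Rightarrow> 'z::finite pmf" and J :: "'o pmf"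
    and U :: "'o \<Rightarrow> nat" and X Y Z and W :: "'o \<Rightarrow> 'z \<Rightarrow> 'xh::finite"
begin

definition U_channel :: "'y \<Rightarrow> nat pmf" where
  "U_channel = cond_law J U Y"

definition W_channel :: "'x \<Rightarrow> nat \<Rightarrow> nat pmf" where
  "W_channel x u = map_pmf to_nat (cond_law J W (\<lambda>\<omega>. (X \<omega>, U \<omega>)) (x, u))"

abbreviation test_law :: "('x \<times> 'y \<times> 'z \<times> nat \<times> nat) pmf" where
  "test_law \<equiv> joint5 pXY pZ U_channel W_channel"

lemma finite_U_channel: "finite (\<Union>y. set_pmf (U_channel y))"
proof (rule finite_subset)
  show "(\<Union>y. set_pmf (U_channel y)) \<subseteq> U ` set_pmf J"
    unfolding U_channel_def by (intro UN_least set_cond_law_subset)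
qed (use finite_J in simp)

lemma finite_W_channel: "finite (\<Union>x u. set_pmf (W_channel x u))"
proof (rule finite_subset)
  show "(\<Union>x u. set_pmf (W_channel x u)) \<subseteq> range (to_nat :: ('z \<Rightarrow> 'xh) \<Rightarrow> nat)"
    by (auto simp: W_channel_def)
qed simp

lemma law_UYZ: "map_pmf (\<lambda>\<omega>. (U \<omega>, Y \<omega>, Z \<omega>)) J = map_pmf (\<lambda>\<omega>. (U_of \<omega>, Y_of \<omega>, Z_of \<omega>)) test_law"
proof -
  have "map_pmf (\<lambda>\<omega>. (((X \<omega>, Y \<omega>), U \<omega>), Z \<omega>)) J =
      joint_pmf (joint_pmf pXY (\<lambda>(x, y). U_channel y)) (\<lambda>((x, y), u). pZ x)"
    using law_Z[of "\<lambda>((x, y), u). pZ x" "\<lambda>(u, x, y, w). ((x, y), u)"]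
    by (simp add: law_XYU U_channel_def)
  from arg_cong[OF this, of "map_pmf (\<lambda>(((x, y), u), z). (u, y, z))"]
  have "map_pmf (\<lambda>\<omega>. (U \<omega>, Y \<omega>, Z \<omega>)) J = bind_pmf pXY (\<lambda>v. bind_pmf (U_channel (snd v))
      (\<lambda>u. bind_pmf (pZ (fst v)) (\<lambda>z. return_pmf (u, snd v, z))))"
    by (simp add: map_pmf_comp) (simp add: pmf_monad)
  also have "\<dots> = map_pmf (\<lambda>\<omega>. (U_of \<omega>, Y_of \<omega>, Z_of \<omega>)) test_law"
    by (simp add: joint5_def pmf_monad) (intro bind_pmf_cong refl, rule bind_commute_pmf)
  finally show ?thesis .
qed

lemma law_XUWZ: "map_pmf (\<lambda>\<omega>. (X \<omega>, U \<omega>, to_nat (W \<omega>), Z \<omega>)) J =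
  map_pmf (\<lambda>\<omega>. (X_of \<omega>, U_of \<omega>, W_of \<omega>, Z_of \<omega>)) test_law"
proof -
  let ?kW = "cond_law J W (\<lambda>\<omega>. (X \<omega>, U \<omega>))"
  have law_XU: "map_pmf (\<lambda>\<omega>. (X \<omega>, U \<omega>)) J =
      map_pmf (\<lambda>((x, y), u). (x, u)) (joint_pmf pXY (\<lambda>(x, y). U_channel y))"
    using arg_cong[OF law_XYU, of "map_pmf (\<lambda>((x, y), u). (x, u))"]
    by (simp add: map_pmf_comp U_channel_def)
  have "map_pmf (\<lambda>\<omega>. (((X \<omega>, U \<omega>), W \<omega>), Z \<omega>)) J =
      joint_pmf (joint_pmf (map_pmf (\<lambda>\<omega>. (X \<omega>, U \<omega>)) J) ?kW) (\<lambda>((x, u), w). pZ x)"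
    using law_Z[of "\<lambda>((x, u), w). pZ x" "\<lambda>(u, x, y, w). ((x, u), w)"]
    by (simp add: joint_pmf_cond_law)
  from arg_cong[OF this, of "map_pmf (\<lambda>(((x, u), w), z). (x, u, to_nat w, z))"]
  have "map_pmf (\<lambda>\<omega>. (X \<omega>, U \<omega>, to_nat (W \<omega>), Z \<omega>)) J =
      bind_pmf pXY (\<lambda>v. bind_pmf (U_channel (snd v))
      (\<lambda>u. bind_pmf (W_channel (fst v) u)
        (\<lambda>w. bind_pmf (pZ (fst v)) (\<lambda>z. return_pmf (fst v, u, w, z)))))"
    by (simp add: map_pmf_comp law_XU) (simp add: pmf_monad W_channel_def)
  also have "\<dots> = bind_pmf pXY (\<lambda>v. bind_pmf (U_channel (snd v))
      (\<lambda>u. bind_pmf (pZ (fst v)) (\<lambda>z. bind_pmf (W_channel (fst v) u)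
        (\<lambda>w. return_pmf (fst v, u, w, z)))))"
    by (intro bind_pmf_cong refl, rule bind_commute_pmf)
  also have "\<dots> = map_pmf (\<lambda>\<omega>. (X_of \<omega>, U_of \<omega>, W_of \<omega>, Z_of \<omega>)) test_law"
    by (simp add: joint5_def pmf_monad) (intro bind_pmf_cong refl, rule bind_commute_pmf)
  finally show ?thesis .
qed

lemma test_law_cent_Y: "cent test_law Y_of UZ_of = cent J Y (\<lambda>\<omega>. (U \<omega>, Z \<omega>))"
  using arg_cong[OF law_UYZ, of "\<lambda>p. cent p (\<lambda>(u, y, z). y) (\<lambda>(u, y, z). (u, z))"]
  by (simp add: cent_map_pmf case_prod_unfold)

lemma test_law_cmi: "cmi test_law X_of W_of UZ_of = cmi J X W (\<lambda>\<omega>. (U \<omega>, Z \<omega>))"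
proof -
  have "cmi test_law X_of W_of UZ_of = cmi J X (\<lambda>\<omega>. to_nat (W \<omega>)) (\<lambda>\<omega>. (U \<omega>, Z \<omega>))"
    using arg_cong[OF law_XUWZ,
        of "\<lambda>p. cmi p (\<lambda>(x, u, w, z). x) (\<lambda>(x, u, w, z). w) (\<lambda>(x, u, w, z). (u, z))"]
    by (simp add: cmi_map_pmf case_prod_unfold)
  also have "\<dots> = cmi J X W (\<lambda>\<omega>. (U \<omega>, Z \<omega>))"
    by (rule cmi_cong[OF finite_J]) simp
  finally show ?thesis .
qed

lemma test_law_distortion:
  fixes d :: "'x \<Rightarrow> 'xh \<Rightarrow> real"
  shows "measure_pmf.expectation test_law
      (\<lambda>\<omega>. d (X_of \<omega>) ((from_nat (W_of \<omega>) :: 'z \<Rightarrow> 'xh) (Z_of \<omega>))) =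
    measure_pmf.expectation J (\<lambda>\<omega>. d (X \<omega>) (W \<omega> (Z \<omega>)))"
  using arg_cong[OF law_XUWZ, of "\<lambda>p. measure_pmf.expectation p
    (\<lambda>(x, u, w, z). d x ((from_nat w :: 'z \<Rightarrow> 'xh) z))"]
  by (simp add: case_prod_unfold)

lemma mem_RYXZ:
  assumes "cent_Y_given_Z pXY pZ - cent J Y (\<lambda>\<omega>. (U \<omega>, Z \<omega>)) \<le> R1"
    and "cmi J X W (\<lambda>\<omega>. (U \<omega>, Z \<omega>)) \<le> R"
    and "measure_pmf.expectation J (\<lambda>\<omega>. d (X \<omega>) (W \<omega> (Z \<omega>))) \<le> D"
  shows "(R, R1) \<in> RYXZ pXY pZ d D"
proof -
  have "map_pmf (\<lambda>\<omega>. (X_of \<omega>, Y_of \<omega>, Z_of \<omega>)) test_law = src pXY pZ"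
    by (simp add: joint5_def src_def pmf_monad)
  from arg_cong[OF this, of "\<lambda>p. cent p (\<lambda>(x, y, z). y) (\<lambda>(x, y, z). z)"]
  have "cent test_law Y_of Z_of = cent_Y_given_Z pXY pZ"
    by (simp add: cent_map_pmf case_prod_unfold)
  moreover have "finite (set_pmf test_law)"
    using test_channel.finite_J[of U_channel W_channel "\<lambda>_ _. 0"] finite_U_channel finite_W_channel
    by (simp add: test_channel_def)
  then have "cmi test_law U_of Y_of Z_of = cent test_law Y_of Z_of - cent test_law Y_of UZ_of"
    by (subst cmi_commute) (simp_all add: cmi_eq_cent)
  ultimately show ?thesis
    unfolding mem_RYXZ_iff using assms finite_U_channel finite_W_channel
    by (intro exI[of _ U_channel] exI[of _ W_channel] exI[of _ "\<lambda>u w. from_nat w"])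
      (simp add: test_law_cent_Y test_law_cmi test_law_distortion)
qed

end

definition single_letter_region :: "('x::finite \<times> 'y::finite) pmf \<Rightarrow> ('x \<Rightarrow> 'z::finite pmf) \<Rightarrow>
    ('x \<Rightarrow> 'xh::finite \<Rightarrow> real) \<Rightarrow> (real \<times> real \<times> real) set" where
  "single_letter_region pXY pZ d =
  {(R1, R, D). \<exists>c1 c2 c3. (\<chi> v. pmf pXY v, c1, c2, c3) \<in> letter_hull pXY pZ d \<and>
    cent_Y_given_Z pXY pZ - c1 \<le> R1 \<and> c2 \<le> R \<and> c3 \<le> D}"

lemma single_letter_regionI:
  assumes "(\<chi> v. pmf pXY v, c1, c2, c3) \<in> letter_hull pXY pZ d"
    and "cent_Y_given_Z pXY pZ - c1 \<le> R1" "c2 \<le> R" "c3 \<le> D"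
  shows "(R1, R, D) \<in> single_letter_region pXY pZ d"
  using assms unfolding single_letter_region_def by blast

lemma single_letter_region_imp_RYXZ:
  fixes pXY :: "('x::finite \<times> 'y::finite) pmf" and pZ :: "'x \<Rightarrow> 'z::finite pmf"
    and d :: "'x \<Rightarrow> 'xh::finite \<Rightarrow> real"
  assumes "(R1, R, D) \<in> single_letter_region pXY pZ d"
  shows "(R, R1) \<in> RYXZ pXY pZ d D"
proof -
  obtain c1 c2 c3 where bounds: "(\<chi> v. pmf pXY v, c1, c2, c3) \<in> letter_hull pXY pZ d"
    "cent_Y_given_Z pXY pZ - c1 \<le> R1" "c2 \<le> R" "c3 \<le> D"
    using assms by (auto simp: single_letter_region_def)
  obtain J :: "(nat \<times> ('x \<times> 'y \<times> ('z \<Rightarrow> 'xh)) \<times> 'z) pmf" and U :: "_ \<Rightarrow> nat" and X Y Z W where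
    "helper_markov pXY pZ J U X Y Z W" and
    rates: "cent J Y (\<lambda>\<omega>. (U \<omega>, Z \<omega>)) = c1" "cmi J X W (\<lambda>\<omega>. (U \<omega>, Z \<omega>)) = c2"
      "measure_pmf.expectation J (\<lambda>\<omega>. d (X \<omega>) (W \<omega> (Z \<omega>))) = c3"
    by (rule letter_hull_imp_helper_markov[OF bounds(1)])
  then interpret helper_markov_nat pXY pZ J U X Y Z W
    by (simp add: helper_markov_nat_def)
  show ?thesis using bounds(2-4) by (intro mem_RYXZ) (simp_all add: rates)
qed

text \<open>The region is the sum of a compact set and the positive orthant.\<close>
lemma closed_single_letter_region: "closed (single_letter_region pXY pZ d)"
proof -
  let ?H = "cent_Y_given_Z pXY pZ"
  let ?C = "letter_hull pXY pZ d \<inter> {p. fst p = (\<chi> v. pmf pXY v)}"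
  let ?corner = "\<lambda>p. (?H - fst (snd p), snd (snd p))"
  have "closed {p. fst p = (\<chi> v. pmf pXY v)}"
    by (intro closed_Collect_eq continuous_intros)
  then have "compact (?corner ` ?C)"
    by (intro compact_continuous_image compact_Int_closed compact_letter_hull continuous_intros)
  moreover have "closed ({0..} \<times> {0..} \<times> {0..} :: (real \<times> real \<times> real) set)"
    by (intro closed_Times closed_atLeast)
  ultimately have "closed (\<Union>a\<in>?corner ` ?C. \<Union>b\<in>{0..} \<times> {0..} \<times> {0..}. {a + b})"
    by (rule compact_closed_sums)
  moreover have "single_letter_region pXY pZ d =
      (\<Union>a\<in>?corner ` ?C. \<Union>b\<in>{0..} \<times> {0..} \<times> {0..}. {a + b})"
  proof (intro set_eqI iffI)
    fix r assume "r \<in> single_letter_region pXY pZ d"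
    then obtain R1 R D c1 c2 c3
      where "r = (R1, R, D)" "(\<chi> v. pmf pXY v, c1, c2, c3) \<in> letter_hull pXY pZ d"
      "?H - c1 \<le> R1" "c2 \<le> R" "c3 \<le> D"
      by (auto simp: single_letter_region_def)
    then show "r \<in> (\<Union>a\<in>?corner ` ?C. \<Union>b\<in>{0..} \<times> {0..} \<times> {0..}. {a + b})"
      by (intro UN_I[of "?corner (\<chi> v. pmf pXY v, c1, c2, c3)"]
          UN_I[of "(R1 - (?H - c1), R - c2, D - c3)"] imageI)
        auto
  next
    fix r assume "r \<in> (\<Union>a\<in>?corner ` ?C. \<Union>b\<in>{0..} \<times> {0..} \<times> {0..}. {a + b})"
    then obtain c1 c2 c3 R1 R D where "(\<chi> v. pmf pXY v, c1, c2, c3) \<in> letter_hull pXY pZ d"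
      "r = (?H - c1 + R1, c2 + R, c3 + D)" "0 \<le> R1" "0 \<le> R" "0 \<le> D"
      by auto
    then show "r \<in> single_letter_region pXY pZ d"
      by (auto intro: single_letter_regionI)
  qed
  ultimately show ?thesis by simp
qed

section \<open>Converse\<close>

lemma iid_split_at:
  "iid (i + Suc m) P = map_pmf (\<lambda>(s, pre, post). pre @ s # post)
    (pair_pmf P (pair_pmf (iid i P) (iid m P)))"
proof (induction i)
  case 0
  show ?case by (simp add: pmf_monad pair_pmf_def)
next
  case (Suc i)
  have "iid (Suc i + Suc m) P = bind_pmf P (\<lambda>a. bind_pmf P (\<lambda>s. bind_pmf (iid i P) (\<lambda>pre.
      bind_pmf (iid m P) (\<lambda>post. return_pmf ((a # pre) @ s # post)))))"
    using Suc by (simp add: pair_pmf_def pmf_monad)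
  also have "\<dots> = bind_pmf P (\<lambda>s. bind_pmf P (\<lambda>a. bind_pmf (iid i P) (\<lambda>pre.
      bind_pmf (iid m P) (\<lambda>post. return_pmf ((a # pre) @ s # post)))))"
    by (rule bind_commute_pmf)
  also have "\<dots> = map_pmf (\<lambda>(s, pre, post). pre @ s # post)
      (pair_pmf P (pair_pmf (iid (Suc i) P) (iid m P)))"
    by (simp add: pair_pmf_def pmf_monad)
  finally show ?case .
qed

lemma helper_markovI:
  assumes fin: "finite (set_pmf J)"
    and law_XYU: "map_pmf (\<lambda>\<omega>. ((X \<omega>, Y \<omega>), U \<omega>)) J = joint_pmf pXY (\<lambda>(x, y). k y)"
    and law_UXYWZ: "map_pmf (\<lambda>\<omega>. ((U \<omega>, X \<omega>, Y \<omega>, W \<omega>), Z \<omega>)) J =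
      joint_pmf (map_pmf (\<lambda>\<omega>. (U \<omega>, X \<omega>, Y \<omega>, W \<omega>)) J) (\<lambda>(u, x, y, w). pZ x)"
  shows "helper_markov pXY pZ J U X Y Z W"
proof
  have "map_pmf (\<lambda>\<omega>. (Y \<omega>, U \<omega>)) J = joint_pmf (map_pmf snd pXY) k"
    using arg_cong[OF law_XYU, of "map_pmf (\<lambda>((x, y), u). (y, u))"]
    by (simp add: map_pmf_comp joint_pmf_map case_prod_unfold)
  then have "cond_law J U Y y = k y" if "y \<in> set_pmf (map_pmf snd pXY)" for y
    using that by (rule cond_law_joint_pmf)
  then show "map_pmf (\<lambda>\<omega>. ((X \<omega>, Y \<omega>), U \<omega>)) J = joint_pmf pXY (\<lambda>(x, y). cond_law J U Y y)"
    unfolding law_XYU by (intro joint_pmf_cong) force+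
qed (fact assms)+

locale helper_code =
  fixes pXY :: "('x::finite \<times> 'y::finite) pmf" and pZ :: "'x \<Rightarrow> 'z::finite pmf"
    and n M Me Md :: nat and fe fd :: "'y list \<Rightarrow> nat" and f :: "'x list \<Rightarrow> nat \<Rightarrow> nat"
    and g :: "nat \<Rightarrow> nat \<Rightarrow> 'z list \<Rightarrow> 'xh::finite list"
  assumes fe_range: "\<And>ys. length ys = n \<Longrightarrow> fe ys \<in> {1..Me}"
    and fd_range: "\<And>ys. length ys = n \<Longrightarrow> fd ys \<in> {1..Md}"
    and f_range: "\<And>xs m. length xs = n \<Longrightarrow> m \<in> {1..Me} \<Longrightarrow> f xs m \<in> {1..M}"
begin

abbreviation S :: "('x \<times> 'y \<times> 'z) pmf" where
  "S \<equiv> src pXY pZ"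

abbreviation L :: "('x \<times> 'y \<times> 'z) list pmf" where
  "L \<equiv> iid n S"

definition X :: "nat \<Rightarrow> ('x \<times> 'y \<times> 'z) list \<Rightarrow> 'x" where "X i t = fst (t ! i)"

definition Y :: "nat \<Rightarrow> ('x \<times> 'y \<times> 'z) list \<Rightarrow> 'y" where "Y i t = fst (snd (t ! i))"

definition Z :: "nat \<Rightarrow> ('x \<times> 'y \<times> 'z) list \<Rightarrow> 'z" where "Z i t = snd (snd (t ! i))"

definition decoder_msg :: "('x \<times> 'y \<times> 'z) list \<Rightarrow> nat" where
  "decoder_msg t = fd (map (fst \<circ> snd) t)"

definition source_msg :: "('x \<times> 'y \<times> 'z) list \<Rightarrow> nat" where
  "source_msg t = f (map fst t) (fe (map (fst \<circ> snd) t))"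

text \<open>Overwriting position \<open>i\<close> by \<open>undefined\<close> forgets \<open>Z i\<close> and keeps the other indices in place.\<close>
definition rest :: "nat \<Rightarrow> ('x \<times> 'y \<times> 'z) list \<Rightarrow> ('x \<times> 'y) list \<times> 'z list" where
  "rest i t = (take i (map (\<lambda>s. (fst s, fst (snd s))) t), (map (snd \<circ> snd) t)[i := undefined])"

definition U :: "nat \<Rightarrow> ('x \<times> 'y \<times> 'z) list \<Rightarrow> nat \<times> ('x \<times> 'y) list \<times> 'z list" where
  "U i t = (decoder_msg t, rest i t)"

definition W :: "nat \<Rightarrow> ('x \<times> 'y \<times> 'z) list \<Rightarrow> 'z \<Rightarrow> 'xh" where
  "W i t = (\<lambda>z. g (source_msg t) (decoder_msg t) ((snd (rest i t))[i := z]) ! i)"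

lemma finite_L: "finite (set_pmf L)"
  by (intro finite_set_pmf_iid) simp

lemma length_L: "t \<in> set_pmf L \<Longrightarrow> length t = n"
  by (simp add: set_pmf_iid)

lemma side_info_determined:
  assumes mem_L: "t \<in> set_pmf L" "t' \<in> set_pmf L"
    and same: "snd (rest i t) = snd (rest i t')" "Z i t = Z i t'"
  shows "map (snd \<circ> snd) t = map (snd \<circ> snd) t'"
proof (rule nth_equalityI)
  show "length (map (snd \<circ> snd) t) = length (map (snd \<circ> snd) t')"
    using mem_L by (simp add: length_L)
  fix j assume j_less: "j < length (map (snd \<circ> snd) t)"
  show "map (snd \<circ> snd) t ! j = map (snd \<circ> snd) t' ! j"
  proof (cases "j = i")
    case True
    then show ?thesis using same(2) j_less mem_L by (simp add: Z_def length_L)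
  next
    case False
    then show ?thesis
      using arg_cong[OF same(1), of "\<lambda>zs. zs ! j"] by (simp add: rest_def)
  qed
qed

lemma rest_Suc_determined:
  assumes mem_L: "t \<in> set_pmf L" "t' \<in> set_pmf L" and i_less: "i < n"
    and same: "rest (Suc i) t = rest (Suc i) t'" "Z (Suc i) t = Z (Suc i) t'"
  shows "X i t = X i t'" "Y i t = Y i t'" "Z i t = Z i t'" "rest i t = rest i t'"
proof -
  have lengths: "length t = n" "length t' = n" using mem_L by (simp_all add: length_L)
  let ?xy = "\<lambda>s. (fst s, fst (snd s))"
  have side: "map (snd \<circ> snd) t = map (snd \<circ> snd) t'"
    using mem_L same by (intro side_info_determined[of t t' "Suc i"]) auto
  have "take (Suc i) (map ?xy t) = take (Suc i) (map ?xy t')"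
    using same(1) by (simp add: rest_def)
  then have past: "take i (map ?xy t) = take i (map ?xy t')" "?xy (t ! i) = ?xy (t' ! i)"
    using i_less lengths by (simp_all add: take_Suc_conv_app_nth)
  show "X i t = X i t'" "Y i t = Y i t'" using past(2) by (simp_all add: X_def Y_def)
  show "Z i t = Z i t'"
    using arg_cong[OF side, of "\<lambda>zs. zs ! i"] i_less lengths by (simp add: Z_def)
  show "rest i t = rest i t'" using side past(1) by (simp add: rest_def)
qed

lemma W_determined: "source_msg t = source_msg t' \<Longrightarrow> U i t = U i t' \<Longrightarrow> W i t = W i t'"
  by (simp add: W_def U_def)

context
  fixes i :: nat
  assumes i_less: "i < n"
begin

definition others :: "(('x \<times> 'y \<times> 'z) list \<times> ('x \<times> 'y \<times> 'z) list) pmf" where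
  "others = pair_pmf (iid i S) (iid (n - Suc i) S)"

lemma map_pmf_L_split_at:
  assumes "\<And>s pre post. length pre = i \<Longrightarrow> length post = n - Suc i \<Longrightarrow>
      h (pre @ s # post) = h' s (pre, post)"
  shows "map_pmf h L = map_pmf (\<lambda>(s, c). h' s c) (pair_pmf S others)"
proof -
  have "n = i + Suc (n - Suc i)" using i_less by simp
  then have "map_pmf h L = map_pmf (\<lambda>(s, pre, post). h (pre @ s # post)) (pair_pmf S others)"
    using iid_split_at[of i "n - Suc i" S] by (simp add: map_pmf_comp others_def case_prod_unfold)
  also have "\<dots> = map_pmf (\<lambda>(s, c). h' s c) (pair_pmf S others)"
    by (intro map_pmf_cong refl) (auto simp: others_def set_pmf_iid assms)
  finally show ?thesis .
qed

lemma rest_independent: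
  obtains q where "map_pmf (\<lambda>t. (rest i t, (X i t, Y i t, Z i t))) L = joint_pmf q (\<lambda>_. S)"
    "finite (set_pmf q)"
proof -
  define q where "q = map_pmf (\<lambda>(pre, post). rest i (pre @ undefined # post)) others"
  have "map_pmf (\<lambda>t. (rest i t, (X i t, Y i t, Z i t))) L =
      map_pmf (\<lambda>(s, c). (rest i (fst c @ undefined # snd c), s)) (pair_pmf S others)"
    by (rule map_pmf_L_split_at)
      (simp add: rest_def X_def Y_def Z_def nth_append list_update_append)
  also have "\<dots> = bind_pmf S (\<lambda>s. bind_pmf q (\<lambda>r. return_pmf (r, s)))"
    by (simp add: q_def pair_pmf_def pmf_monad)
  also have "\<dots> = joint_pmf q (\<lambda>_. S)"
    by (subst bind_commute_pmf) (simp add: joint_pmf_def map_pmf_def)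
  finally show thesis
    by (rule that)
      (auto simp: q_def others_def
        intro!: finite_imageI finite_cartesian_product finite_set_pmf_iid)
qed

lemma cent_Y_rest: "cent L (Y i) (\<lambda>t. (rest i t, Z i t)) = cent_Y_given_Z pXY pZ"
proof -
  obtain q where law: "map_pmf (\<lambda>t. (rest i t, (X i t, Y i t, Z i t))) L = joint_pmf q (\<lambda>_. S)"
    and fin: "finite (set_pmf q)" by (rule rest_independent)
  have "cent L (Y i) (\<lambda>t. (rest i t, Z i t)) =
      cent (map_pmf (\<lambda>t. (rest i t, (X i t, Y i t, Z i t))) L) (\<lambda>(r, s). (\<lambda>(x, y, z). y) s)
        (\<lambda>(r, s). (r, (\<lambda>(x, y, z). z) s))"
    by (simp add: cent_map_pmf)
  also have "\<dots> = cent_Y_given_Z pXY pZ"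
    unfolding law by (subst cent_joint_pmf[OF fin]) simp_all
  finally show ?thesis .
qed

lemma helper_markov_letter: "helper_markov pXY pZ L (U i) (X i) (Y i) (Z i) (W i)"
proof (rule helper_markovI[OF finite_L])
  let ?t = "\<lambda>x y c. fst c @ (x, y, undefined) # snd c"
  let ?v = "\<lambda>v c. (U i (?t (fst v) (snd v) c), fst v, snd v, W i (?t (fst v) (snd v) c))"
  have "map_pmf (\<lambda>t. ((U i t, X i t, Y i t, W i t), Z i t)) L =
      map_pmf (\<lambda>(s, c). (?v (fst s, fst (snd s)) c, snd (snd s))) (pair_pmf S others)"
    by (rule map_pmf_L_split_at)
      (simp add: X_def Y_def Z_def U_def W_def rest_def decoder_msg_def source_msg_def nth_append
        list_update_append)
  also have "\<dots> = bind_pmf pXY (\<lambda>v. bind_pmf (pZ (fst v)) (\<lambda>z. map_pmf (\<lambda>c. (?v v c, z)) others))"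
    by (simp add: src_def pair_pmf_def pmf_monad)
  also have "\<dots> = bind_pmf pXY (\<lambda>v. bind_pmf others (\<lambda>c. map_pmf (Pair (?v v c)) (pZ (fst v))))"
    unfolding map_pmf_def by (intro bind_pmf_cong refl bind_commute_pmf)
  finally have law: "map_pmf (\<lambda>t. ((U i t, X i t, Y i t, W i t), Z i t)) L = \<dots>" .
  have law_UXYW: "map_pmf (\<lambda>t. (U i t, X i t, Y i t, W i t)) L =
      bind_pmf pXY (\<lambda>v. map_pmf (?v v) others)"
    using arg_cong[OF law, of "map_pmf fst"]
    by (simp add: map_pmf_comp map_bind_pmf map_pmf_const) (simp add: map_pmf_def)
  show "map_pmf (\<lambda>t. ((U i t, X i t, Y i t, W i t), Z i t)) L =
      joint_pmf (map_pmf (\<lambda>t. (U i t, X i t, Y i t, W i t)) L) (\<lambda>(u, x, y, w). pZ x)"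
    unfolding law law_UXYW by (simp add: joint_pmf_def bind_map_pmf bind_assoc_pmf)
  have "U i (?t (fst v) (snd v) c) = U i (?t undefined (snd v) c)" if "c \<in> set_pmf others" for v c
    using that by (auto simp: others_def set_pmf_iid U_def rest_def decoder_msg_def)
  then have "map_pmf (\<lambda>c. ((fst v, snd v), U i (?t (fst v) (snd v) c))) others =
      map_pmf (Pair v) (map_pmf (\<lambda>c. U i (?t undefined (snd v) c)) others)" for v
    unfolding map_pmf_comp by (intro map_pmf_cong refl) simp
  then show "map_pmf (\<lambda>t. ((X i t, Y i t), U i t)) L = joint_pmf pXY (\<lambda>(x, y).
      map_pmf (\<lambda>c. U i (?t undefined y c)) others)"
    using arg_cong[OF law_UXYW, of "map_pmf (\<lambda>(u, x, y, w). ((x, y), u))"]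
    by (simp add: map_pmf_comp map_bind_pmf joint_pmf_def case_prod_unfold)
qed

lemma letter_rates_in_hull:
  "(\<chi> v. pmf pXY v, cent L (Y i) (\<lambda>t. (U i t, Z i t)), cmi L (X i) (W i) (\<lambda>t. (U i t, Z i t)),
    measure_pmf.expectation L (\<lambda>t. d (X i t) (W i t (Z i t)))) \<in> letter_hull pXY pZ d"
  by (rule helper_markov.rates_in_letter_hull[OF helper_markov_letter])

end

lemma sum_Y_rate:
  "n * cent_Y_given_Z pXY pZ - (\<Sum>i<n. cent L (Y i) (\<lambda>t. (U i t, Z i t))) \<le> log 2 Md"
proof -
  let ?C = "\<lambda>i t. (rest i t, Z i t)"
  have "cmi L decoder_msg (Y i) (?C i) =
      cent_Y_given_Z pXY pZ - cent L (Y i) (\<lambda>t. (U i t, Z i t))" if "i < n" for i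
  proof -
    have "cent L (Y i) (\<lambda>t. (decoder_msg t, ?C i t)) = cent L (Y i) (\<lambda>t. (U i t, Z i t))"
      by (rule cent_cong[OF finite_L]) (auto simp: U_def)
    then show ?thesis
      using cmi_commute[OF finite_L, of decoder_msg "Y i" "?C i"] cent_Y_rest[OF that]
      by (simp add: cmi_eq_cent)
  qed
  then have "n * cent_Y_given_Z pXY pZ - (\<Sum>i<n. cent L (Y i) (\<lambda>t. (U i t, Z i t))) =
      (\<Sum>i<n. cmi L decoder_msg (Y i) (?C i))"
    by (simp add: sum_subtractf)
  also have "\<dots> \<le> ent (map_pmf decoder_msg L)"
    by (rule sum_cmi_le_ent[OF finite_L]) (auto intro: rest_Suc_determined)
  also have "\<dots> \<le> log 2 (card {1..Md})"
    using fd_range by (intro ent_le_log_card) (auto simp: decoder_msg_def length_L)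
  finally show ?thesis by simp
qed

lemma sum_W_rate: "(\<Sum>i<n. cmi L (X i) (W i) (\<lambda>t. (U i t, Z i t))) \<le> log 2 M"
proof -
  have "(\<Sum>i<n. cmi L (X i) (W i) (\<lambda>t. (U i t, Z i t))) \<le>
      (\<Sum>i<n. cmi L source_msg (X i) (\<lambda>t. (U i t, Z i t)))"
    unfolding cmi_commute[OF finite_L, of source_msg]
    by (intro sum_mono cmi_data_processing finite_L) (auto intro: W_determined)
  also have "\<dots> \<le> ent (map_pmf source_msg L)"
    by (rule sum_cmi_le_ent[OF finite_L]) (auto simp: U_def intro: rest_Suc_determined)
  also have "\<dots> \<le> log 2 (card {1..M})"
    using f_range fe_range by (intro ent_le_log_card) (auto simp: source_msg_def length_L)
  finally show ?thesis by simp
qed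

lemma sum_distortion:
  "(\<Sum>i<n. measure_pmf.expectation L (\<lambda>t. d (X i t) (W i t (Z i t)))) / n = measure_pmf.expectation L
      (\<lambda>t. let xs = map fst t; ys = map (fst \<circ> snd) t; zs = map (snd \<circ> snd) t;
               xh = g (f xs (fe ys)) (fd ys) zs
           in (1 / real n) * (\<Sum>i<n. d (xs ! i) (xh ! i)))"
proof -
  have "(\<Sum>i<n. measure_pmf.expectation L (\<lambda>t. d (X i t) (W i t (Z i t)))) / n =
      measure_pmf.expectation L (\<lambda>t. (1 / n) * (\<Sum>i<n. d (X i t) (W i t (Z i t))))"
    by (simp add: integrable_measure_pmf_finite finite_L)
  also have "\<dots> = measure_pmf.expectation L
      (\<lambda>t. let xs = map fst t; ys = map (fst \<circ> snd) t; zs = map (snd \<circ> snd) t;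
               xh = g (f xs (fe ys)) (fd ys) zs
           in (1 / real n) * (\<Sum>i<n. d (xs ! i) (xh ! i)))"
  proof (rule expectation_cong_pmf)
    fix t assume t_mem: "t \<in> set_pmf L"
    have "(map (snd \<circ> snd) t)[i := Z i t] = map (snd \<circ> snd) t" if "i < n" for i
      using that t_mem list_update_id[of "map (snd \<circ> snd) t" i] by (simp add: Z_def length_L)
    then show "(1 / n) * (\<Sum>i<n. d (X i t) (W i t (Z i t))) =
      (let xs = map fst t; ys = map (fst \<circ> snd) t; zs = map (snd \<circ> snd) t;
           xh = g (f xs (fe ys)) (fd ys) zs
       in (1 / real n) * (\<Sum>i<n. d (xs ! i) (xh ! i)))"
      using t_mem by (simp add: Let_def W_def X_def rest_def source_msg_def decoder_msg_def
          length_L)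
  qed
  finally show ?thesis .
qed

end

lemma is_code_imp_single_letter_region:
  fixes pXY :: "('x::finite \<times> 'y::finite) pmf" and pZ :: "'x \<Rightarrow> 'z::finite pmf"
    and d :: "'x \<Rightarrow> 'xh::finite \<Rightarrow> real"
  assumes n_pos: "n > 0" and code: "is_code pXY pZ d n M Me Md D"
    and M_le: "real M \<le> 2 powr (real n * R)" and Md_le: "real Md \<le> 2 powr (real n * R1)"
  shows "(R1, R, D) \<in> single_letter_region pXY pZ d"
proof -
  from code obtain fe fd f and g :: "nat \<Rightarrow> nat \<Rightarrow> 'z list \<Rightarrow> 'xh list" where
    fe_range: "\<forall>ys. length ys = n \<longrightarrow> fe ys \<in> {1..Me}" and
    fd_range: "\<forall>ys. length ys = n \<longrightarrow> fd ys \<in> {1..Md}" and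
    f_range: "\<forall>xs m. length xs = n \<longrightarrow> m \<in> {1..Me} \<longrightarrow> f xs m \<in> {1..M}" and
    distortion: "measure_pmf.expectation (iid n (src pXY pZ))
      (\<lambda>t. let xs = map fst t; ys = map (fst \<circ> snd) t; zs = map (snd \<circ> snd) t;
               xh = g (f xs (fe ys)) (fd ys) zs
           in (1 / real n) * (\<Sum>i<n. d (xs ! i) (xh ! i))) \<le> D"
    unfolding is_code_def by blast
  interpret helper_code pXY pZ n M Me Md fe fd f g
    by standard (use fe_range fd_range f_range in auto)
  have "Md > 0" "M > 0"
    using fd_range[rule_format, of "replicate n undefined"]
      f_range[rule_format, OF _ fe_range[rule_format, of "replicate n undefined"],
        of "replicate n undefined"]
    by simp_all
  then have logs: "log 2 Md \<le> n * R1" "log 2 M \<le> n * R"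
    using M_le Md_le by (simp_all add: log_le_iff)
  let ?H = "cent_Y_given_Z pXY pZ"
  let ?c1 = "\<lambda>i. cent L (Y i) (\<lambda>t. (U i t, Z i t))"
    and ?c2 = "\<lambda>i. cmi L (X i) (W i) (\<lambda>t. (U i t, Z i t))"
    and ?c3 = "\<lambda>i. measure_pmf.expectation L (\<lambda>t. d (X i t) (W i t (Z i t)))"
  have "(\<Sum>i<n. (1 / real n) *\<^sub>R (\<chi> v. pmf pXY v, ?c1 i, ?c2 i, ?c3 i)) \<in> letter_hull pXY pZ d"
    unfolding letter_hull_def using n_pos letter_rates_in_hull[unfolded letter_hull_def]
    by (intro convex_sum convex_convex_hull) auto
  also have "(\<Sum>i<n. (1 / real n) *\<^sub>R (\<chi> v. pmf pXY v, ?c1 i, ?c2 i, ?c3 i)) =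
      (\<chi> v. pmf pXY v, (\<Sum>i<n. ?c1 i) / n, (\<Sum>i<n. ?c2 i) / n, (\<Sum>i<n. ?c3 i) / n)"
    using n_pos by (simp add: prod_eq_iff fst_sum snd_sum sum_constant_scaleR sum_divide_distrib
        del: sum_constant)
  finally show ?thesis
  proof (rule single_letter_regionI)
    show "?H - (\<Sum>i<n. ?c1 i) / n \<le> R1" using sum_Y_rate logs(1) n_pos by (simp add: field_simps)
    show "(\<Sum>i<n. ?c2 i) / n \<le> R" using sum_W_rate logs(2) n_pos by (simp add: field_simps)
    show "(\<Sum>i<n. ?c3 i) / n \<le> D" using distortion by (simp only: sum_distortion)
  qed
qed

lemma achievable_imp_single_letter_region:
  assumes "achievable pXY pZ d D R R_e R_d"
  shows "(R_d, R, D) \<in> single_letter_region pXY pZ d"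
proof (rule closed_sequentially[OF closed_single_letter_region])
  fix k
  define \<delta> where "\<delta> = inverse (real (Suc k))"
  have "\<delta> > 0" by (simp add: \<delta>_def)
  then obtain n M Me Md where "n > 0" "is_code pXY pZ d n M Me Md (D + \<delta>)"
    "real M \<le> 2 powr (real n * (R + \<delta>))" "real Md \<le> 2 powr (real n * (R_d + \<delta>))"
    using assms unfolding achievable_def by (meson order_refl)
  then show "(R_d + inverse (real (Suc k)), R + inverse (real (Suc k)), D + inverse (real (Suc k)))
      \<in> single_letter_region pXY pZ d"
    unfolding \<delta>_def[symmetric] by (rule is_code_imp_single_letter_region)
next
  have "(\<lambda>k. a + inverse (real (Suc k))) \<longlonglongrightarrow> a" for a
    using tendsto_add[OF tendsto_const LIMSEQ_inverse_real_of_nat, of a] by simp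
  then show "(\<lambda>k. (R_d + inverse (real (Suc k)), R + inverse (real (Suc k)),
        D + inverse (real (Suc k))))
      \<longlonglongrightarrow> (R_d, R, D)"
    by (intro tendsto_Pair)
qed

theorem theorem5:
  fixes pXY :: "('x::finite \<times> 'y::finite) pmf"
    and pZ :: "'x \<Rightarrow> 'z::finite pmf"
    and d :: "'x \<Rightarrow> 'xh::finite \<Rightarrow> real"
    and R_e R_d D :: real
  assumes "\<forall>a b. d a b \<ge> 0"
    and "R_e \<ge> R_d" and "R_d \<ge> 0"
  shows "RgO pXY pZ d R_e R_d D = Rreg pXY pZ d R_d D"
proof (intro set_eqI iffI)
  fix R assume "R \<in> Rreg pXY pZ d R_d D"
  then have "achievable pXY pZ d D R R_e R_d"
    using assms(1,2) by (intro RYXZ_imp_achievable) (simp_all add: Rreg_def)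
  then show "R \<in> RgO pXY pZ d R_e R_d D"
    unfolding RgO_def RgO_D_def using closure_subset by fastforce
next
  fix R assume "R \<in> RgO pXY pZ d R_e R_d D"
  then have "(R, R_e, R_d) \<in> closure {(R, R_e, R_d). achievable pXY pZ d D R R_e R_d}"
    by (simp add: RgO_def RgO_D_def)
  also have "\<dots> \<subseteq> (\<lambda>(R, R_e, R_d). (R_d, R, D)) -` single_letter_region pXY pZ d"
    unfolding case_prod_unfold
    by (intro closure_minimal closed_vimage closed_single_letter_region continuous_intros)
      (auto intro: achievable_imp_single_letter_region)
  finally show "R \<in> Rreg pXY pZ d R_d D"
    by (simp add: Rreg_def single_letter_region_imp_RYXZ)
qed

end
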